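(* Let $d\ge 1$, let $(B_n)_{n\ge 0}$ be a branching random walk on $\mathbb{Z}^d$ whose offspring distribution $\mu$ is critical, non-trivial, and sub-exponential, started with a single particle at the origin, and let $L(0)=\sum_{m=0}^\infty B_m(0)$ be the total number of particles that visit the origin. Then $$\mathbb{P}_{\mu,0}\left(L(0)\ge n\right)=\begin{cases}\Theta\bigl(n^{-2/(4-d)}\bigr) & d<4,\\ \exp\left[-\Theta(\sqrt{n})\right] & d=4,\\ \exp\left[-\Theta(n)\right] & d>4\end{cases}$$ for every $n\ge 1$.
   Context: An offspring distribution is a probability measure $\mu$ on $\{0,1,2,\dots\}$. It is critical if it has mean $1$, non-trivial if $\mu(1)<1$, and sub-exponential if there exist positive constants $C',c'$ such that $\mu(n)\le C'e^{-c'n}$ for every $n\ge 1$. Branching random walk: for $x\in\mathbb{Z}^d$, $\mathbb{P}_{\mu,x}$ denotes the law of the branching random walk $(B_n)_{n\ge 0}$ on $\mathbb{Z}^d$ with offspring distribution $\mu$ started with a single particle at $x$. This is the Markov chain on finitely supported functions $\mathbb{Z}^d\to\{0,1,\dots\}$ with $B_0(y)=\mathbf{1}(y=x)$, where $B_n(y)$ is the number of particles at $y$ in generation $n$. At each time step, each particle independently splits into a random number of offspring particles with law $\mu$, and each offspring particle immediately and independently performs one simple random walk step from its parent's location (it moves to a uniformly random one of the $2d$ nearest neighbours). Notation: "$f(n)=\Theta(g(n))$ for every $n\ge 1$" means that there exist positive constants $c,C$, depending only on the offspring distribution $\mu$ and the dimension $d$, such that $c\,g(n)\le f(n)\le C\,g(n)$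 for every $n\ge 1$. An expression $\exp[-\Theta(g(n))]$ stands for $\exp[-f(n)]$ with $f(n)=\Theta(g(n))$ in this sense.
   Formalization: For d ≥ 4 the bounds on the exponent in exp[-Θ(√n)] and exp[-Θ(n)] are claimed for n ≥ 2 only: the starting particle is counted in L(0), so P(L(0) ≥ 1) = 1 and the exponent at n = 1 is 0, which no positive lower constant allows. *)

theory Defs
  imports "HOL-Probability.Probability"
begin

text \<open>The Bochner integral of a non-integrable function is 0, so \<open>critical\<close> entails that
  the mean exists.\<close>
definition critical :: "nat pmf \<Rightarrow> bool" where
  "critical \<mu> \<longleftrightarrow> measure_pmf.expectation \<mu> real = 1"

definition nontrivial :: "nat pmf \<Rightarrow> bool" where
  "nontrivial \<mu> \<longleftrightarrow> pmf \<mu> 1 < 1"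

definition subexponential :: "nat pmf \<Rightarrow> bool" where
  "subexponential \<mu> \<longleftrightarrow> (\<exists>C>0. \<exists>c>0. \<forall>n\<ge>1. pmf \<mu> n \<le> C * exp (- c * real n))"

text \<open>The law on trajectories of the Markov chain started at \<open>x\<close> with transition kernel \<open>K\<close>,
  obtained from the Ionescu-Tulcea theorem. It is characterised by
  \<open>emeasure_markov_law_cylinder\<close> below.\<close>

definition markov_kernel :: "'a \<Rightarrow> ('a \<Rightarrow> 'a pmf) \<Rightarrow> nat \<Rightarrow> (nat \<Rightarrow> 'a) \<Rightarrow> 'a measure" where
  "markov_kernel x K n \<omega> = measure_pmf (if n = 0 then return_pmf x else K (\<omega> (n - 1)))"

definition markov_law :: "'a \<Rightarrow> ('a \<Rightarrow> 'a pmf) \<Rightarrow> (nat \<Rightarrow> 'a) measure" where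
  "markov_law x K =
     projective_family.lim UNIV
       (Ionescu_Tulcea.CI (markov_kernel x K) (\<lambda>_. count_space UNIV)) (\<lambda>_. count_space UNIV)"

lemma Ionescu_Tulcea_markov_kernel:
  "Ionescu_Tulcea (markov_kernel x K) (\<lambda>_. count_space UNIV)"
proof (rule Ionescu_Tulcea.intro)
  fix i :: nat
  show "markov_kernel x K i \<in> PiM {0..<i} (\<lambda>_. count_space UNIV) \<rightarrow>\<^sub>M subprob_algebra (count_space UNIV)"
  proof (cases "i = 0")
    case True
    then show ?thesis
      by (auto simp: markov_kernel_def[abs_def] measure_pmf_in_subprob_algebra intro!: measurable_const)
  next
    case False
    have 1: "(\<lambda>\<omega>. \<omega> (i - 1)) \<in> PiM {0..<i} (\<lambda>_. count_space (UNIV :: 'a set)) \<rightarrow>\<^sub>M count_space UNIV"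
      using False by (intro measurable_component_singleton) auto
    have 2: "(\<lambda>y. measure_pmf (K y)) \<in> count_space UNIV \<rightarrow>\<^sub>M subprob_algebra (count_space UNIV)"
      by (auto simp: measurable_count_space_eq1 measure_pmf_in_subprob_algebra)
    show ?thesis
      using measurable_compose[OF 1 2] False by (simp add: markov_kernel_def[abs_def])
  qed
qed (simp add: markov_kernel_def prob_space_measure_pmf)

interpretation markov: Ionescu_Tulcea "markov_kernel x K" "\<lambda>_. count_space UNIV" for x K
  by (rule Ionescu_Tulcea_markov_kernel)

lemma sets_markov_law [measurable_cong]:
  "sets (markov_law x K) = sets (PiM UNIV (\<lambda>_. count_space UNIV))"
  unfolding markov_law_def by simp

lemma space_markov_law [simp]: "space (markov_law x K) = UNIV"
  unfolding markov_law_def by (simp add: space_PiM)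

lemma emeasure_markov_law:
  assumes [measurable]: "X \<in> sets (PiM {0..<n} (\<lambda>_. count_space UNIV))"
  shows "emeasure (markov_law x K) {\<omega>. restrict \<omega> {0..<n} \<in> X} =
    emeasure (Ionescu_Tulcea.C (markov_kernel x K) (\<lambda>_. count_space UNIV) 0 n (\<lambda>_. undefined)) X"
proof -
  let ?M = "\<lambda>_::nat. count_space (UNIV :: 'a set)"
  have sub: "X \<subseteq> space (PiM {0..<n} ?M)"
    by (rule sets.sets_into_space) fact
  have 1: "prod_emb UNIV ?M {0..<n} X = {\<omega>. restrict \<omega> {0..<n} \<in> X}"
    by (auto simp: prod_emb_def space_PiM)
  have 2: "prod_emb {0..<n} ?M {0..<n} X = X"
    using sub by (rule prod_emb_id[unfolded space_PiM[symmetric]])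
  show ?thesis
    using markov.lim[of "{0..<n}" X x K] markov.emeasure_CI[of "{0..<n}" n X x K] assms
    by (simp add: markov_law_def 1 2)
qed

lemma prob_space_markov_law: "prob_space (markov_law x K)"
proof (rule prob_spaceI)
  let ?C = "Ionescu_Tulcea.C (markov_kernel x K) (\<lambda>_. count_space UNIV) 0 0 (\<lambda>_. undefined)"
  have "emeasure ?C (space ?C) = 1"
    by (intro prob_space.emeasure_space_1 markov.prob_space_C) (simp add: space_PiM)
  moreover have "space ?C = {\<lambda>_. undefined}"
    by (simp add: space_PiM)
  ultimately show "emeasure (markov_law x K) (space (markov_law x K)) = 1"
    using emeasure_markov_law[of "{\<lambda>_. undefined}" 0 x K]
    by (simp add: sets_PiM_empty restrict_def)
qed

theorem emeasure_markov_law_cylinder: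
  "emeasure (markov_law x K) {\<omega>. \<forall>i\<le>n. \<omega> i = b i} =
     (if b 0 = x then ennreal (\<Prod>i<n. pmf (K (b i)) (b (Suc i))) else 0)"
proof -
  let ?M = "\<lambda>_::nat. count_space (UNIV :: 'a set)"
  let ?C = "\<lambda>m. Ionescu_Tulcea.C (markov_kernel x K) ?M 0 m (\<lambda>_. undefined)"
  let ?b = "\<lambda>m. restrict b {0..<m}"
  have b_sets: "{?b m} \<in> sets (PiM {0..<m} ?M)" for m
  proof -
    have "{?b m} = PiE {0..<m} (\<lambda>i. {b i})"
      by (subst PiE_singleton[of "?b m" "{0..<m}", symmetric]) (auto intro!: PiE_cong)
    also have "\<dots> \<in> sets (PiM {0..<m} ?M)"
      by (intro sets_PiM_I_finite) auto
    finally show ?thesis .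
  qed
  have step: "emeasure (?C (Suc m)) {?b (Suc m)} =
      emeasure (markov_kernel x K m (?b m)) {b m} * emeasure (?C m) {?b m}" for m
  proof -
    have u: "(\<lambda>_. undefined) \<in> space (PiM {0..<0} ?M)"
      by (simp add: space_PiM)
    have spC: "space (?C m) = space (PiM {0..<m} ?M)"
      using markov.space_C[OF u, of x K m] by simp
    have stC: "sets (?C m) = sets (PiM {0..<m} ?M)"
      using markov.sets_C[OF u, of x K m] by simp
    have ne: "space (?C m) \<noteq> {}"
      unfolding spC by (simp add: space_PiM PiE_eq_empty_iff)
    have meas: "Ionescu_Tulcea.eP (markov_kernel x K) ?M m \<in> ?C m \<rightarrow>\<^sub>M subprob_algebra (PiM {0..<Suc m} ?M)"
      using markov.measurable_eP[of x K m] by (simp add: measurable_cong_sets[OF stC refl])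
    have "emeasure (?C (Suc m)) {?b (Suc m)} =
        (\<integral>\<^sup>+\<omega>. emeasure (Ionescu_Tulcea.eP (markov_kernel x K) ?M m \<omega>) {?b (Suc m)} \<partial>?C m)"
      using emeasure_bind[OF ne meas b_sets] by simp
    also have "\<dots> = (\<integral>\<^sup>+\<omega>. emeasure (markov_kernel x K m (?b m)) {b m} * indicator {?b m} \<omega> \<partial>?C m)"
    proof (rule nn_integral_cong)
      fix \<omega> assume "\<omega> \<in> space (?C m)"
      then have \<omega>: "\<omega> \<in> space (PiM {0..<m} ?M)"
        by (simp only: spC)
      then have ext: "\<omega> i = undefined" if "i \<notin> {0..<m}" for i
        using that by (auto simp: space_PiM PiE_def extensional_def)
      have "fun_upd \<omega> m -` {?b (Suc m)} = (if \<omega> = ?b m then {b m} else {})"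
      proof -
        have "fun_upd \<omega> m y = ?b (Suc m) \<longleftrightarrow> \<omega> = ?b m \<and> y = b m" for y
          unfolding fun_eq_iff using ext
          by (auto simp: restrict_def less_Suc_eq split: if_splits)
        then show ?thesis by auto
      qed
      then show "emeasure (Ionescu_Tulcea.eP (markov_kernel x K) ?M m \<omega>) {?b (Suc m)} =
          emeasure (markov_kernel x K m (?b m)) {b m} * indicator {?b m} \<omega>"
        by (simp add: markov.emeasure_eP[OF \<omega> b_sets] split: split_indicator)
    qed
    also have "\<dots> = emeasure (markov_kernel x K m (?b m)) {b m} * emeasure (?C m) {?b m}"
      by (rule nn_integral_cmult_indicator) (simp add: stC b_sets)
    finally show ?thesis .
  qed
  have C: "emeasure (?C (Suc n)) {?b (Suc n)} =
      (if b 0 = x then ennreal (\<Prod>i<n. pmf (K (b i)) (b (Suc i))) else 0)"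
  proof (induction n)
    case 0
    have "emeasure (?C 0) {?b 0} = 1"
      using b_sets[of 0] by (simp add: emeasure_return restrict_def)
    then show ?case
      unfolding step[of 0] by (auto simp: markov_kernel_def indicator_def)
  next
    case (Suc n)
    have "emeasure (markov_kernel x K (Suc n) (?b (Suc n))) {b (Suc n)} =
        ennreal (pmf (K (b n)) (b (Suc n)))"
      by (simp add: markov_kernel_def emeasure_pmf_single)
    then show ?case
      unfolding step[of "Suc n"] Suc.IH
      by (simp add: ennreal_mult'[symmetric] prod_nonneg mult.commute)
  qed
  have "{\<omega>. \<forall>i\<le>n. \<omega> i = b i} = {\<omega>. restrict \<omega> {0..<Suc n} \<in> {?b (Suc n)}}"
    by (auto simp: restrict_def fun_eq_iff less_Suc_eq_le)
  then show ?thesis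
    using emeasure_markov_law[OF b_sets, of x K "Suc n"] C by simp
qed

definition neighbours :: "int ^ 'd \<Rightarrow> (int ^ 'd::finite) set" where
  "neighbours x = (\<Union>i. {x + axis i 1, x - axis i 1})"

lemma finite_neighbours [simp]: "finite (neighbours x)"
  by (simp add: neighbours_def)

lemma neighbours_nonempty [simp]: "neighbours x \<noteq> {}"
  by (simp add: neighbours_def)

lemma card_neighbours: "card (neighbours (x :: int ^ 'd)) = 2 * CARD('d::finite)"
proof -
  have ax: "(axis i (a::int) :: int ^ 'd) = axis j b \<longleftrightarrow> i = j \<and> a = b" if "a \<noteq> 0" for i j a b
    using that by (auto simp: axis_eq_axis)
  define f :: "'d \<times> bool \<Rightarrow> int ^ 'd" where "f = (\<lambda>(i, s). x + axis i (if s then 1 else -1))"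
  have neg: "- axis i (1::int) = (axis i (-1) :: int ^ 'd)" for i
    by (simp add: vec_eq_iff axis_def)
  have "f ` UNIV = (\<Union>i. {f (i, True), f (i, False)})"
    by (auto simp: UNIV_Times_UNIV[symmetric] UNIV_bool simp del: UNIV_Times_UNIV)
  then have "neighbours x = f ` UNIV"
    by (simp add: neighbours_def f_def neg[symmetric])
  moreover have "inj f"
    by (auto simp: inj_on_def f_def ax split: if_splits)
  ultimately show ?thesis
    by (simp add: card_image card_prod UNIV_Times_UNIV[symmetric] del: UNIV_Times_UNIV)
qed

text \<open>A configuration, i.e. a finitely supported function from sites to \<open>nat\<close>, is a multiset \<open>B\<close> of
  sites; \<open>count B y\<close> is the number of particles at \<open>y\<close>.\<close>
type_synonym 'd config = "(int ^ 'd) multiset"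

definition offspring :: "nat pmf \<Rightarrow> int ^ 'd \<Rightarrow> 'd::finite config pmf" where
  "offspring \<mu> y = do {
     k \<leftarrow> \<mu>;
     map_pmf mset (replicate_pmf k (pmf_of_set (neighbours y)))
   }"

text \<open>The particles of a configuration, those at the same site being told apart by an index.\<close>
definition particles :: "'d config \<Rightarrow> ((int ^ 'd::finite) \<times> nat) set" where
  "particles B = {(y, i). i < count B y}"

definition brw_step :: "nat pmf \<Rightarrow> 'd config \<Rightarrow> 'd::finite config pmf" where
  "brw_step \<mu> B =
     map_pmf (\<lambda>\<xi>. \<Sum>p\<in>particles B. \<xi> p) (Pi_pmf (particles B) {#} (\<lambda>(y, i). offspring \<mu> y))"

lemma finite_particles [simp]: "finite (particles B)"
proof -
  have "particles B = (SIGMA y:set_mset B. {..<count B y})"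
    by (auto simp: particles_def dest: gr_implies_not0 intro: count_inI)
  then show ?thesis by simp
qed

definition brw_law :: "nat pmf \<Rightarrow> int ^ 'd \<Rightarrow> (nat \<Rightarrow> 'd::finite config) measure" where
  "brw_law \<mu> x = markov_law {#x#} (brw_step \<mu>)"

text \<open>\<open>total_visits B y\<close> is \<open>L(y)\<close> for the trajectory \<open>B\<close>; it may be infinite.\<close>
definition total_visits :: "(nat \<Rightarrow> 'd config) \<Rightarrow> int ^ 'd::finite \<Rightarrow> ennreal" where
  "total_visits B y = (\<Sum>m. of_nat (count (B m) y))"

lemma measurable_total_visits [measurable]:
  "(\<lambda>B. total_visits B y) \<in> borel_measurable (brw_law \<mu> x)"
proof -
  have "(\<lambda>B. of_nat (count (B m) y) :: ennreal) \<in> borel_measurable (PiM UNIV (\<lambda>_. count_space UNIV))" for m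
    by (rule measurable_compose[OF measurable_component_singleton]) auto
  then show ?thesis
    unfolding total_visits_def brw_law_def measurable_cong_sets[OF sets_markov_law refl]
    by (rule borel_measurable_suminf_order)
qed

lemma prob_total_visits_ge_1:
  fixes x :: "int ^ 'd::finite"
  shows "\<P>(B in brw_law \<mu> x. of_nat 1 \<le> total_visits B x) = 1"
proof -
  interpret prob_space "brw_law \<mu> x"
    unfolding brw_law_def by (rule prob_space_markov_law)
  have 1: "emeasure (brw_law \<mu> x) {B. \<forall>i\<le>0. B i = {#x#}} = 1"
    unfolding brw_law_def using emeasure_markov_law_cylinder[of "{#x#}" "brw_step \<mu>" 0 "\<lambda>_. {#x#}"]
    by simp
  let ?E = "{B \<in> space (brw_law \<mu> x). of_nat 1 \<le> total_visits B x}"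
  have E: "?E \<in> sets (brw_law \<mu> x)"
    by measurable
  have "B \<in> ?E" if "\<forall>i\<le>0. B i = {#x#}" for B :: "nat \<Rightarrow> 'd config"
  proof -
    have "B 0 = {#x#}"
      using that by blast
    then have "(1::ennreal) = (\<Sum>m\<in>{0}. of_nat (count (B m) x))"
      by simp
    also have "\<dots> \<le> total_visits B x"
      unfolding total_visits_def by (rule sum_le_suminf) auto
    finally show ?thesis
      by (simp add: brw_law_def)
  qed
  then have "1 \<le> emeasure (brw_law \<mu> x) ?E"
    unfolding 1[symmetric] by (intro emeasure_mono E) auto
  then have "1 \<le> prob ?E"
    by (simp add: emeasure_eq_measure)
  then show ?thesis
    using prob_le_1[of ?E] by linarith
qed

definition Theta_from :: "nat \<Rightarrow> (nat \<Rightarrow> real) \<Rightarrow> (nat \<Rightarrow> real) \<Rightarrow> bool" where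
  "Theta_from n0 f g \<longleftrightarrow> (\<exists>c>0. \<exists>C>0. \<forall>n\<ge>n0. c * g n \<le> f n \<and> f n \<le> C * g n)"

text \<open>\<open>p(n) = exp[-\<Theta>(g(n))]\<close> for every \<open>n \<ge> 1\<close>. The starting particle is counted in \<open>L(0)\<close>, so
  \<open>L(0) \<ge> 1\<close> has probability 1 (\<open>prob_total_visits_ge_1\<close>) and the exponent \<open>f 1\<close> is necessarily 0.
  Hence the two-sided bound on the exponent can only be, and is, required from \<open>n = 2\<close> on.\<close>
definition exp_minus_Theta :: "(nat \<Rightarrow> real) \<Rightarrow> (nat \<Rightarrow> real) \<Rightarrow> bool" where
  "exp_minus_Theta p g \<longleftrightarrow> (\<exists>f. (\<forall>n\<ge>1. p n = exp (- f n)) \<and> Theta_from 2 f g)"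

end

theory Submission
  imports Defs
begin

text \<open>Let \<open>L_N\<close> be the number of visits to the origin before generation \<open>N\<close>. A critical branching
  process survives to generation \<open>N\<close> with probability \<open>O(1/N)\<close>, so the tail of \<open>L(0)\<close> is that of
  \<open>L_N\<close> up to \<open>O(1/N)\<close>. The generating function of \<open>L_N\<close> and its binomial moments satisfy recursions in \<open>N\<close>
  driven by the averaging operator of the simple random walk, whose transition probabilities are
  bounded by \<open>C m powr (-d/2)\<close>.

  For \<open>d < 4\<close> the upper bound is Markov's inequality for the \<open>d\<close>-th moment of \<open>L_N\<close> with
  \<open>n = N powr ((4 - d)/2)\<close>; for the lower bound, the visits in the generations \<open>{N..<4 * N}\<close> are positive
  with probability \<open>O(1/N)\<close>, and Paley--Zygmund shows that given this they are of order \<open>n\<close> with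
  positive probability.

  For \<open>d > 4\<close> the function \<open>h(x) = 1/(\<bar>x\<bar>^2 + 30)\<close> satisfies \<open>P h \<le> h - c h^2\<close>, hence \<open>1 + \<epsilon> h\<close> dominates the
  generating function of \<open>L_N\<close> at a fixed point above 1 for all \<open>N\<close>. For \<open>d = 4\<close> the concave function
  \<open>h/(T + ln h)\<close> with \<open>T\<close> of order \<open>ln N\<close> takes its place; it handles the point \<open>1 + c/T\<close>, and
  \<open>N = exp (sqrt n)\<close> gives the upper bound. For the lower bound in \<open>d = 4\<close>, summing the moment recursion over
  dyadic shells shows that the \<open>k\<close>-th binomial moment of \<open>L(0)\<close> is at least \<open>c^k k^k\<close>. By the upper bound
  the \<open>2k\<close>-th moment is at most \<open>C^k k^(4 * k)\<close>, and Paley--Zygmund for \<open>L_N^k\<close> yields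
  \<open>L(0) \<ge> c k^2\<close> with probability at least \<open>\<rho>^k\<close>.\<close>

section \<open>Visits before a fixed generation\<close>

text \<open>Why the \<open>d\<close>-th moment when \<open>d < 4\<close>: a process alive at
  generation \<open>N\<close> makes about \<open>N powr (1/s)\<close> visits,
  \<open>s = 2/(4 - d)\<close>, and so contributes order \<open>N powr (k/s - 1)\<close> to the
  \<open>k\<close>-th moment. For \<open>k > s\<close> this contribution dominates and Markov's
  inequality loses only a constant; the least such integer is \<open>d\<close>. A bound
  \<open>1 + g\<close> for the generating function needs \<open>P g + A * (P g)^2 <= g\<close>,
  where \<open>A\<close> bounds the curvature of the offspring law. In the continuum the Laplacian
  of \<open>|x|^-2\<close> is \<open>-2 (d - 4) |x|^-4\<close>: a gain of order \<open>h^2\<close>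
  if \<open>d > 4\<close>, none if \<open>d = 4\<close>. There the strict concavity of
  \<open>h/(T + ln h)\<close> supplies a gain of order \<open>h^2/(T + ln h)^2\<close>. This
  function is usable only where \<open>T + ln h\<close> is positive, that is on a ball, which forces
  the cut at generation \<open>N\<close>. The obvious strategy of going back and forth to the origin
  yields only \<open>exp (-O(n))\<close>, so \<open>d = 4\<close> needs high moments. The upper
  bound enters the lower one because the bound on the \<open>2k\<close>-th moment and the square of
  the bound on the \<open>k\<close>-th carry the same power of \<open>k\<close>; only a factor
  \<open>\<rho>^k\<close> is lost.\<close>

primrec path_pmf :: "('a \<Rightarrow> 'a pmf) \<Rightarrow> nat \<Rightarrow> 'a \<Rightarrow> 'a list pmf" where
  "path_pmf K 0 b = return_pmf []"
| "path_pmf K (Suc n) b = map_pmf (Cons b) (bind_pmf (K b) (path_pmf K n))"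

text \<open>The same product as in \<open>emeasure_markov_law_cylinder\<close>, so that the two laws
  can be compared point by point.\<close>

lemma pmf_path_pmf:
  "pmf (path_pmf K (Suc n) b) bs =
     (if length bs = Suc n \<and> bs ! 0 = b then \<Prod>i<n. pmf (K (bs ! i)) (bs ! Suc i) else 0)"
proof (induction n arbitrary: b bs)
  case 0
  show ?case
  proof -
    have "path_pmf K 0 = (\<lambda>_. return_pmf [])"
      by auto
    then show ?thesis
      by (cases bs) (auto simp: indicator_def)
  qed
next
  case (Suc n)
  show ?case
  proof (cases bs)
    case Nil
    then have "Nil \<notin> Cons b ` set_pmf (bind_pmf (K b) (path_pmf K (Suc n)))"
      by auto
    then have "pmf (path_pmf K (Suc (Suc n)) b) [] = 0"
      unfolding path_pmf.simps(2)[of K "Suc n"] by (rule pmf_map_outside)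
    with Nil show ?thesis by simp
  next
    case (Cons c cs)
    show ?thesis
    proof (cases "c = b")
      case False
      then have "c # cs \<notin> Cons b ` set_pmf (bind_pmf (K b) (path_pmf K (Suc n)))"
        by auto
      then have "pmf (path_pmf K (Suc (Suc n)) b) (c # cs) = 0"
        unfolding path_pmf.simps(2)[of K "Suc n"] by (rule pmf_map_outside)
      with Cons False show ?thesis by simp
    next
      case True
      have "pmf (path_pmf K (Suc (Suc n)) b) (b # cs) = pmf (bind_pmf (K b) (path_pmf K (Suc n))) cs"
        unfolding path_pmf.simps(2)[of K "Suc n"] by (rule pmf_map_inj') (auto simp: inj_def)
      also have "\<dots> = measure_pmf.expectation (K b) (\<lambda>b'. pmf (path_pmf K (Suc n) b') cs)"
        by (rule pmf_bind)
      also have "\<dots> = measure_pmf.expectation (K b) (\<lambda>b'.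
          (if length cs = Suc n then \<Prod>i<n. pmf (K (cs ! i)) (cs ! Suc i) else 0) * indicator {cs ! 0} b')"
        unfolding Suc.IH by (intro Bochner_Integration.integral_cong) (auto simp: indicator_def)
      also have "\<dots> = (if length cs = Suc n then \<Prod>i<n. pmf (K (cs ! i)) (cs ! Suc i) else 0) * pmf (K b) (cs ! 0)"
        by (simp add: measure_pmf_single)
      also have "\<dots> = (if length (b # cs) = Suc (Suc n) \<and> (b # cs) ! 0 = b
          then \<Prod>i<Suc n. pmf (K ((b # cs) ! i)) ((b # cs) ! Suc i) else 0)"
        by (simp add: prod.lessThan_Suc_shift mult.commute del: prod.lessThan_Suc)
      finally show ?thesis
        using Cons True by simp
    qed
  qed
qed

lemma measurable_markov_law_cylinder:
  "{\<omega>. \<forall>i\<le>n. \<omega> i = b i} \<in> sets (markov_law x K)"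
proof -
  have "{\<omega>. \<forall>i\<le>n. \<omega> i = b i} = (\<Inter>i\<in>{..n}. (\<lambda>\<omega>. \<omega> i) -` {b i} \<inter> space (PiM UNIV (\<lambda>_. count_space UNIV)))"
    by (auto simp: space_PiM)
  also have "\<dots> \<in> sets (PiM UNIV (\<lambda>_. count_space UNIV))"
    by (intro sets.finite_INT measurable_sets[OF measurable_component_singleton]) auto
  finally show ?thesis
    by (simp add: sets_markov_law)
qed

text \<open>With countably many states a law on lists is determined by its point masses, and these
  are cylinder probabilities. This is the bridge from the trajectory measure to pmfs.\<close>

lemma distr_markov_law_prefix:
  fixes x :: 'a
  assumes "countable (UNIV :: 'a set)"
  shows "(\<lambda>\<omega>. map \<omega> [0..<Suc n]) \<in> markov_law x K \<rightarrow>\<^sub>M count_space UNIV" (is ?meas)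
    and "distr (markov_law x K) (count_space UNIV) (\<lambda>\<omega>. map \<omega> [0..<Suc n]) = measure_pmf (path_pmf K (Suc n) x)" (is ?eq)
proof -
  have c: "countable (UNIV :: 'a list set)"
    using assms by (metis countable_lists lists_UNIV)
  have single: "(\<lambda>\<omega>. map \<omega> [0..<Suc n]) -` {bs} =
      (if length bs = Suc n then {\<omega>. \<forall>i\<le>n. \<omega> i = bs ! i} else {})" for bs :: "'a list"
  proof -
    have "map \<omega> [0..<Suc n] = bs \<longleftrightarrow> length bs = Suc n \<and> (\<forall>i\<le>n. \<omega> i = bs ! i)" for \<omega> :: "nat \<Rightarrow> 'a"
      by (subst list_eq_iff_nth_eq) (auto simp: less_Suc_eq_le simp del: upt_Suc)
    then show ?thesis by auto
  qed
  show m: ?meas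
    unfolding measurable_count_space_eq_countable[OF c]
    by (auto simp: single measurable_markov_law_cylinder simp del: upt_Suc)
  show ?eq
  proof (rule measure_eqI_countable[of _ UNIV])
    fix bs :: "'a list"
    have "emeasure (distr (markov_law x K) (count_space UNIV) (\<lambda>\<omega>. map \<omega> [0..<Suc n])) {bs} =
        emeasure (markov_law x K) ((\<lambda>\<omega>. map \<omega> [0..<Suc n]) -` {bs})"
      using m by (subst emeasure_distr) auto
    also have "\<dots> = emeasure (measure_pmf (path_pmf K (Suc n) x)) {bs}"
      unfolding single emeasure_pmf_single pmf_path_pmf
      by (auto simp: emeasure_markov_law_cylinder)
    finally show "emeasure (distr (markov_law x K) (count_space UNIV) (\<lambda>\<omega>. map \<omega> [0..<Suc n])) {bs} =
        emeasure (measure_pmf (path_pmf K (Suc n) x)) {bs}" .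
  qed (auto simp: c)
qed

text \<open>\<open>occ \<mu> [\<phi>\<^sub>0, \<phi>\<^sub>1, \<dots>] B\<close> is the law of the sum over \<open>i\<close> of \<open>\<phi>\<^sub>i\<close> summed over generation \<open>i\<close>; for
  \<open>replicate N at_origin\<close> it is the law of the visits to the origin before generation \<open>N\<close>.\<close>

primrec occ :: "nat pmf \<Rightarrow> (int ^ 'd \<Rightarrow> nat) list \<Rightarrow> 'd::finite config \<Rightarrow> nat pmf" where
  "occ \<mu> [] B = return_pmf 0"
| "occ \<mu> (\<phi> # \<phi>s) B = map_pmf (\<lambda>k. (\<Sum>x\<in>#B. \<phi> x) + k) (bind_pmf (brw_step \<mu> B) (occ \<mu> \<phi>s))"

lemma occ_eq_map_path:
  "occ \<mu> \<phi>s B = map_pmf (\<lambda>Bs. \<Sum>i<length \<phi>s. \<Sum>x\<in>#Bs ! i. (\<phi>s ! i) x) (path_pmf (brw_step \<mu>) (length \<phi>s) B)"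
proof (induction \<phi>s arbitrary: B)
  case Nil
  then show ?case by simp
next
  case (Cons \<phi> \<phi>s)
  show ?case
    by (simp add: Cons.IH[abs_def] map_bind_pmf map_pmf_comp sum.lessThan_Suc_shift del: sum.lessThan_Suc)
qed

lemma countable_multiset: "countable (UNIV :: ('a::countable) multiset set)"
proof -
  have "UNIV = mset ` (UNIV :: 'a list set)"
    by (metis ex_mset surj_def)
  then show ?thesis
    by (metis countableI_type countable_image)
qed

definition at_origin :: "int ^ 'd::finite \<Rightarrow> nat" where
  "at_origin x = (if x = 0 then 1 else 0)"

lemma sum_at_origin: "(\<Sum>x\<in>#B. at_origin x) = count B 0"
  by (induction B) (auto simp: at_origin_def)

lemma prob_visits_before:
  fixes x :: "int ^ 'd::finite"
  shows "{B. n \<le> (\<Sum>m<N. count (B m) 0)} \<in> sets (brw_law \<mu> x)"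
    and "measure (brw_law \<mu> x) {B. n \<le> (\<Sum>m<N. count (B m) 0)} =
      measure (occ \<mu> (replicate N at_origin) {#x#}) {n..}"
proof -
  have c: "countable (UNIV :: 'd config set)"
    by (rule countable_multiset)
  interpret prob_space "brw_law \<mu> x"
    unfolding brw_law_def by (rule prob_space_markov_law)
  have "{B. n \<le> (\<Sum>m<N. count (B m) 0)} \<in> sets (brw_law \<mu> x) \<and>
      measure (brw_law \<mu> x) {B. n \<le> (\<Sum>m<N. count (B m) 0)} =
      measure (occ \<mu> (replicate N at_origin) {#x#}) {n..}"
  proof (cases N)
    case 0
    have "space (brw_law \<mu> x) = UNIV"
      by (simp add: brw_law_def)
    then show ?thesis
      using 0 prob_space sets.top[of "brw_law \<mu> x"] by (auto simp: indicator_def)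
  next
    case (Suc M)
    define S where "S = {Bs :: 'd config list. n \<le> (\<Sum>m<N. count (Bs ! m) 0)}"
    let ?f = "\<lambda>B :: nat \<Rightarrow> 'd config. map B [0..<N]"
    have eq: "{B. n \<le> (\<Sum>m<N. count (B m) 0)} = ?f -` S \<inter> space (brw_law \<mu> x)"
      by (auto simp: S_def brw_law_def)
    have m: "?f \<in> brw_law \<mu> x \<rightarrow>\<^sub>M count_space UNIV"
      unfolding Suc brw_law_def by (rule distr_markov_law_prefix[OF c])
    have "measure (brw_law \<mu> x) (?f -` S \<inter> space (brw_law \<mu> x)) =
        measure (distr (brw_law \<mu> x) (count_space UNIV) ?f) S"
      using m by (simp add: measure_distr)
    also have "\<dots> = measure (path_pmf (brw_step \<mu>) N {#x#}) S"
      unfolding Suc brw_law_def distr_markov_law_prefix(2)[OF c] ..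
    also have "\<dots> = measure (occ \<mu> (replicate N at_origin) {#x#}) {n..}"
      unfolding occ_eq_map_path measure_map_pmf
      by (simp add: S_def sum_at_origin vimage_def)
    finally show ?thesis
      unfolding eq using measurable_sets[OF m, of S] by auto
  qed
  then show "{B. n \<le> (\<Sum>m<N. count (B m) 0)} \<in> sets (brw_law \<mu> x)"
    and "measure (brw_law \<mu> x) {B. n \<le> (\<Sum>m<N. count (B m) 0)} =
      measure (occ \<mu> (replicate N at_origin) {#x#}) {n..}" by blast+
qed

lemma total_visits_ge_iff:
  "of_nat n \<le> total_visits B (0 :: int ^ 'd::finite) \<longleftrightarrow> (\<exists>N. n \<le> (\<Sum>m<N. count (B m) 0))"
proof
  assume "\<exists>N. n \<le> (\<Sum>m<N. count (B m) 0)"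
  then obtain N where "n \<le> (\<Sum>m<N. count (B m) 0)" ..
  then have "(of_nat n :: ennreal) \<le> of_nat (\<Sum>m<N. count (B m) 0)"
    using of_nat_mono by blast
  also have "\<dots> = (\<Sum>m<N. of_nat (count (B m) 0))"
    by simp
  also have "\<dots> \<le> total_visits B 0"
    unfolding total_visits_def by (rule sum_le_suminf) auto
  finally show "of_nat n \<le> total_visits B 0" .
next
  assume *: "of_nat n \<le> total_visits B 0"
  show "\<exists>N. n \<le> (\<Sum>m<N. count (B m) 0)"
  proof (rule ccontr)
    assume "\<not> ?thesis"
    then have less: "(\<Sum>m<N. count (B m) 0) < n" for N
      by (simp add: not_le)
    \<comment> \<open>Integrality gives room: the partial sums are at most \<open>n - 1\<close>, and
      this non-strict bound, unlike the strict one, survives the passage to the infinite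
      sum.\<close>
    then have "(\<Sum>m<N. of_nat (count (B m) 0)) \<le> (of_nat (n - 1) :: ennreal)" for N
    proof -
      have "(\<Sum>m<N. count (B m) 0) \<le> n - 1"
        using less[of N] by linarith
      then have "(of_nat (\<Sum>m<N. count (B m) 0) :: ennreal) \<le> of_nat (n - 1)"
        using of_nat_mono by blast
      then show ?thesis by simp
    qed
    then have "total_visits B 0 \<le> of_nat (n - 1)"
      unfolding total_visits_def by (intro suminf_le_const) auto
    with * have "(of_nat n :: ennreal) \<le> of_nat (n - 1)"
      by (rule order_trans)
    moreover have "0 < n"
      using less[of 0] by simp
    ultimately show False
      by simp
  qed
qed

definition visit_tail :: "'d::finite itself \<Rightarrow> nat pmf \<Rightarrow> nat \<Rightarrow> real" where
  "visit_tail _ \<mu> n = \<P>(B in brw_law \<mu> (0 :: int ^ 'd). of_nat n \<le> total_visits B 0)"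

lemma visit_tail_LIMSEQ:
  "(\<lambda>N. measure (occ \<mu> (replicate N at_origin) {#0 :: int ^ 'd::finite#}) {n..}) \<longlonglongrightarrow> visit_tail TYPE('d) \<mu> n"
proof -
  interpret prob_space "brw_law \<mu> (0 :: int ^ 'd)"
    unfolding brw_law_def by (rule prob_space_markov_law)
  let ?A = "\<lambda>N. {B :: nat \<Rightarrow> 'd config. n \<le> (\<Sum>m<N. count (B m) 0)}"
  have "(\<lambda>N. measure (brw_law \<mu> (0 :: int ^ 'd)) (?A N)) \<longlonglongrightarrow> measure (brw_law \<mu> (0 :: int ^ 'd)) (\<Union>N. ?A N)"
  proof (rule finite_Lim_measure_incseq)
    show "range ?A \<subseteq> events"
      using prob_visits_before(1) by blast
    show "incseq ?A"
    proof (rule incseq_SucI)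
      show "?A i \<subseteq> ?A (Suc i)" for i
        by auto
    qed
  qed
  moreover have "(\<Union>N. ?A N) = {B \<in> space (brw_law \<mu> (0 :: int ^ 'd)). of_nat n \<le> total_visits B 0}"
    by (auto simp: total_visits_ge_iff brw_law_def)
  ultimately show ?thesis
    by (simp add: prob_visits_before(2) visit_tail_def)
qed

lemma incseq_prob_visits_before:
  "incseq (\<lambda>N. measure (occ \<mu> (replicate N at_origin) {#0 :: int ^ 'd::finite#}) {n..})"
proof (rule incseq_SucI)
  fix N
  interpret prob_space "brw_law \<mu> (0 :: int ^ 'd)"
    unfolding brw_law_def by (rule prob_space_markov_law)
  show "measure (occ \<mu> (replicate N at_origin) {#0 :: int ^ 'd::finite#}) {n..} \<le>
    measure (occ \<mu> (replicate (Suc N) at_origin) {#0 :: int ^ 'd::finite#}) {n..}"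
    unfolding prob_visits_before(2)[symmetric]
    by (intro finite_measure_mono) (auto simp: prob_visits_before(1) simp del: sum.lessThan_Suc intro: order_trans[OF _ sum_mono2])
qed

lemma visit_tail_ge:
  "measure (occ \<mu> (replicate N at_origin) {#0 :: int ^ 'd::finite#}) {n..} \<le> visit_tail TYPE('d) \<mu> n"
  using incseq_le[OF incseq_prob_visits_before visit_tail_LIMSEQ] .

lemma visit_tail_leI:
  assumes "\<And>N. N0 \<le> N \<Longrightarrow> measure (occ \<mu> (replicate N at_origin) {#0 :: int ^ 'd::finite#}) {n..} \<le> c"
  shows "visit_tail TYPE('d) \<mu> n \<le> c"
  by (rule LIMSEQ_le_const2[OF visit_tail_LIMSEQ]) (use assms in blast)

section \<open>Binomial moments and generating functions of the visits\<close>

text \<open>Stated for commutative monoids because it is used both for configurations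
  (\<open>brw_step_plus\<close>) and for numbers of visits (\<open>occ_plus\<close>).\<close>

definition conv :: "'a::comm_monoid_add pmf \<Rightarrow> 'a pmf \<Rightarrow> 'a pmf" where
  "conv p q = bind_pmf p (\<lambda>a. bind_pmf q (\<lambda>b. return_pmf (a + b)))"

primrec convpow :: "nat \<Rightarrow> 'a::comm_monoid_add pmf \<Rightarrow> 'a pmf" where
  "convpow 0 p = return_pmf 0"
| "convpow (Suc k) p = conv p (convpow k p)"

lemma conv_return_0 [simp]: "conv (return_pmf 0) q = q"
  by (simp add: conv_def bind_return_pmf bind_return_pmf')

lemma conv_assoc: "conv (conv p q) r = conv p (conv q r)"
  by (simp add: conv_def bind_assoc_pmf bind_return_pmf add.assoc)

lemma map_plus_conv:
  "map_pmf (\<lambda>k. (m + n) + k) (conv p q) = conv (map_pmf (\<lambda>k. m + k) p) (map_pmf (\<lambda>k. n + k) q)"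
  by (simp add: conv_def map_pmf_def bind_assoc_pmf bind_return_pmf ac_simps)

text \<open>Independence is inherited by the next generation: a kernel that turns sums into
  convolutions commutes with convolution. The proof only exchanges the order of two independent
  draws.\<close>

lemma bind_conv:
  assumes "\<And>a b. f (a + b) = conv (f a) (f b)"
  shows "bind_pmf (conv p q) f = conv (bind_pmf p f) (bind_pmf q f)"
proof -
  have "bind_pmf (conv p q) f =
      bind_pmf p (\<lambda>a. bind_pmf q (\<lambda>b. bind_pmf (f a) (\<lambda>i. bind_pmf (f b) (\<lambda>j. return_pmf (i + j)))))"
    unfolding conv_def bind_assoc_pmf bind_return_pmf assms by (simp add: conv_def)
  also have "\<dots> = bind_pmf p (\<lambda>a. bind_pmf (f a) (\<lambda>i. bind_pmf q (\<lambda>b. bind_pmf (f b) (\<lambda>j. return_pmf (i + j)))))"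
    by (subst bind_commute_pmf) (rule refl)
  also have "\<dots> = conv (bind_pmf p f) (bind_pmf q f)"
    by (simp add: conv_def bind_assoc_pmf)
  finally show ?thesis .
qed

lemma bind_convpow:
  assumes "\<And>a b. f (a + b) = conv (f a) (f b)" and "f 0 = return_pmf 0"
  shows "bind_pmf (convpow k p) f = convpow k (bind_pmf p f)"
  by (induction k) (simp_all add: bind_conv[OF assms(1)] bind_return_pmf assms(2))

lemma particles_empty [simp]: "particles {#} = {}"
  by (simp add: particles_def)

lemma particles_add_mset: "particles (add_mset y B) = insert (y, count B y) (particles B)"
  by (auto simp: particles_def split: if_splits)

lemma brw_step_empty [simp]: "brw_step \<mu> {#} = return_pmf {#}"
  by (simp add: brw_step_def)

text \<open>The new particle receives the first free index \<open>count B y\<close>, so one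
  coordinate of the product law splits off and the others are unchanged.\<close>

lemma brw_step_add_mset: "brw_step \<mu> (add_mset y B) = conv (offspring \<mu> y) (brw_step \<mu> B)"
proof -
  have *: "(y, count B y) \<notin> particles B"
    by (simp add: particles_def)
  then have "(\<Sum>p\<in>particles B. if p = (y, count B y) then \<xi> else f p) = (\<Sum>p\<in>particles B. f p)" for f and \<xi> :: "'a config"
    by (intro sum.cong) auto
  then show ?thesis
    using * by (simp add: brw_step_def conv_def particles_add_mset Pi_pmf_insert' map_bind_pmf bind_map_pmf)
qed

lemma brw_step_plus: "brw_step \<mu> (A + B) = conv (brw_step \<mu> A) (brw_step \<mu> B)"
  by (induction A) (simp_all add: brw_step_add_mset conv_assoc)

lemma occ_empty [simp]: "occ \<mu> \<phi>s {#} = return_pmf 0"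
  by (induction \<phi>s) (simp_all add: bind_return_pmf)

text \<open>The branching property: the progenies of \<open>A\<close> and of \<open>B\<close> evolve
  independently.\<close>

lemma occ_plus: "occ \<mu> \<phi>s (A + B) = conv (occ \<mu> \<phi>s A) (occ \<mu> \<phi>s B)"
proof (induction \<phi>s arbitrary: A B)
  case Nil
  then show ?case by simp
next
  case (Cons \<phi> \<phi>s)
  show ?case
    by (simp add: brw_step_plus bind_conv[OF Cons.IH] map_plus_conv)
qed

lemma mset_replicate_pmf:
  "map_pmf mset (replicate_pmf k p) = convpow k (map_pmf (\<lambda>y. {#y#}) p)"
proof (induction k)
  case (Suc k)
  show ?case
    by (simp add: map_bind_pmf conv_def bind_map_pmf Suc.IH[symmetric])
qed simp

text \<open>The recursion behind all estimates. The children are independent and each sits at a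
  uniform neighbour, so given their number \<open>k\<close> the later visits are a
  \<open>k\<close>-fold convolution of a single law averaged over the neighbours.\<close>

lemma occ_single:
  "occ \<mu> (\<phi> # \<phi>s) {#x#} = map_pmf (\<lambda>k. \<phi> x + k) (bind_pmf \<mu> (\<lambda>k.
     convpow k (bind_pmf (pmf_of_set (neighbours x)) (\<lambda>y. occ \<mu> \<phi>s {#y#}))))"
proof -
  have "brw_step \<mu> {#x#} = offspring \<mu> x"
    using brw_step_add_mset[of \<mu> x "{#}"]
    by (simp add: conv_def bind_return_pmf bind_return_pmf')
  moreover have "bind_pmf (map_pmf mset (replicate_pmf k (pmf_of_set (neighbours x)))) (occ \<mu> \<phi>s) =
      convpow k (bind_pmf (pmf_of_set (neighbours x)) (\<lambda>y. occ \<mu> \<phi>s {#y#}))" for k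
    unfolding mset_replicate_pmf
    by (subst bind_convpow) (simp_all add: occ_plus bind_map_pmf)
  ultimately show ?thesis
    by (simp add: offspring_def bind_assoc_pmf)
qed

text \<open>Valued in \<open>ennreal\<close>, so that no integrability has to be carried through the
  recursions.\<close>

definition avg :: "(int ^ 'd \<Rightarrow> ennreal) \<Rightarrow> int ^ 'd::finite \<Rightarrow> ennreal" where
  "avg u x = (\<integral>\<^sup>+y. u y \<partial>pmf_of_set (neighbours x))"

lemma nn_integral_conv_prod:
  fixes f :: "'a::comm_monoid_add \<Rightarrow> ennreal"
  assumes "\<And>a b. f (a + b) = g a * h b"
  shows "(\<integral>\<^sup>+k. f k \<partial>conv p q) = (\<integral>\<^sup>+k. g k \<partial>p) * (\<integral>\<^sup>+k. h k \<partial>q)"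
  by (simp add: conv_def assms nn_integral_cmult nn_integral_multc)

definition gf :: "ennreal \<Rightarrow> nat pmf \<Rightarrow> ennreal" where
  "gf z p = (\<integral>\<^sup>+k. z ^ k \<partial>p)"

lemma gf_conv: "gf z (conv p q) = gf z p * gf z q"
  unfolding gf_def by (rule nn_integral_conv_prod) (rule power_add)

lemma gf_convpow: "gf z (convpow k p) = gf z p ^ k"
  by (induction k) (simp_all add: gf_conv, simp add: gf_def)

lemma gf_occ_Cons:
  "gf z (occ \<mu> (\<phi> # \<phi>s) {#x#}) = z ^ \<phi> x * gf (avg (\<lambda>y. gf z (occ \<mu> \<phi>s {#y#})) x) \<mu>"
proof -
  have "gf z (bind_pmf \<mu> (\<lambda>k. convpow k (bind_pmf (pmf_of_set (neighbours x)) (\<lambda>y. occ \<mu> \<phi>s {#y#})))) =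
      (\<integral>\<^sup>+k. gf z (convpow k (bind_pmf (pmf_of_set (neighbours x)) (\<lambda>y. occ \<mu> \<phi>s {#y#}))) \<partial>\<mu>)"
    by (simp add: gf_def)
  also have "\<dots> = gf (avg (\<lambda>y. gf z (occ \<mu> \<phi>s {#y#})) x) \<mu>"
    unfolding gf_convpow by (simp add: gf_def avg_def)
  finally show ?thesis
    unfolding occ_single by (simp add: gf_def power_add nn_integral_cmult)
qed

text \<open>The factorial moment divided by \<open>k!\<close>. In this normalisation Vandermonde's
  identity makes convolution a Cauchy product (\<open>bm_conv\<close>).\<close>

definition bm :: "nat \<Rightarrow> nat pmf \<Rightarrow> ennreal" where
  "bm k p = (\<integral>\<^sup>+j. of_nat (j choose k) \<partial>p)"

lemma bm_0 [simp]: "bm 0 p = 1"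
  by (simp add: bm_def)

lemma bm_conv: "bm k (conv p q) = (\<Sum>i\<le>k. bm i p * bm (k - i) q)"
proof -
  have "bm k (conv p q) = (\<integral>\<^sup>+a. \<integral>\<^sup>+b. (\<Sum>i\<le>k. of_nat (a choose i) * of_nat (b choose (k - i))) \<partial>q \<partial>p)"
    unfolding bm_def conv_def
    by (simp add: vandermonde[symmetric])
  also have "\<dots> = (\<integral>\<^sup>+a. (\<Sum>i\<le>k. of_nat (a choose i) * bm (k - i) q) \<partial>p)"
    unfolding bm_def by (simp add: nn_integral_sum nn_integral_cmult)
  also have "\<dots> = (\<Sum>i\<le>k. bm i p * bm (k - i) q)"
    unfolding bm_def by (simp add: nn_integral_sum nn_integral_multc)
  finally show ?thesis .
qed

lemma bm_return_0: "0 < k \<Longrightarrow> bm k (return_pmf 0) = 0"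
  by (simp add: bm_def)

text \<open>The numbers \<open>bm j p\<close> are formally the Taylor coefficients at 1 of the
  generating function of \<open>p\<close>; this lemma and the next two read off coefficients of its
  \<open>k\<close>-th power.\<close>

lemma bm_convpow_1: "bm 1 (convpow k p) = of_nat k * bm 1 p"
  by (induction k) (simp_all add: bm_return_0 bm_conv algebra_simps)

lemma bm_convpow_2: "bm 2 (convpow k p) = of_nat k * bm 2 p + of_nat (k choose 2) * (bm 1 p)\<^sup>2"
proof (induction k)
  case (Suc k)
  have "bm 2 (convpow (Suc k) p) = bm 2 (convpow k p) + bm 1 p * bm 1 (convpow k p) + bm 2 p"
  proof -
    have "{..2} = {0, 1, 2::nat}" by auto
    then show ?thesis
      by (simp add: bm_conv ac_simps)
  qed
  also have "\<dots> = of_nat (Suc k) * bm 2 p + of_nat (Suc k choose 2) * (bm 1 p)\<^sup>2"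
    unfolding Suc.IH bm_convpow_1
    by (simp add: eval_nat_numeral algebra_simps)
  finally show ?case .
qed (simp add: bm_return_0)

lemma bm_convpow_3:
  "bm 3 (convpow k p) =
     of_nat k * bm 3 p + 2 * of_nat (k choose 2) * (bm 1 p * bm 2 p) + of_nat (k choose 3) * bm 1 p ^ 3"
proof (induction k)
  case (Suc k)
  have "bm 3 (convpow (Suc k) p) =
      bm 3 (convpow k p) + bm 1 p * bm 2 (convpow k p) + bm 2 p * bm 1 (convpow k p) + bm 3 p"
  proof -
    have "{..3} = {0, 1, 2, 3::nat}" by auto
    then show ?thesis
      by (simp add: bm_conv ac_simps)
  qed
  also have "\<dots> = of_nat (Suc k) * bm 3 p + 2 * of_nat (Suc k choose 2) * (bm 1 p * bm 2 p)
      + of_nat (Suc k choose 3) * bm 1 p ^ 3"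
  proof -
    have "Suc k choose 3 = (k choose 2) + (k choose 3)" "Suc k choose 2 = k + (k choose 2)"
      by (simp_all add: eval_nat_numeral)
    then show ?thesis
      unfolding Suc.IH bm_convpow_1 bm_convpow_2
      by (simp add: power3_eq_cube power2_eq_square algebra_simps mult_2)
  qed
  finally show ?case .
qed (simp add: bm_return_0)

text \<open>Of the expansion of the \<open>n\<close>-fold product only the terms in which one or two
  factors contribute are kept; all others are nonnegative.\<close>

lemma bm_convpow_ge:
  assumes "0 < k"
  shows "of_nat n * bm k p + of_nat (n choose 2) * (\<Sum>i\<in>{0<..<k}. bm i p * bm (k - i) p) \<le> bm k (convpow n p)"
proof -
  have split: "(\<Sum>i\<le>k. f i) = f 0 + (\<Sum>i\<in>{0<..<k}. f i) + f k" for f :: "nat \<Rightarrow> ennreal"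
  proof -
    have "{..k} = insert 0 (insert k {0<..<k})"
      using assms by auto
    then show ?thesis
      using assms by (simp add: ac_simps)
  qed
  have lin: "of_nat n * bm j p \<le> bm j (convpow n p)" if "0 < j" for j n
  proof (induction n)
    case (Suc n)
    have "of_nat (Suc n) * bm j p \<le> bm j p + bm j (convpow n p)"
      using Suc by (simp add: algebra_simps add_mono)
    also have "\<dots> = (\<Sum>i\<in>{0, j}. bm i p * bm (j - i) (convpow n p))"
      using that by (simp add: add.commute)
    also have "\<dots> \<le> (\<Sum>i\<le>j. bm i p * bm (j - i) (convpow n p))"
      by (rule sum_mono2) auto
    finally show ?case
      by (simp add: bm_conv)
  qed simp
  show ?thesis
  proof (induction n)
    case (Suc n)
    have "of_nat (Suc n) * bm k p + of_nat (Suc n choose 2) * (\<Sum>i\<in>{0<..<k}. bm i p * bm (k - i) p) =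
      (of_nat n * bm k p + of_nat (n choose 2) * (\<Sum>i\<in>{0<..<k}. bm i p * bm (k - i) p))
      + of_nat n * (\<Sum>i\<in>{0<..<k}. bm i p * bm (k - i) p) + bm k p"
      by (simp add: eval_nat_numeral algebra_simps)
    \<comment> \<open>The new pairs consist of the added copy, taking order \<open>i\<close>, and
      one of the \<open>n\<close> old copies, taking order \<open>k - i\<close>; \<open>lin\<close>
      bounds the latter.\<close>
    also have "\<dots> \<le> bm k (convpow n p) + (\<Sum>i\<in>{0<..<k}. bm i p * bm (k - i) (convpow n p)) + bm k p"
    proof (intro add_mono Suc.IH order_refl)
      show "of_nat n * (\<Sum>i\<in>{0<..<k}. bm i p * bm (k - i) p) \<le>
          (\<Sum>i\<in>{0<..<k}. bm i p * bm (k - i) (convpow n p))"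
        unfolding sum_distrib_left
      proof (rule sum_mono)
        fix i assume "i \<in> {0<..<k}"
        then have "0 < k - i"
          by auto
        note lin[OF this]
        then have "bm i p * (of_nat n * bm (k - i) p) \<le> bm i p * bm (k - i) (convpow n p)"
          by (intro mult_left_mono) auto
        then show "of_nat n * (bm i p * bm (k - i) p) \<le> bm i p * bm (k - i) (convpow n p)"
          by (simp add: ac_simps)
      qed
    qed
    also have "\<dots> = bm k (convpow (Suc n) p)"
      by (simp add: bm_conv split)
    finally show ?case .
  qed (simp add: eval_nat_numeral)
qed

definition visit_moment :: "nat pmf \<Rightarrow> nat \<Rightarrow> (int ^ 'd \<Rightarrow> nat) list \<Rightarrow> int ^ 'd::finite \<Rightarrow> ennreal" where
  "visit_moment \<mu> k \<phi>s x = bm k (occ \<mu> \<phi>s {#x#})"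

text \<open>The moment of the visits of the descendants alone: the list starts at the first
  generation, and the particle at \<open>x\<close> itself is not counted.\<close>

definition next_moment :: "nat pmf \<Rightarrow> nat \<Rightarrow> (int ^ 'd \<Rightarrow> nat) list \<Rightarrow> int ^ 'd::finite \<Rightarrow> ennreal" where
  "next_moment \<mu> k \<phi>s x = (\<integral>\<^sup>+n. bm k (convpow n (bind_pmf (pmf_of_set (neighbours x)) (\<lambda>y. occ \<mu> \<phi>s {#y#}))) \<partial>\<mu>)"

lemma bm_bind_neighbours:
  "bm k (bind_pmf (pmf_of_set (neighbours x)) (\<lambda>y. occ \<mu> \<phi>s {#y#})) = avg (visit_moment \<mu> k \<phi>s) x"
  by (simp add: visit_moment_def[abs_def] avg_def bm_def)

text \<open>Pascal's rule: the particle at \<open>x\<close> adds 0 or 1 to the count, and in the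
  latter case it may be one of the \<open>Suc k\<close> chosen visits.\<close>

lemma visit_moment_Cons:
  assumes "\<phi> x \<le> 1"
  shows "visit_moment \<mu> (Suc k) (\<phi> # \<phi>s) x = next_moment \<mu> (Suc k) \<phi>s x + of_nat (\<phi> x) * next_moment \<mu> k \<phi>s x"
proof -
  define q where "q = bind_pmf \<mu> (\<lambda>k. convpow k (bind_pmf (pmf_of_set (neighbours x)) (\<lambda>y. occ \<mu> \<phi>s {#y#})))"
  have q: "next_moment \<mu> k \<phi>s x = bm k q" for k
    by (simp add: q_def next_moment_def bm_def)
  have "visit_moment \<mu> (Suc k) (\<phi> # \<phi>s) x = (\<integral>\<^sup>+j. of_nat ((\<phi> x + j) choose Suc k) \<partial>q)"
    unfolding visit_moment_def occ_single q_def[symmetric] by (simp add: bm_def)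
  also have "\<dots> = bm (Suc k) q + of_nat (\<phi> x) * bm k q"
  proof -
    consider "\<phi> x = 0" | "\<phi> x = 1"
      using assms by linarith
    then show ?thesis
      by cases (simp_all add: bm_def nn_integral_add add.commute)
  qed
  finally show ?thesis
    unfolding q .
qed

lemma visit_moment_0 [simp]: "visit_moment \<mu> 0 \<phi>s x = 1"
  by (simp add: visit_moment_def)

lemma visit_moment_Nil: "0 < k \<Longrightarrow> visit_moment \<mu> k [] x = 0"
  by (simp add: visit_moment_def bm_return_0)

lemma next_moment_0 [simp]: "next_moment \<mu> 0 \<phi>s x = 1"
  by (simp add: next_moment_def)

lemma next_moment_1: "next_moment \<mu> 1 \<phi>s x = bm 1 \<mu> * avg (visit_moment \<mu> 1 \<phi>s) x"
  unfolding next_moment_def bm_convpow_1 bm_bind_neighbours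
  by (simp add: nn_integral_multc bm_def)

lemma next_moment_2:
  "next_moment \<mu> 2 \<phi>s x = bm 1 \<mu> * avg (visit_moment \<mu> 2 \<phi>s) x + bm 2 \<mu> * (avg (visit_moment \<mu> 1 \<phi>s) x)\<^sup>2"
  unfolding next_moment_def bm_convpow_2 bm_bind_neighbours
  by (simp add: nn_integral_add nn_integral_multc bm_def)

lemma next_moment_3:
  "next_moment \<mu> 3 \<phi>s x = bm 1 \<mu> * avg (visit_moment \<mu> 3 \<phi>s) x
     + 2 * bm 2 \<mu> * (avg (visit_moment \<mu> 1 \<phi>s) x * avg (visit_moment \<mu> 2 \<phi>s) x)
     + bm 3 \<mu> * (avg (visit_moment \<mu> 1 \<phi>s) x) ^ 3"
  unfolding next_moment_def bm_convpow_3 bm_bind_neighbours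
  by (simp add: nn_integral_add nn_integral_multc nn_integral_cmult bm_def)

lemma next_moment_ge:
  assumes "0 < k"
  shows "bm 1 \<mu> * avg (visit_moment \<mu> k \<phi>s) x
    + bm 2 \<mu> * (\<Sum>i\<in>{0<..<k}. avg (visit_moment \<mu> i \<phi>s) x * avg (visit_moment \<mu> (k - i) \<phi>s) x)
    \<le> next_moment \<mu> k \<phi>s x"
proof -
  let ?q = "bind_pmf (pmf_of_set (neighbours x)) (\<lambda>y. occ \<mu> \<phi>s {#y#})"
  have "bm 1 \<mu> * bm k ?q + bm 2 \<mu> * (\<Sum>i\<in>{0<..<k}. bm i ?q * bm (k - i) ?q) =
     (\<integral>\<^sup>+n. of_nat n * bm k ?q + of_nat (n choose 2) * (\<Sum>i\<in>{0<..<k}. bm i ?q * bm (k - i) ?q) \<partial>\<mu>)"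
    by (simp add: nn_integral_add nn_integral_multc, simp add: bm_def)
  also have "\<dots> \<le> next_moment \<mu> k \<phi>s x"
    unfolding next_moment_def by (intro nn_integral_mono bm_convpow_ge assms)
  finally show ?thesis
    unfolding bm_bind_neighbours .
qed

section \<open>Critical offspring distributions\<close>

text \<open>The functions \<open>\<psi>s\<close> act only on generations from
  \<open>length \<phi>s\<close> on, so they change the count only if that generation is non-empty;
  the rest is a union bound.\<close>

lemma occ_tail_append:
  "emeasure (occ \<mu> (\<phi>s @ \<psi>s) B) {n..} \<le>
     emeasure (occ \<mu> \<phi>s B) {n..} + emeasure (occ \<mu> (replicate (length \<phi>s) (\<lambda>_. 0) @ [\<lambda>_. 1]) B) {1..}"
proof (induction \<phi>s arbitrary: B n)
  case Nil
  show ?case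
  proof (cases "B = {#}")
    case True
    then show ?thesis
      by (auto simp: indicator_def)
  next
    case False
    then have "(\<Sum>x\<in>#B. 1 :: nat) \<ge> 1"
      by (cases B) auto
    then have "emeasure (occ \<mu> [\<lambda>_. 1] B) {1..} = 1"
      by (simp add: map_pmf_const indicator_def vimage_def)
    then show ?thesis
      by (simp add: measure_pmf.emeasure_le_1 add_increasing)
  qed
next
  case (Cons \<phi> \<phi>s)
  have *: "(\<lambda>k. m + k) -` {n..} = {n - m..}" for m n :: nat
    by auto
  show ?case
    using Cons.IH by (auto simp: * nn_integral_add[symmetric] intro!: nn_integral_mono)
qed

lemma pmf_conv_nat_0: "pmf (conv p q) (0::nat) = pmf p 0 * pmf q 0"
proof -
  have "pmf (conv p q) 0 = measure_pmf.expectation p (\<lambda>a. measure_pmf.expectation q (\<lambda>b. indicator {0} a * indicator {0} b))"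
    unfolding conv_def pmf_bind
    by (intro Bochner_Integration.integral_cong refl) (auto simp: indicator_def)
  then show ?thesis
    by (simp add: measure_pmf_single)
qed

lemma pmf_convpow_0: "pmf (convpow k p) (0::nat) = pmf p 0 ^ k"
  by (induction k) (simp_all add: pmf_conv_nat_0)

lemma pmf_occ_Cons_0:
  assumes "\<phi> x = 0"
  shows "pmf (occ \<mu> (\<phi> # \<phi>s) {#x#}) 0 =
    measure_pmf.expectation \<mu> (\<lambda>k. measure_pmf.expectation (pmf_of_set (neighbours x)) (\<lambda>y. pmf (occ \<mu> \<phi>s {#y#}) 0) ^ k)"
proof -
  have "(+) 0 = (id :: nat \<Rightarrow> nat)"
    by auto
  then show ?thesis
    unfolding occ_single assms by (simp add: pmf_bind pmf_convpow_0)
qed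

lemma bernoulli_quadratic:
  fixes t :: real
  assumes "0 \<le> t" "t \<le> 1" "2 \<le> k"
  shows "1 - real k * t + t\<^sup>2 \<le> (1 - t) ^ k"
  using assms(3)
proof (induction k rule: dec_induct)
  case base
  then show ?case by (simp add: power2_eq_square algebra_simps)
next
  case (step k)
  have "0 \<le> t\<^sup>2 * (real k - t)"
    using assms step by (intro mult_nonneg_nonneg) auto
  then have "1 - real (Suc k) * t + t\<^sup>2 \<le> (1 - t) * (1 - real k * t + t\<^sup>2)"
    by (simp add: power2_eq_square algebra_simps)
  also have "\<dots> \<le> (1 - t) * (1 - t) ^ k"
    using step assms by (intro mult_left_mono) auto
  finally show ?case by simp
qed

text \<open>After division by \<open>exp x\<close> this is
  \<open>exp (- x) \<ge> 1 - x\<close>.\<close>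

lemma exp_le_quadratic: "exp x \<le> 1 + x + x\<^sup>2 * exp x" if "0 \<le> x" for x :: real
proof -
  have "1 = (1 + x) * (1 - x) + x\<^sup>2"
    by (simp add: power2_eq_square algebra_simps)
  also have "\<dots> \<le> (1 + x) * exp (- x) + x\<^sup>2"
    using that exp_ge_add_one_self[of "-x"] by (intro add_right_mono mult_left_mono) auto
  finally have "1 * exp x \<le> ((1 + x) * exp (- x) + x\<^sup>2) * exp x"
    by (intro mult_right_mono) auto
  also have "\<dots> = 1 + x + x\<^sup>2 * exp x"
    by (simp add: algebra_simps exp_minus)
  finally show ?thesis by simp
qed

lemma power_le_fact_exp: "x ^ k \<le> fact k * exp x" if "0 \<le> x" for x :: real
proof -
  have "x ^ k / fact k \<le> (\<Sum>n\<le>k. x ^ n / fact n)"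
    using that by (intro member_le_sum) auto
  also have "\<dots> = (\<Sum>n\<le>k. x ^ n /\<^sub>R fact n)"
    by (simp add: divide_inverse mult.commute)
  also have "\<dots> \<le> exp x"
    unfolding exp_def using that summable_exp_generic[of x]
    by (intro sum_le_suminf) auto
  finally show ?thesis
    by (simp add: field_simps)
qed

locale critical_offspring =
  fixes \<mu> :: "nat pmf"
  assumes critical: "critical \<mu>" and nontrivial: "nontrivial \<mu>" and subexponential: "subexponential \<mu>"
begin

lemma integrable_offspring: "integrable \<mu> real"
  using critical not_integrable_integral_eq[of \<mu> real] by (force simp: critical_def)

lemma mean_offspring: "measure_pmf.expectation \<mu> real = 1"
  using critical by (simp add: critical_def)

lemma bm_offspring_1: "bm 1 \<mu> = 1"
proof -
  have "bm 1 \<mu> = (\<integral>\<^sup>+k. ennreal (real k) \<partial>\<mu>)"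
    unfolding bm_def by (intro nn_integral_cong) (simp add: ennreal_of_nat_eq_real_of_nat)
  also have "\<dots> = 1"
    by (subst nn_integral_eq_integral) (simp_all add: integrable_offspring mean_offspring)
  finally show ?thesis .
qed

text \<open>A law on \<open>{0, 1}\<close> with mean 1 is concentrated at 1.\<close>

lemma offspring_ge_2: "0 < measure \<mu> {2..}"
proof (rule ccontr)
  assume "\<not> ?thesis"
  then have "set_pmf \<mu> \<inter> {2..} = {}"
    by (meson measure_pmf_zero_iff zero_less_measure_iff)
  then have "set_pmf \<mu> \<subseteq> {0, 1}"
    by (force simp: not_le)
  then have "measure_pmf.expectation \<mu> real = (\<Sum>k\<in>{0, 1}. real k * pmf \<mu> k)"
    by (subst integral_measure_pmf_real[of "{0, 1}"]) auto
  with mean_offspring nontrivial show False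
    by (simp add: nontrivial_def)
qed

text \<open>Otherwise \<open>k - 1\<close> would be nonnegative with mean 0, hence almost surely
  0.\<close>

lemma offspring_0: "0 < pmf \<mu> 0"
proof (rule ccontr)
  assume "\<not> ?thesis"
  then have nz: "0 \<notin> set_pmf \<mu>"
    by (metis pmf_pos set_pmf_iff)
  have "measure_pmf.expectation \<mu> (\<lambda>k. real k - 1) = 0"
    using integrable_offspring mean_offspring by (subst Bochner_Integration.integral_diff) auto
  moreover have "AE k in \<mu>. 0 \<le> real k - 1"
    using nz by (auto simp: AE_measure_pmf_iff Suc_le_eq intro: gr0I)
  ultimately have "AE k in \<mu>. real k - 1 = 0"
    using integrable_offspring by (subst (asm) integral_nonneg_eq_0_iff_AE) auto
  then have "set_pmf \<mu> \<subseteq> {1}"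
    by (auto simp: AE_measure_pmf_iff)
  then have "\<mu> = return_pmf 1"
    by (simp add: set_pmf_subset_singleton)
  with nontrivial show False
    by (simp add: nontrivial_def)
qed

text \<open>Half of the decay rate is given up to make the series geometric.\<close>

lemma exp_moment_offspring:
  obtains c where "0 < c" "(\<integral>\<^sup>+k. ennreal (exp (c * real k)) \<partial>\<mu>) < \<top>"
proof -
  obtain C c where C: "0 < C" "0 < c" and le: "\<And>n. 1 \<le> n \<Longrightarrow> pmf \<mu> n \<le> C * exp (- c * real n)"
    using subexponential by (auto simp: subexponential_def)
  have "(\<integral>\<^sup>+k. ennreal (exp (c / 2 * real k)) \<partial>\<mu>) = (\<Sum>n. ennreal (pmf \<mu> n * exp (c / 2 * real n)))"
    by (simp add: nn_integral_measure_pmf nn_integral_count_space_nat ennreal_mult)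
  also have "\<dots> < \<top>"
  proof -
    have "summable (\<lambda>n. pmf \<mu> n * exp (c / 2 * real n))"
    proof (rule summable_comparison_test_ev)
      show "\<forall>\<^sub>F n in sequentially. norm (pmf \<mu> n * exp (c / 2 * real n)) \<le> C * exp (- c / 2) ^ n"
      proof (rule eventually_sequentiallyI[of 1])
        fix n :: nat assume "1 \<le> n"
        then have "pmf \<mu> n * exp (c / 2 * real n) \<le> C * exp (- c * real n) * exp (c / 2 * real n)"
          by (intro mult_right_mono le) auto
        also have "\<dots> = C * exp (- c / 2) ^ n"
          by (simp add: exp_of_nat_mult[symmetric] exp_add[symmetric] field_simps)
        finally show "norm (pmf \<mu> n * exp (c / 2 * real n)) \<le> C * exp (- c / 2) ^ n"
          by simp
      qed
      show "summable (\<lambda>n. C * exp (- c / 2) ^ n)"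
        using C by (intro summable_mult summable_geometric) auto
    qed
    then show ?thesis
      by (subst suminf_ennreal_eq[OF _ summable_sums]) auto
  qed
  finally show ?thesis
    using C by (intro that[of "c / 2"]) auto
qed

lemma bm_offspring_finite: "bm k \<mu> < \<top>"
proof -
  obtain c where c: "0 < c" "(\<integral>\<^sup>+k. ennreal (exp (c * real k)) \<partial>\<mu>) < \<top>"
    by (rule exp_moment_offspring)
  have "bm k \<mu> \<le> (\<integral>\<^sup>+j. ennreal (fact k / c ^ k) * ennreal (exp (c * real j)) \<partial>\<mu>)"
    unfolding bm_def
  proof (rule nn_integral_mono)
    fix j
    have "real (j choose k) \<le> real j ^ k"
      by (metis binomial_le_pow binomial_eq_0 not_le of_nat_0_le_iff of_nat_le_iff of_nat_power zero_le_power of_nat_0)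
    also have "\<dots> \<le> fact k / c ^ k * exp (c * real j)"
      using power_le_fact_exp[of "c * real j" k] c by (simp add: field_simps power_mult_distrib)
    finally show "of_nat (j choose k) \<le> ennreal (fact k / c ^ k) * ennreal (exp (c * real j))"
      using c by (simp add: ennreal_mult[symmetric] ennreal_of_nat_eq_real_of_nat)
  qed
  also have "\<dots> < \<top>"
    using c by (simp add: nn_integral_cmult ennreal_mult_less_top)
  finally show ?thesis .
qed

lemma bm_offspring_2_pos: "0 < bm 2 \<mu>"
proof -
  have "0 < emeasure \<mu> {2..}"
    using offspring_ge_2 by (simp add: measure_pmf.emeasure_eq_measure)
  also have "\<dots> = (\<integral>\<^sup>+k. indicator {2..} k \<partial>\<mu>)"
    by simp
  also have "\<dots> \<le> bm 2 \<mu>"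
    unfolding bm_def
  proof (rule nn_integral_mono)
    fix k :: nat
    show "indicator {2..} k \<le> (of_nat (k choose 2) :: ennreal)"
    proof (cases "2 \<le> k")
      case True
      then have "1 \<le> k choose 2"
        using zero_less_binomial[of 2 k] by linarith
      then have "(of_nat 1 :: ennreal) \<le> of_nat (k choose 2)"
        using of_nat_mono by blast
      with True show ?thesis by simp
    qed simp
  qed
  finally show ?thesis .
qed

text \<open>Criticality makes the linear coefficient exactly 1. The quadratic term is what every
  supersolution below has to absorb.\<close>

lemma gf_offspring_le:
  obtains A t0 where "0 < A" "0 < t0"
    "\<And>t. 0 \<le> t \<Longrightarrow> t \<le> t0 \<Longrightarrow> gf (ennreal (1 + t)) \<mu> \<le> ennreal (1 + t + A * t\<^sup>2)"
proof -
  obtain c where c: "0 < c" "(\<integral>\<^sup>+k. ennreal (exp (c * real k)) \<partial>\<mu>) < \<top>"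
    by (rule exp_moment_offspring)
  then obtain E where E: "(\<integral>\<^sup>+k. ennreal (exp (c * real k)) \<partial>\<mu>) = ennreal E" "0 \<le> E"
    by (metis ennreal_cases less_irrefl)
  \<comment> \<open>One half of the exponential moment dominates \<open>exp (k * t)\<close> for
    \<open>t \<le> c / 2\<close>, the other dominates \<open>k^2\<close> with constant
    \<open>8 / c^2\<close>, from \<open>x^2 \<le> 2 * exp x\<close> at \<open>x = c * k / 2\<close>.
    The summand 1 only makes \<open>A\<close> positive.\<close>
  define A where "A = 8 / c\<^sup>2 * E + 1"
  have "gf (ennreal (1 + t)) \<mu> \<le> ennreal (1 + t + A * t\<^sup>2)" if t: "0 \<le> t" "t \<le> c / 2" for t
  proof -
    have "gf (ennreal (1 + t)) \<mu> \<le> (\<integral>\<^sup>+k. 1 + ennreal t * of_nat k + ennreal (t\<^sup>2 * (8 / c\<^sup>2)) * ennreal (exp (c * real k)) \<partial>\<mu>)"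
      unfolding gf_def
    proof (rule nn_integral_mono)
      fix k :: nat
      have "(1 + t) ^ k \<le> exp (real k * t)"
        using power_mono[of "1 + t" "exp t" k] t exp_ge_add_one_self[of t]
        by (simp add: exp_of_nat_mult)
      also have "\<dots> \<le> 1 + real k * t + (real k * t)\<^sup>2 * exp (real k * t)"
        using t by (intro exp_le_quadratic) auto
      also have "(real k * t)\<^sup>2 * exp (real k * t) \<le> t\<^sup>2 * (8 / c\<^sup>2) * exp (c * real k)"
      proof -
        have "(real k)\<^sup>2 \<le> 8 / c\<^sup>2 * exp (c / 2 * real k)"
          using power_le_fact_exp[of "c / 2 * real k" 2] c
          by (simp add: field_simps power2_eq_square)
        moreover have "exp (real k * t) \<le> exp (c / 2 * real k)"
          using t mult_right_mono[of t "c / 2" "real k"] by (simp add: mult.commute)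
        ultimately have "(real k)\<^sup>2 * exp (real k * t) \<le> (8 / c\<^sup>2 * exp (c / 2 * real k)) * exp (c / 2 * real k)"
          by (intro mult_mono) auto
        also have "\<dots> = 8 / c\<^sup>2 * exp (c * real k)"
          by (simp add: exp_add[symmetric] field_simps)
        finally have "t\<^sup>2 * ((real k)\<^sup>2 * exp (real k * t)) \<le> t\<^sup>2 * (8 / c\<^sup>2 * exp (c * real k))"
          by (intro mult_left_mono) auto
        then show ?thesis
          by (simp add: power_mult_distrib ac_simps)
      qed
      finally have "ennreal ((1 + t) ^ k) \<le> ennreal (1 + t * real k + t\<^sup>2 * (8 / c\<^sup>2) * exp (c * real k))"
        by (intro ennreal_leI) (simp add: mult.commute)
      then show "ennreal (1 + t) ^ k \<le> 1 + ennreal t * of_nat k + ennreal (t\<^sup>2 * (8 / c\<^sup>2)) * ennreal (exp (c * real k))"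
      proof -
        have "1 + ennreal t * of_nat k + ennreal (t\<^sup>2 * (8 / c\<^sup>2)) * ennreal (exp (c * real k)) =
            ennreal (1 + t * real k + t\<^sup>2 * (8 / c\<^sup>2) * exp (c * real k))"
          unfolding ennreal_of_nat_eq_real_of_nat using t c
          by (subst ennreal_plus, simp, simp, subst ennreal_plus, simp, simp, subst ennreal_mult, simp, simp,
              subst ennreal_mult, simp, simp) simp
        then show ?thesis
          using \<open>ennreal ((1 + t) ^ k) \<le> _\<close> t by (simp add: ennreal_power del: ennreal_plus)
      qed
    qed
    also have "\<dots> = 1 + ennreal t * bm 1 \<mu> + ennreal (t\<^sup>2 * (8 / c\<^sup>2)) * ennreal E"
      by (simp add: nn_integral_add nn_integral_cmult E bm_def)
    also have "\<dots> = ennreal (1 + t + t\<^sup>2 * (8 / c\<^sup>2) * E)"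
    proof -
      have "ennreal (t\<^sup>2 * (8 / c\<^sup>2)) * ennreal E = ennreal (t\<^sup>2 * (8 / c\<^sup>2) * E)"
        using E by (subst ennreal_mult) auto
      then show ?thesis
        using t E by (simp add: bm_offspring_1 del: One_nat_def)
    qed
    also have "\<dots> \<le> ennreal (1 + t + A * t\<^sup>2)"
      unfolding A_def by (intro ennreal_leI) (simp add: algebra_simps)
    finally show ?thesis .
  qed
  moreover have "0 < A"
    using c E by (simp add: A_def add_nonneg_pos)
  ultimately show ?thesis
    using c by (intro that[of A "c / 2"]) auto
qed

section \<open>Survival probability of the critical process\<close>

lemma expectation_power_ge:
  assumes "0 \<le> t" "t \<le> 1"
  shows "1 - t + measure \<mu> {2..} * t\<^sup>2 \<le> measure_pmf.expectation \<mu> (\<lambda>k. (1 - t) ^ k)"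
proof -
  have ind: "integrable \<mu> (indicator {2..} :: nat \<Rightarrow> real)"
    by (intro measure_pmf.integrable_const_bound[of _ 1]) auto
  have lin: "integrable \<mu> (\<lambda>k. 1 - real k * t)"
    using integrable_offspring by auto
  have "measure_pmf.expectation \<mu> (\<lambda>k. 1 - real k * t + indicator {2..} k * t\<^sup>2) =
      measure_pmf.expectation \<mu> (\<lambda>k. 1 - real k * t) + measure \<mu> {2..} * t\<^sup>2"
    by (subst Bochner_Integration.integral_add) (use lin ind in auto)
  also have "measure_pmf.expectation \<mu> (\<lambda>k. 1 - real k * t) = 1 - t"
    by (subst Bochner_Integration.integral_diff) (use integrable_offspring mean_offspring in auto)
  finally have "1 - t + measure \<mu> {2..} * t\<^sup>2 = measure_pmf.expectation \<mu> (\<lambda>k. 1 - real k * t + indicator {2..} k * t\<^sup>2)" ..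
  also have "\<dots> \<le> measure_pmf.expectation \<mu> (\<lambda>k. (1 - t) ^ k)"
  proof (rule integral_mono)
    show "integrable \<mu> (\<lambda>k. 1 - real k * t + indicator {2..} k * t\<^sup>2)"
      using lin ind by auto
    show "integrable \<mu> (\<lambda>k. (1 - t) ^ k)"
      using assms by (intro measure_pmf.integrable_const_bound[of _ 1]) (auto simp: power_le_one)
    fix k :: nat
    consider "k = 0" | "k = 1" | "2 \<le> k" by linarith
    then show "1 - real k * t + indicator {2..} k * t\<^sup>2 \<le> (1 - t) ^ k"
      using bernoulli_quadratic[OF assms, of k] by cases auto
  qed
  finally show ?thesis .
qed

text \<open>The factor 1/2 makes the bound in \<open>extinction_ge\<close> trivial for generation 0,
  where it reads \<open>1 / (2 * survival_rate) \<ge> 1\<close>.\<close>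

definition survival_rate :: real where "survival_rate = measure \<mu> {2..} / 2"

lemma survival_rate_pos: "0 < survival_rate"
  using offspring_ge_2 by (simp add: survival_rate_def)

lemma survival_rate_le: "survival_rate \<le> 1 / 2"
  by (simp add: survival_rate_def)

text \<open>\<open>occ \<mu> (survivors N)\<close> is the law of the size of generation \<open>N\<close>.\<close>

definition survivors :: "nat \<Rightarrow> (int ^ 'd::finite \<Rightarrow> nat) list" where
  "survivors N = replicate N (\<lambda>_. 0) @ [\<lambda>_. 1]"

text \<open>Kolmogorov's estimate. The survival probability \<open>t\<close> passes to at most
  \<open>t - a * t^2\<close> in one generation, \<open>a\<close> being \<open>survival_rate\<close>,
  and \<open>Q = 1 / (a * (N + 2))\<close> is a supersolution of this recursion because
  \<open>(N + 1) * (N + 3) \<le> (N + 2)^2\<close>.\<close>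

lemma extinction_ge: "1 - 1 / (survival_rate * (real N + 2)) \<le> pmf (occ \<mu> (survivors N) {#x :: int ^ 'd::finite#}) 0"
proof (induction N arbitrary: x)
  case 0
  have "1 / (survival_rate * 2) \<ge> 1"
    using survival_rate_pos survival_rate_le by (simp add: field_simps)
  then show ?case
    by (simp add: order_trans[OF _ pmf_nonneg])
next
  case (Suc N)
  define q where "q = measure_pmf.expectation (pmf_of_set (neighbours x)) (\<lambda>y. pmf (occ \<mu> (survivors N) {#y#}) 0)"
  define t where "t = 1 - q"
  define Q where "Q = 1 / (survival_rate * (real N + 2))"
  have q: "1 - Q \<le> q" "q \<le> 1" "0 \<le> q"
  proof -
    have int: "integrable (pmf_of_set (neighbours x)) (\<lambda>y. pmf (occ \<mu> (survivors N) {#y#}) 0)"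
      by (intro measure_pmf.integrable_const_bound[of _ 1]) (auto simp: pmf_le_1)
    have "measure_pmf.expectation (pmf_of_set (neighbours x)) (\<lambda>_. 1 - Q) \<le> q"
      unfolding q_def using Suc.IH by (intro integral_mono int) (auto simp: Q_def)
    then show "1 - Q \<le> q" by simp
    have "q \<le> measure_pmf.expectation (pmf_of_set (neighbours x)) (\<lambda>_. 1)"
      unfolding q_def by (intro integral_mono int) (auto simp: pmf_le_1)
    then show "q \<le> 1" by simp
    show "0 \<le> q"
      unfolding q_def by (intro Bochner_Integration.integral_nonneg) auto
  qed
  have a: "0 < survival_rate" "survival_rate \<le> 1 / 2"
    by (fact survival_rate_pos survival_rate_le)+
  have t: "0 \<le> t" "t \<le> 1" "t \<le> Q"
    using q by (auto simp: t_def)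
  have Q: "2 * survival_rate * Q \<le> 1" "0 < Q"
  proof -
    have "2 * survival_rate * Q = 2 / (real N + 2)"
      using a by (simp add: Q_def)
    then show "2 * survival_rate * Q \<le> 1" by simp
    show "0 < Q"
      using a by (auto simp: Q_def intro!: divide_pos_pos mult_pos_pos)
  qed
  have "1 - 1 / (survival_rate * (real (Suc N) + 2)) \<le> 1 - Q + survival_rate * Q\<^sup>2"
  proof -
    have "(real N + 1) / (real N + 2)\<^sup>2 \<le> 1 / (real N + 3)"
    proof -
      have "(real N + 1) * (real N + 3) \<le> (real N + 2)\<^sup>2"
        by (simp add: power2_eq_square algebra_simps)
      then show ?thesis
        by (simp add: pos_divide_le_eq pos_le_divide_eq)
    qed
    then have "(real N + 1) / (real N + 2)\<^sup>2 / survival_rate \<le> 1 / (real N + 3) / survival_rate"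
      using a by (intro divide_right_mono) auto
    moreover have "Q - survival_rate * Q\<^sup>2 = (real N + 1) / (real N + 2)\<^sup>2 / survival_rate"
      using a by (simp add: Q_def power2_eq_square divide_simps)
    ultimately show ?thesis
      by (simp add: ac_simps)
  qed
  \<comment> \<open>The map \<open>t - a * t^2\<close> is increasing on \<open>[0, Q]\<close>, since
    \<open>2 * a * Q \<le> 1\<close>; hence \<open>t\<close> may replace its upper bound
    \<open>Q\<close>.\<close>
  also have "\<dots> \<le> 1 - t + survival_rate * t\<^sup>2"
  proof -
    have "0 \<le> (Q - t) * (1 - survival_rate * (Q + t))"
    proof (rule mult_nonneg_nonneg)
      have "survival_rate * t \<le> survival_rate * Q"
        using t a by (intro mult_left_mono) auto
      then show "0 \<le> 1 - survival_rate * (Q + t)"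
        using Q by (simp add: algebra_simps)
    qed (use t in auto)
    then show ?thesis
      by (simp add: algebra_simps power2_eq_square)
  qed
  also have "\<dots> \<le> 1 - t + measure \<mu> {2..} * t\<^sup>2"
    by (simp add: survival_rate_def mult_right_mono)
  also have "\<dots> \<le> measure_pmf.expectation \<mu> (\<lambda>k. (1 - t) ^ k)"
    using t by (intro expectation_power_ge) auto
  also have "\<dots> = pmf (occ \<mu> (survivors (Suc N)) {#x#}) 0"
  proof -
    have "survivors (Suc N) = (\<lambda>_ :: int ^ 'd. 0) # survivors N"
      by (simp add: survivors_def)
    then show ?thesis
      using pmf_occ_Cons_0[of "\<lambda>_. 0" x \<mu> "survivors N"] by (simp only: t_def q_def) simp
  qed
  finally show ?case .
qed

lemma survival_le:
  "measure (occ \<mu> (survivors N) {#x :: int ^ 'd::finite#}) {1..} \<le> 1 / (survival_rate * (real N + 1))"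
proof -
  have "{1..} = UNIV - {0::nat}"
    by auto
  then have "measure (occ \<mu> (survivors N) {#x#}) {1..} = 1 - pmf (occ \<mu> (survivors N) {#x#}) 0"
    by (simp add: measure_pmf.prob_compl[simplified] measure_pmf_single)
  also have "\<dots> \<le> 1 / (survival_rate * (real N + 2))"
    using extinction_ge[of N x] by simp
  also have "\<dots> \<le> 1 / (survival_rate * (real N + 1))"
    using survival_rate_pos by (intro divide_left_mono mult_left_mono mult_pos_pos) auto
  finally show ?thesis .
qed

lemma occ_tail_le:
  "measure (occ \<mu> (\<phi>s @ \<psi>s) {#x :: int ^ 'd::finite#}) {n..} \<le>
     measure (occ \<mu> \<phi>s {#x#}) {n..} + 1 / (survival_rate * (real (length \<phi>s) + 1))"
proof -
  have "ennreal (measure (occ \<mu> (\<phi>s @ \<psi>s) {#x#}) {n..}) \<le>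
     ennreal (measure (occ \<mu> \<phi>s {#x#}) {n..} + measure (occ \<mu> (survivors (length \<phi>s)) {#x#}) {1..})"
    using occ_tail_append[of \<mu> \<phi>s \<psi>s "{#x#}" n]
    by (simp add: measure_pmf.emeasure_eq_measure survivors_def)
  then have "measure (occ \<mu> (\<phi>s @ \<psi>s) {#x#}) {n..} \<le>
     measure (occ \<mu> \<phi>s {#x#}) {n..} + measure (occ \<mu> (survivors (length \<phi>s)) {#x#}) {1..}"
    by (subst (asm) ennreal_le_iff) (auto intro: add_nonneg_nonneg)
  with survival_le[of "length \<phi>s" x] show ?thesis
    by linarith
qed

lemma visit_tail_le_truncated:
  "visit_tail TYPE('d::finite) \<mu> n \<le>
     measure (occ \<mu> (replicate N at_origin) {#0 :: int ^ 'd#}) {n..} + 1 / (survival_rate * (real N + 1))"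
proof (rule visit_tail_leI)
  fix M assume "N \<le> M"
  then have "replicate M (at_origin :: int ^ 'd \<Rightarrow> nat) = replicate N at_origin @ replicate (M - N) at_origin"
    by (simp add: replicate_add[symmetric])
  then show "measure (occ \<mu> (replicate M at_origin) {#0 :: int ^ 'd#}) {n..} \<le>
      measure (occ \<mu> (replicate N at_origin) {#0 :: int ^ 'd#}) {n..} + 1 / (survival_rate * (real N + 1))"
    using occ_tail_le[of "replicate N (at_origin :: int ^ 'd \<Rightarrow> nat)" "replicate (M - N) at_origin" 0 n] by simp
qed

end

section \<open>Heat kernel of the simple random walk\<close>

primrec rw :: "nat \<Rightarrow> int ^ 'd \<Rightarrow> (int ^ 'd::finite) pmf" where
  "rw 0 x = return_pmf x"
| "rw (Suc m) x = bind_pmf (pmf_of_set (neighbours x)) (rw m)"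

lemma avg_mono: "(\<And>y. y \<in> neighbours x \<Longrightarrow> u y \<le> v y) \<Longrightarrow> avg u x \<le> avg v x"
  unfolding avg_def by (intro nn_integral_mono_AE) (simp add: AE_measure_pmf_iff)

lemma avg_add: "avg (\<lambda>y. u y + v y) x = avg u x + avg v x"
  unfolding avg_def by (simp add: nn_integral_add)

lemma avg_cmult: "avg (\<lambda>y. c * u y) x = c * avg u x"
  unfolding avg_def by (simp add: nn_integral_cmult)

lemma avg_const [simp]: "avg (\<lambda>_. c) x = c"
  unfolding avg_def by simp

lemma avg_power: "(avg ^^ m) u x = (\<integral>\<^sup>+y. u y \<partial>rw m x)"
  by (induction m arbitrary: x) (simp_all add: avg_def)

lemma avg_power_mono: "(\<And>y. u y \<le> v y) \<Longrightarrow> (avg ^^ m) u x \<le> (avg ^^ m) v x"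
  unfolding avg_power by (intro nn_integral_mono) auto

lemma rw_add: "rw (m + n) x = bind_pmf (rw m x) (rw n)"
  by (induction m arbitrary: x) (auto simp: bind_return_pmf bind_assoc_pmf intro!: bind_pmf_cong)

lemma neighbours_translate: "neighbours (x + z) = (\<lambda>y. y + z) ` neighbours x"
  by (auto simp: neighbours_def image_UN algebra_simps)

lemma neighbours_uminus: "neighbours (- x) = uminus ` neighbours x"
  by (auto simp: neighbours_def image_UN algebra_simps)

lemma rw_translate: "rw m (x + z) = map_pmf (\<lambda>y. y + z) (rw m x)"
proof (induction m arbitrary: x)
  case (Suc m)
  have "pmf_of_set (neighbours (x + z)) = map_pmf (\<lambda>y. y + z) (pmf_of_set (neighbours x))"
    unfolding neighbours_translate by (intro map_pmf_of_set_inj[symmetric]) (auto simp: inj_on_def)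
  then show ?case
    by (simp add: bind_map_pmf map_bind_pmf Suc.IH)
qed simp

lemma rw_uminus: "rw m (- x) = map_pmf uminus (rw m x)"
proof (induction m arbitrary: x)
  case (Suc m)
  have "pmf_of_set (neighbours (- x)) = map_pmf uminus (pmf_of_set (neighbours x))"
    unfolding neighbours_uminus by (intro map_pmf_of_set_inj[symmetric]) (auto simp: inj_on_def)
  then show ?case
    by (simp add: bind_map_pmf map_bind_pmf Suc.IH)
qed simp

definition hk :: "nat \<Rightarrow> int ^ 'd::finite \<Rightarrow> real" where
  "hk m x = pmf (rw m x) 0"

lemma pmf_rw: "pmf (rw m x) y = hk m (x - y)"
proof -
  have "rw m x = map_pmf (\<lambda>z. z + y) (rw m (x - y))"
    using rw_translate[of m "x - y" y] by simp
  then have "pmf (rw m x) y = pmf (map_pmf (\<lambda>z. z + y) (rw m (x - y))) (0 + y)"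
    by simp
  also have "\<dots> = hk m (x - y)"
    unfolding hk_def by (rule pmf_map_inj') (auto simp: inj_def)
  finally show ?thesis .
qed

lemma hk_uminus: "hk m (- x) = hk m x"
proof -
  have "hk m (- x) = pmf (map_pmf uminus (rw m x)) (- 0)"
    by (simp add: hk_def rw_uminus)
  also have "\<dots> = hk m x"
    unfolding hk_def by (rule pmf_map_inj') (auto simp: inj_def)
  finally show ?thesis .
qed

lemma hk_nonneg [simp]: "0 \<le> hk m x"
  by (simp add: hk_def)

lemma hk_le_1: "hk m x \<le> 1"
  by (simp add: hk_def pmf_le_1)

lemma avg_hk: "avg (\<lambda>y. ennreal (hk m y)) x = ennreal (hk (Suc m) x)"
  by (simp add: avg_def hk_def ennreal_pmf_bind)

lemma avg_power_hk:
  fixes x :: "int ^ 'd::finite"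
  shows "(avg ^^ j) (\<lambda>y. ennreal (hk m y)) x = ennreal (hk (j + m) x)"
proof (induction j arbitrary: x)
  case (Suc j)
  have "(avg ^^ j) (\<lambda>y. ennreal (hk m y)) = (\<lambda>x :: int ^ 'd. ennreal (hk (j + m) x))"
    using Suc.IH by auto
  then show ?case
    by (simp add: avg_hk)
qed simp

lemma avg_power_eq_sum: "(avg ^^ m) u x = (\<integral>\<^sup>+y. ennreal (hk m (x - y)) * u y \<partial>count_space UNIV)"
  unfolding avg_power nn_integral_measure_pmf pmf_rw ..

lemma chapman_kolmogorov:
  "ennreal (hk (m + n) x) = (\<integral>\<^sup>+y. ennreal (hk m (x - y)) * ennreal (hk n y) \<partial>count_space UNIV)"
  by (simp add: avg_power_hk[symmetric] avg_power_eq_sum)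

lemma nn_integral_translate:
  fixes f :: "'a::group_add \<Rightarrow> ennreal"
  shows "(\<integral>\<^sup>+x. f (x + z) \<partial>count_space UNIV) = (\<integral>\<^sup>+x. f x \<partial>count_space UNIV)"
proof (rule nn_integral_bij_count_space)
  show "bij (\<lambda>x. x + z)"
    by (rule bij_betwI[of _ _ _ "\<lambda>x. x - z"]) auto
qed

lemma chapman_kolmogorov_shift:
  "(\<integral>\<^sup>+x. ennreal (hk m x) * ennreal (hk n (x + z)) \<partial>count_space UNIV) = ennreal (hk (m + n) z)"
proof -
  have "(\<integral>\<^sup>+x. ennreal (hk m x) * ennreal (hk n (x + z)) \<partial>count_space UNIV) =
      (\<integral>\<^sup>+x. ennreal (hk m (z - (x + z))) * ennreal (hk n (x + z)) \<partial>count_space UNIV)"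
    by (simp add: hk_uminus)
  also have "\<dots> = (\<integral>\<^sup>+x. ennreal (hk m (z - x)) * ennreal (hk n x) \<partial>count_space UNIV)"
    by (rule nn_integral_translate)
  finally show ?thesis
    by (simp add: chapman_kolmogorov)
qed

lemma hk_Suc_ge:
  assumes "y \<in> neighbours x"
  shows "hk m y / (2 * real CARD('d)) \<le> hk (Suc m) (x :: int ^ 'd::finite)"
proof -
  have "hk (Suc m) x = (\<Sum>y\<in>neighbours x. hk m y) / card (neighbours x)"
    unfolding hk_def rw.simps pmf_bind by (subst integral_pmf_of_set) auto
  moreover have "hk m y \<le> (\<Sum>y\<in>neighbours x. hk m y)"
    using assms by (intro member_le_sum) auto
  ultimately show ?thesis
    by (simp add: card_neighbours divide_right_mono)
qed

text \<open>\<open>gap m y\<close> is half the squared distance in \<open>l\<^sup>2\<close> between the law of the walk at time \<open>m\<close>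
  and its translate by \<open>y\<close>, which is why its square root is subadditive in \<open>y\<close>.\<close>

definition gap :: "nat \<Rightarrow> int ^ 'd::finite \<Rightarrow> real" where
  "gap m y = hk (2 * m) (0 :: int ^ 'd) - hk (2 * m) y"

lemma gap_eq_square:
  fixes y :: "int ^ 'd::finite"
  shows "(\<integral>\<^sup>+x. ennreal ((hk m x - hk m (x + y))\<^sup>2) \<partial>count_space UNIV) = ennreal (2 * gap m y)" (is "?D = _")
  and gap_nonneg: "0 \<le> gap m y"
proof -
  have sq: "(\<integral>\<^sup>+x. ennreal ((hk m (x :: int ^ 'd))\<^sup>2) \<partial>count_space UNIV) = ennreal (hk (2 * m) (0 :: int ^ 'd))"
    using chapman_kolmogorov_shift[of m m "0 :: int ^ 'd"]
    by (simp add: power2_eq_square ennreal_mult mult_2)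
  have "?D + 2 * ennreal (hk (2 * m) y) =
      (\<integral>\<^sup>+x. ennreal ((hk m x - hk m (x + y))\<^sup>2) + 2 * (ennreal (hk m x) * ennreal (hk m (x + y))) \<partial>count_space UNIV)"
    using chapman_kolmogorov_shift[of m m y]
    by (simp add: nn_integral_add nn_integral_cmult mult_2[of m])
  also have "\<dots> = (\<integral>\<^sup>+x. ennreal ((hk m x)\<^sup>2) + ennreal ((hk m (x + y))\<^sup>2) \<partial>count_space UNIV)"
  proof (rule nn_integral_cong)
    fix x
    have "ennreal ((hk m x - hk m (x + y))\<^sup>2) + 2 * (ennreal (hk m x) * ennreal (hk m (x + y))) =
        ennreal ((hk m x - hk m (x + y))\<^sup>2) + ennreal (2 * (hk m x * hk m (x + y)))"
      by (simp add: ennreal_mult)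
    also have "\<dots> = ennreal ((hk m x - hk m (x + y))\<^sup>2 + 2 * (hk m x * hk m (x + y)))"
      by (rule ennreal_plus[symmetric]) auto
    also have "\<dots> = ennreal ((hk m x)\<^sup>2 + (hk m (x + y))\<^sup>2)"
      by (rule arg_cong[where f = ennreal]) (simp add: power2_eq_square algebra_simps)
    finally show "ennreal ((hk m x - hk m (x + y))\<^sup>2) + 2 * (ennreal (hk m x) * ennreal (hk m (x + y))) =
        ennreal ((hk m x)\<^sup>2) + ennreal ((hk m (x + y))\<^sup>2)"
      by simp
  qed
  also have "\<dots> = 2 * ennreal (hk (2 * m) (0 :: int ^ 'd))"
    using nn_integral_translate[of "\<lambda>x. ennreal ((hk m x)\<^sup>2)" y]
    by (simp add: nn_integral_add sq mult_2)
  finally have eq: "?D + 2 * ennreal (hk (2 * m) y) = 2 * ennreal (hk (2 * m) (0 :: int ^ 'd))" .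
  have "2 * ennreal (hk (2 * m) y) \<le> 2 * ennreal (hk (2 * m) (0 :: int ^ 'd))"
    unfolding eq[symmetric] by (rule add_increasing) auto
  then have "ennreal (2 * hk (2 * m) y) \<le> ennreal (2 * hk (2 * m) (0 :: int ^ 'd))"
    by (simp add: ennreal_mult)
  then show nn: "0 \<le> gap m y"
    by (simp add: gap_def)
  have "?D + ennreal (2 * hk (2 * m) y) = ennreal (2 * gap m y) + ennreal (2 * hk (2 * m) y)"
    using eq nn by (subst ennreal_plus[symmetric]) (auto simp: gap_def ennreal_mult)
  then show "?D = ennreal (2 * gap m y)"
    by (simp add: add.commute ennreal_add_left_cancel)
qed

text \<open>The triangle inequality of \<open>l^2\<close> in squared form; the free weight
  \<open>t\<close> avoids square roots.\<close>

lemma gap_add: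
  fixes y z :: "int ^ 'd::finite"
  assumes "0 < t"
  shows "gap m (y + z) \<le> (1 + t) * gap m y + (1 + 1 / t) * gap m z"
proof -
  have "ennreal (2 * gap m (y + z)) = (\<integral>\<^sup>+x. ennreal ((hk m x - hk m (x + (y + z)))\<^sup>2) \<partial>count_space UNIV)"
    by (simp add: gap_eq_square)
  also have "\<dots> \<le> (\<integral>\<^sup>+x. ennreal (1 + t) * ennreal ((hk m x - hk m (x + y))\<^sup>2)
      + ennreal (1 + 1 / t) * ennreal ((hk m (x + y) - hk m (x + y + z))\<^sup>2) \<partial>count_space UNIV)"
  proof (rule nn_integral_mono)
    fix x :: "int ^ 'd"
    have sq: "(a + b)\<^sup>2 \<le> (1 + t) * a\<^sup>2 + (1 + 1 / t) * b\<^sup>2" for a b :: real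
    proof -
      have "0 \<le> (t * a - b)\<^sup>2 / t"
        using assms by simp
      also have "\<dots> = (1 + t) * a\<^sup>2 + (1 + 1 / t) * b\<^sup>2 - (a + b)\<^sup>2"
        using assms by (simp add: power2_eq_square field_simps)
      finally show ?thesis by simp
    qed
    have "ennreal ((hk m x - hk m (x + (y + z)))\<^sup>2) \<le>
        ennreal ((1 + t) * (hk m x - hk m (x + y))\<^sup>2 + (1 + 1 / t) * (hk m (x + y) - hk m (x + y + z))\<^sup>2)"
      using sq[of "hk m x - hk m (x + y)" "hk m (x + y) - hk m (x + y + z)"]
      by (intro ennreal_leI) (simp add: add.assoc)
    also have "\<dots> = ennreal (1 + t) * ennreal ((hk m x - hk m (x + y))\<^sup>2)
      + ennreal (1 + 1 / t) * ennreal ((hk m (x + y) - hk m (x + y + z))\<^sup>2)"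
      using assms by (subst ennreal_plus) (auto simp: ennreal_mult simp del: ennreal_plus)
    finally show "ennreal ((hk m x - hk m (x + (y + z)))\<^sup>2) \<le>
      ennreal (1 + t) * ennreal ((hk m x - hk m (x + y))\<^sup>2)
      + ennreal (1 + 1 / t) * ennreal ((hk m (x + y) - hk m (x + y + z))\<^sup>2)" .
  qed
  also have "\<dots> = ennreal (1 + t) * ennreal (2 * gap m y) + ennreal (1 + 1 / t) *
      (\<integral>\<^sup>+x. ennreal ((hk m (x + y) - hk m (x + y + z))\<^sup>2) \<partial>count_space UNIV)"
    by (simp add: nn_integral_add nn_integral_cmult gap_eq_square)
  also have "(\<integral>\<^sup>+x. ennreal ((hk m (x + y) - hk m (x + y + z))\<^sup>2) \<partial>count_space UNIV) = ennreal (2 * gap m z)"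
    using nn_integral_translate[of "\<lambda>x. ennreal ((hk m x - hk m (x + z))\<^sup>2)" y]
    by (simp add: gap_eq_square)
  also have "ennreal (1 + t) * ennreal (2 * gap m y) + ennreal (1 + 1 / t) * ennreal (2 * gap m z) =
      ennreal ((1 + t) * (2 * gap m y) + (1 + 1 / t) * (2 * gap m z))"
    using assms gap_nonneg[of m y] gap_nonneg[of m z]
    by (subst ennreal_plus) (auto simp: ennreal_mult simp del: ennreal_plus)
  finally have "2 * gap m (y + z) \<le> (1 + t) * (2 * gap m y) + (1 + 1 / t) * (2 * gap m z)"
    using assms gap_nonneg[of m y] gap_nonneg[of m z]
    by (subst (asm) ennreal_le_iff) (auto intro!: add_nonneg_nonneg mult_nonneg_nonneg)
  then show ?thesis
    by simp
qed

lemma gap_0 [simp]: "gap m 0 = 0"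
  by (simp add: gap_def)

lemma gap_sum:
  assumes "finite I" "\<And>i. i \<in> I \<Longrightarrow> gap m (v i) \<le> M" "0 \<le> M"
  shows "gap m (\<Sum>i\<in>I. v i) \<le> (real (card I))\<^sup>2 * M"
  using assms(1,2)
proof (induction I rule: finite_induct)
  case (insert i I)
  show ?case
  proof (cases "I = {}")
    case True
    have "gap m (v i) \<le> M"
      by (rule insert.prems) simp
    then have "gap m (\<Sum>i\<in>{i}. v i) \<le> (real (card {i}))\<^sup>2 * M"
      by simp
    then show ?thesis
      unfolding True .
  next
    case False
    define k where "k = real (card I)"
    have k: "0 < k"
      using False insert by (simp add: k_def card_gt_0_iff)
    \<comment> \<open>The weight \<open>k\<close>, the number of vectors summed so far, gives
      \<open>(1 + k) + (1 + 1/k) * k^2 = (k + 1)^2\<close>, so nothing is lost against the triangle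
      inequality.\<close>
    have "gap m (v i + (\<Sum>i\<in>I. v i)) \<le> (1 + k) * gap m (v i) + (1 + 1 / k) * gap m (\<Sum>i\<in>I. v i)"
      using k by (rule gap_add)
    also have "\<dots> \<le> (1 + k) * M + (1 + 1 / k) * (k\<^sup>2 * M)"
      using k insert by (intro add_mono mult_left_mono) (auto simp: k_def)
    also have "\<dots> = (k + 1)\<^sup>2 * M"
      using k by (simp add: power2_eq_square field_simps)
    finally show ?thesis
      using insert by (simp add: k_def add.commute)
  qed
qed simp

lemma axis_neighbours: "x + axis i 1 \<in> neighbours x" "x - axis i 1 \<in> neighbours x"
  by (auto simp: neighbours_def)

text \<open>The decrease of the return probability over two steps is the mean of
  \<open>gap m\<close> at the position of the walk after two steps, and \<open>2 e_i\<close> is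
  reached with probability at least \<open>1 / (2 d)^2\<close>. Even displacements are forced by the
  parity of the walk.\<close>

lemma gap_decrease:
  fixes i :: "'d::finite"
  shows "gap m (axis i 2) \<le> 4 * (real CARD('d))\<^sup>2 * (hk (2 * m) (0 :: int ^ 'd) - hk (2 * Suc m) (0 :: int ^ 'd))"
proof -
  let ?e = "axis i 2 :: int ^ 'd"
  let ?d = "real CARD('d)"
  have int: "integrable (rw 2 (0 :: int ^ 'd)) (\<lambda>y. hk (2 * m) y)"
    by (intro measure_pmf.integrable_const_bound[of _ 1]) (auto simp: hk_le_1)
  have ge: "1 / (4 * ?d\<^sup>2) \<le> pmf (rw 2 0) ?e"
  proof -
    have "(1 :: real) / (2 * ?d) / (2 * ?d) \<le> hk 2 (- ?e)"
    proof -
      have "hk 0 (0 :: int ^ 'd) / (2 * ?d) \<le> hk (Suc 0) (- axis i 1 :: int ^ 'd)"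
        by (rule hk_Suc_ge) (use axis_neighbours(1)[of "- axis i 1" i] in simp)
      then have "1 / (2 * ?d) / (2 * ?d) \<le> hk (Suc 0) (- axis i 1 :: int ^ 'd) / (2 * ?d)"
        by (intro divide_right_mono) (auto simp: hk_def)
      also have "\<dots> \<le> hk (Suc (Suc 0)) (- ?e)"
      proof (rule hk_Suc_ge)
        have "axis i 2 = axis i 1 + (axis i 1 :: int ^ 'd)"
          by (simp add: vec_eq_iff axis_def)
        then show "- axis i 1 \<in> neighbours (- ?e)"
          using axis_neighbours(1)[of "- ?e" i] by (simp add: algebra_simps)
      qed
      finally show ?thesis
        by (simp add: numeral_2_eq_2)
    qed
    then show ?thesis
      by (simp add: pmf_rw power2_eq_square)
  qed
  have "1 / (4 * ?d\<^sup>2) * gap m ?e \<le> pmf (rw 2 0) ?e * gap m ?e"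
    using ge by (intro mult_right_mono gap_nonneg)
  also have "\<dots> = measure_pmf.expectation (rw 2 0) (\<lambda>y. indicator {?e} y * gap m ?e)"
    by (simp add: measure_pmf_single)
  also have "\<dots> \<le> measure_pmf.expectation (rw 2 (0 :: int ^ 'd)) (gap m)"
  proof (rule Bochner_Integration.integral_mono)
    show "integrable (rw 2 0) (gap m :: int ^ 'd \<Rightarrow> real)"
      unfolding gap_def[abs_def] using int by auto
    show "integrable (rw 2 0) (\<lambda>y. indicator {?e} y * gap m ?e)"
      by (intro measure_pmf.integrable_const_bound[of _ "gap m ?e"]) (auto simp: indicator_def gap_nonneg)
  qed (auto simp: indicator_def gap_nonneg)
  also have "\<dots> = hk (2 * m) (0 :: int ^ 'd) - measure_pmf.expectation (rw 2 (0 :: int ^ 'd)) (hk (2 * m))"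
    unfolding gap_def[abs_def] using int by (subst Bochner_Integration.integral_diff) auto
  also have "measure_pmf.expectation (rw 2 (0 :: int ^ 'd)) (hk (2 * m)) = hk (2 * Suc m) (0 :: int ^ 'd)"
  proof -
    have "hk (2 * Suc m) (0 :: int ^ 'd) = pmf (bind_pmf (rw 2 0) (rw (2 * m))) (0 :: int ^ 'd)"
      unfolding hk_def rw_add[symmetric] by simp
    then show ?thesis
      unfolding pmf_bind hk_def[abs_def] ..
  qed
  finally show ?thesis
    by (simp add: field_simps)
qed

lemma card_vec_box:
  fixes A :: "'a set"
  assumes "finite A"
  shows "finite {x :: 'a ^ 'd::finite. \<forall>i. x $ i \<in> A}"
    and "card {x :: 'a ^ 'd::finite. \<forall>i. x $ i \<in> A} = card A ^ CARD('d)"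
proof -
  have bij: "bij_betw (\<lambda>f. \<chi> i. f i) (PiE (UNIV :: 'd set) (\<lambda>_. A)) {x :: 'a ^ 'd. \<forall>i. x $ i \<in> A}"
    by (rule bij_betwI[of _ _ _ "\<lambda>x i. x $ i"]) (auto simp: PiE_def Pi_def)
  show "card {x :: 'a ^ 'd. \<forall>i. x $ i \<in> A} = card A ^ CARD('d)"
    using bij_betw_same_card[OF bij] by (simp add: card_PiE)
  show "finite {x :: 'a ^ 'd. \<forall>i. x $ i \<in> A}"
    using bij_betw_finite[OF bij] assms by (simp add: finite_PiE)
qed

lemma sum_pmf_le_1: "finite A \<Longrightarrow> (\<Sum>x\<in>A. pmf p x) \<le> 1"
  by (metis measure_measure_pmf_finite measure_pmf.prob_le_1)

text \<open>A Nash-type inequality. Average over a box of \<open>r^d\<close> even points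
  \<open>y\<close>: the values at \<open>y\<close> sum to at most 1, and their distance from the
  value at 0 is a gap, controlled by joining 0 to \<open>y\<close> along the axes in steps of length
  two. \<open>gap_sum\<close> along a line costs \<open>r^2\<close> and over the coordinates
  \<open>d^2\<close>.\<close>

lemma hk_nash:
  assumes "1 \<le> r"
  shows "hk (2 * m) (0 :: int ^ 'd::finite) \<le>
    4 * real CARD('d) ^ 4 * (real r)\<^sup>2 * (hk (2 * m) (0 :: int ^ 'd) - hk (2 * Suc m) (0 :: int ^ 'd))
    + 1 / real r ^ CARD('d)"
proof -
  let ?d = "real CARD('d)"
  define D where "D = hk (2 * m) (0 :: int ^ 'd) - hk (2 * Suc m) (0 :: int ^ 'd)"
  define E where "E = 4 * ?d\<^sup>2 * D"
  define Y where "Y = {y :: int ^ 'd. \<forall>i. y $ i \<in> (\<lambda>k. 2 * int k) ` {..<r}}"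
  have E: "gap m (axis i 2 :: int ^ 'd) \<le> E" for i
    unfolding E_def D_def by (rule gap_decrease)
  have "0 \<le> E"
    using E gap_nonneg order_trans by blast
  have line: "gap m (axis i (2 * int k) :: int ^ 'd) \<le> (real k)\<^sup>2 * E" for i k
  proof -
    have "axis i (2 * int k) = (\<Sum>j<k. axis i 2 :: int ^ 'd)"
      by (simp add: vec_eq_iff sum_component del: sum_constant) (simp add: axis_def)
    then show ?thesis
      using gap_sum[of "{..<k}" m "\<lambda>_. axis i 2 :: int ^ 'd" E] E \<open>0 \<le> E\<close> by simp
  qed
  have gapY: "gap m y \<le> ?d\<^sup>2 * ((real r)\<^sup>2 * E)" if yY: "y \<in> Y" for y
  proof -
    have "y = (\<Sum>i\<in>UNIV. axis i (y $ i))"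
      by (simp add: vec_eq_iff axis_def sum.delta')
    moreover have "gap m (axis i (y $ i)) \<le> (real r)\<^sup>2 * E" for i
    proof -
      obtain k where k: "y $ i = 2 * int k" "k < r"
        using yY unfolding Y_def by blast
      have "gap m (axis i (y $ i)) \<le> (real k)\<^sup>2 * E"
        unfolding k by (rule line)
      also have "\<dots> \<le> (real r)\<^sup>2 * E"
        using k \<open>0 \<le> E\<close> by (intro mult_right_mono power_mono) auto
      finally show ?thesis .
    qed
    ultimately show ?thesis
      using gap_sum[of UNIV m "\<lambda>i. axis i (y $ i)" "(real r)\<^sup>2 * E"] \<open>0 \<le> E\<close> by simp
  qed
  have card: "card Y = r ^ CARD('d)" and fin: "finite Y"
    unfolding Y_def by (subst card_vec_box) (auto simp: card_image inj_on_def intro: card_vec_box)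
  have "real (card Y) * hk (2 * m) (0 :: int ^ 'd) = (\<Sum>y\<in>Y. gap m y + hk (2 * m) y)"
    by (simp add: gap_def)
  also have "\<dots> \<le> (\<Sum>y\<in>Y. ?d\<^sup>2 * ((real r)\<^sup>2 * E)) + (\<Sum>y\<in>Y. pmf (rw (2 * m) 0) y)"
    unfolding sum.distrib by (intro add_mono sum_mono gapY) (auto simp: pmf_rw hk_uminus)
  also have "\<dots> \<le> real (card Y) * (?d\<^sup>2 * ((real r)\<^sup>2 * E)) + 1"
    using sum_pmf_le_1[OF fin] by simp
  finally have "hk (2 * m) (0 :: int ^ 'd) \<le> ?d\<^sup>2 * ((real r)\<^sup>2 * E) + 1 / real (card Y)"
    using assms by (simp add: card field_simps)
  also have "?d\<^sup>2 * ((real r)\<^sup>2 * E) = 4 * ?d ^ 4 * (real r)\<^sup>2 * D"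
    by (simp add: E_def power2_eq_square power4_eq_xxxx)
  finally show ?thesis
    by (simp add: card D_def)
qed

lemma one_plus_powr_minus_ge:
  fixes a x :: real
  assumes "0 \<le> a" "0 \<le> x"
  shows "1 - a * x \<le> (1 + x) powr (- a)"
proof -
  have "1 - a * x \<le> 1 - a * ln (1 + x)"
    using assms ln_add_one_self_le_self[of x] by (simp add: mult_left_mono)
  also have "\<dots> \<le> exp (- a * ln (1 + x))"
    using exp_ge_add_one_self[of "- a * ln (1 + x)"] by simp
  also have "\<dots> = (1 + x) powr (- a)"
    using assms by (simp add: powr_def)
  finally show ?thesis .
qed

text \<open>The induction compares \<open>u\<close> with \<open>C (m + 1) powr (-d/2)\<close>, taking \<open>r\<close> of the order of the
  diffusive scale \<open>\<rho> * sqrt (m + 1)\<close>.\<close>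

lemma nash_decay:
  fixes u :: "nat \<Rightarrow> real"
  assumes d: "1 \<le> d" and K: "1 \<le> K" and u1: "\<And>m. u m \<le> 1"
    and nash: "\<And>m r. 1 \<le> r \<Longrightarrow> u m \<le> K * (real r)\<^sup>2 * (u m - u (Suc m)) + 1 / real r ^ d"
  obtains C where "0 < C" "\<And>m. u m \<le> C * real (Suc m) powr (- real d / 2)"
proof -
  \<comment> \<open>Chosen so that \<open>K * (2 * x)^2 = n / d\<close> at
    \<open>x = \<rho> * sqrt n\<close>: the contraction rate at scale \<open>r \<le> 2 * x\<close>
    is then at least \<open>d / n\<close>, which is what the decay \<open>n powr (-d/2)\<close>
    consumes. The factor 2 in \<open>C\<close> below makes the error \<open>1 / r^d\<close> at most
    half of the bound.\<close>
  define \<rho> where "\<rho> = 1 / sqrt (4 * K * real d)"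
  have rho: "0 < \<rho>" "\<rho>\<^sup>2 = 1 / (4 * K * real d)"
    using d K by (simp_all add: \<rho>_def power_divide)
  define C where "C = 2 * \<rho> powr (- real d)"
  have C: "0 < C"
    using rho by (simp add: C_def)
  have scale: "\<rho> powr (- real d) * n powr (- real d / 2) = (\<rho> * sqrt n) powr (- real d)" if "0 < n" for n
    using that rho by (simp add: powr_mult powr_half_sqrt[symmetric] powr_powr)
  have trivial: "u m \<le> C * n powr (- real d / 2)" if "\<rho> * sqrt n \<le> 1" "0 < n" for n m
  proof -
    have "1 powr (- real d) \<le> (\<rho> * sqrt n) powr (- real d)"
      using that rho d by (intro powr_mono2') auto
    then show ?thesis
      using u1[of m] scale[OF that(2)] by (simp add: C_def)
  qed
  have "u m \<le> C * real (Suc m) powr (- real d / 2)" for m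
  proof (induction m)
    case 0
    have "\<rho> \<le> 1"
      unfolding \<rho>_def using d K mult_mono[of 1 K 1 "real d"] by (simp add: divide_le_eq real_le_rsqrt)
    then show ?case
      by (intro trivial) auto
  next
    case (Suc m)
    define n where "n = real (Suc m)"
    have n: "1 \<le> n"
      by (simp add: n_def)
    have Suc_n: "real (Suc (Suc m)) = n + 1"
      by (simp add: n_def)
    show ?case
    proof (cases "\<rho> * sqrt (n + 1) \<le> 1")
      case True
      then show ?thesis
        unfolding Suc_n using n by (intro trivial) auto
    next
      case False
      define x where "x = \<rho> * sqrt n"
      have x: "1 / 2 < x"
      proof -
        have "sqrt (n + 1) \<le> sqrt (4 * n)"
          using n by (intro real_sqrt_le_mono) simp
        also have "\<dots> = 2 * sqrt n"
          by (simp add: real_sqrt_mult)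
        finally have "\<rho> * sqrt (n + 1) \<le> 2 * x"
          using rho by (simp add: x_def mult_left_mono)
        with False show ?thesis by simp
      qed
      define r where "r = nat \<lceil>x\<rceil>"
      have r: "x \<le> real r" "real r \<le> 2 * x" "1 \<le> r"
      proof -
        have r': "real r = of_int \<lceil>x\<rceil>" "1 \<le> \<lceil>x\<rceil>"
          using x by (auto simp: r_def)
        show "x \<le> real r" "1 \<le> r"
          using r' by (auto simp: r_def le_nat_iff)
        show "real r \<le> 2 * x"
        proof (cases "x \<le> 1")
          case True
          then have "\<lceil>x\<rceil> \<le> 1" by simp
          with r' x show ?thesis by linarith
        next
          case False
          then show ?thesis
            using r' by linarith
        qed
      qed
      define \<theta> where "\<theta> = 1 / (K * (real r)\<^sup>2)"
      have Kr: "1 \<le> K * (real r)\<^sup>2"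
        using K r mult_mono[of 1 K 1 "(real r)\<^sup>2"] by simp
      have \<theta>: "0 \<le> \<theta>" "\<theta> \<le> 1"
        using Kr by (auto simp: \<theta>_def)
      define B where "B = C * n powr (- real d / 2)"
      have r_le: "1 / real r ^ d \<le> B / 2"
      proof -
        have "1 / real r ^ d = real r powr (- real d)"
          using r by (simp add: powr_minus powr_realpow divide_inverse)
        also have "\<dots> \<le> x powr (- real d)"
          using r x by (intro powr_mono2') auto
        also have "\<dots> = B / 2"
          using n scale[of n] by (simp add: B_def C_def x_def)
        finally show ?thesis .
      qed
      have "\<theta> * u m \<le> \<theta> * (K * (real r)\<^sup>2 * (u m - u (Suc m)) + 1 / real r ^ d)"
        using \<theta> r by (intro mult_left_mono nash) auto
      also have "\<dots> = u m - u (Suc m) + \<theta> * (1 / real r ^ d)"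
      proof -
        have "\<theta> * (K * (real r)\<^sup>2) = 1"
          using K r by (simp add: \<theta>_def)
        then show ?thesis
          by algebra
      qed
      \<comment> \<open>A convex combination of the old value and of an error below half its bound:
        the bound contracts by \<open>1 - \<theta> / 2\<close> with
        \<open>\<theta> / 2 \<ge> d / (2 * n)\<close>.\<close>
      finally have "u (Suc m) \<le> (1 - \<theta>) * u m + \<theta> * (1 / real r ^ d)"
        by (simp add: algebra_simps)
      also have "\<dots> \<le> (1 - \<theta>) * B + \<theta> * (B / 2)"
        using \<theta> Suc.IH r_le by (intro add_mono mult_left_mono) (auto simp: B_def n_def)
      also have "\<dots> = B * (1 - \<theta> / 2)"
        by (simp add: algebra_simps)
      also have "\<dots> \<le> B * (1 - real d / 2 * (1 / n))"
      proof (intro mult_left_mono)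
        have "K * (real r)\<^sup>2 \<le> K * (2 * x)\<^sup>2"
          using r K by (intro mult_left_mono power_mono) auto
        also have "\<dots> = n / real d"
          using n rho K by (simp add: x_def power_mult_distrib)
        finally have "K * (real r)\<^sup>2 * real d \<le> n"
          using d by (simp add: field_simps)
        then show "1 - \<theta> / 2 \<le> 1 - real d / 2 * (1 / n)"
          using Kr n by (simp add: \<theta>_def field_simps)
      qed (use C in \<open>simp add: B_def\<close>)
      also have "\<dots> \<le> B * (1 + 1 / n) powr (- (real d / 2))"
        using n C by (intro mult_left_mono one_plus_powr_minus_ge) (auto simp: B_def)
      also have "\<dots> = C * (n + 1) powr (- real d / 2)"
      proof -
        have "n powr (- real d / 2) * (1 + 1 / n) powr (- (real d / 2)) = (n * (1 + 1 / n)) powr (- real d / 2)"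
          using n by (simp add: powr_mult)
        also have "n * (1 + 1 / n) = n + 1"
          using n by (simp add: field_simps)
        finally show ?thesis
          by (simp add: B_def)
      qed
      finally show ?thesis
        unfolding Suc_n .
    qed
  qed
  with C show ?thesis
    by (rule that)
qed

lemma hk_double_le:
  fixes x :: "int ^ 'd::finite"
  shows "hk (2 * m) x \<le> hk (2 * m) (0 :: int ^ 'd)"
  using gap_nonneg[of m x] by (simp add: gap_def)

lemma hk_Suc_le: "(\<And>y :: int ^ 'd::finite. hk m y \<le> B) \<Longrightarrow> hk (Suc m) (x :: int ^ 'd) \<le> B"
proof -
  assume *: "\<And>y :: int ^ 'd. hk m y \<le> B"
  have "0 \<le> B"
    using *[of 0] hk_nonneg[of m "0 :: int ^ 'd"] by linarith
  have "ennreal (hk (Suc m) x) \<le> avg (\<lambda>_. ennreal B) x"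
    unfolding avg_hk[symmetric] using * by (intro avg_mono ennreal_leI)
  then show ?thesis
    using \<open>0 \<le> B\<close> by simp
qed

text \<open>Even times come from the Nash argument at the origin; \<open>hk_double_le\<close> moves
  the bound to other points, and one more averaging step gives odd times.\<close>

theorem hk_upper:
  obtains C where "0 < C" "\<And>m x. hk m (x :: int ^ 'd::finite) \<le> C * real (Suc m) powr (- real CARD('d) / 2)"
proof -
  let ?d = "real CARD('d)"
  have d: "1 \<le> CARD('d)"
    by (simp add: Suc_le_eq)
  have K: "1 \<le> 4 * ?d ^ 4"
  proof -
    have "1 \<le> ?d"
      using d by linarith
    then have "1 \<le> ?d ^ 4"
      by (rule one_le_power)
    then show ?thesis
      by linarith
  qed
  obtain C where C: "0 < C" "\<And>m. hk (2 * m) (0 :: int ^ 'd) \<le> C * real (Suc m) powr (- ?d / 2)"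
    by (rule nash_decay[OF d K, of "\<lambda>m. hk (2 * m) (0 :: int ^ 'd)"]) (rule hk_le_1, erule hk_nash, blast)
  have "hk m x \<le> C * 2 powr (?d / 2) * real (Suc m) powr (- ?d / 2)" for m and x :: "int ^ 'd"
  proof -
    have *: "hk m x \<le> C * real (Suc (m div 2)) powr (- ?d / 2)"
    proof (cases "even m")
      case True
      then obtain k where "m = 2 * k" ..
      then show ?thesis
        using hk_double_le[of k x] C(2)[of k] by simp
    next
      case False
      then obtain k where k: "m = 2 * k + 1" ..
      have "hk (Suc (2 * k)) x \<le> hk (2 * k) (0 :: int ^ 'd)"
        by (rule hk_Suc_le) (rule hk_double_le)
      then show ?thesis
        using C(2)[of k] k by simp
    qed
    also have "\<dots> \<le> C * (real (Suc m) / 2) powr (- ?d / 2)"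
    proof (intro mult_left_mono powr_mono2')
      have "m \<le> 2 * (m div 2) + 1"
        by presburger
      then have "real m \<le> real (2 * (m div 2) + 1)"
        by (rule of_nat_mono)
      then show "real (Suc m) / 2 \<le> real (Suc (m div 2))"
        by simp
    qed (use C in auto)
    also have "\<dots> = C * 2 powr (?d / 2) * real (Suc m) powr (- ?d / 2)"
      by (simp add: powr_divide powr_minus field_simps)
    finally show ?thesis .
  qed
  then show ?thesis
    using C by (intro that[of "C * 2 powr (?d / 2)"]) auto
qed

section \<open>Lattice averages and the return probability from below\<close>

lemma axis_1_eq_iff: "(axis i (a::int) :: int ^ 'd::finite) = axis j b \<longleftrightarrow> i = j \<and> a = b" if "a \<noteq> 0"
  using that by (auto simp: axis_eq_axis)

lemma sum_neighbours:
  "(\<Sum>y\<in>neighbours (x :: int ^ 'd::finite). f y) = (\<Sum>i\<in>UNIV. f (x + axis i 1) + f (x - axis i 1))"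
proof -
  define g :: "'d \<times> bool \<Rightarrow> int ^ 'd" where "g = (\<lambda>(i, s). x + axis i (if s then 1 else -1))"
  have neg: "- axis i (1::int) = (axis i (-1) :: int ^ 'd)" for i
    by (simp add: vec_eq_iff axis_def)
  have img: "neighbours x = g ` (UNIV \<times> UNIV)"
  proof -
    have "g ` UNIV = (\<Union>i. {g (i, True), g (i, False)})"
      by (auto simp: UNIV_Times_UNIV[symmetric] UNIV_bool simp del: UNIV_Times_UNIV)
    then show ?thesis
      by (simp add: neighbours_def g_def neg[symmetric])
  qed
  have "inj g"
    by (auto simp: inj_on_def g_def axis_1_eq_iff split: if_splits)
  then have "(\<Sum>y\<in>neighbours x. f y) = (\<Sum>p\<in>UNIV \<times> UNIV. f (g p))"
    unfolding img by (subst sum.reindex) (auto intro: inj_on_subset)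
  also have "\<dots> = (\<Sum>i\<in>UNIV. \<Sum>s\<in>UNIV. f (g (i, s)))"
    by (simp add: sum.cartesian_product)
  also have "\<dots> = (\<Sum>i\<in>UNIV. f (x + axis i 1) + f (x - axis i 1))"
    by (simp add: UNIV_bool g_def neg[symmetric] add.commute)
  finally show ?thesis .
qed

definition ravg :: "(int ^ 'd \<Rightarrow> real) \<Rightarrow> int ^ 'd::finite \<Rightarrow> real" where
  "ravg f x = (\<Sum>i\<in>UNIV. f (x + axis i 1) + f (x - axis i 1)) / (2 * real CARD('d))"

lemma avg_ennreal:
  assumes "\<And>y. 0 \<le> f y"
  shows "avg (\<lambda>y. ennreal (f y)) x = ennreal (ravg f x)"
proof -
  have "avg (\<lambda>y. ennreal (f y)) x = ennreal (measure_pmf.expectation (pmf_of_set (neighbours x)) f)"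
    unfolding avg_def using assms
    by (intro nn_integral_eq_integral integrable_measure_pmf_finite) auto
  also have "measure_pmf.expectation (pmf_of_set (neighbours x)) f = ravg f x"
    by (subst integral_pmf_of_set) (auto simp: sum_neighbours card_neighbours ravg_def)
  finally show ?thesis .
qed

definition sqnorm :: "int ^ 'd::finite \<Rightarrow> real" where
  "sqnorm x = (\<Sum>i\<in>UNIV. (real_of_int (x $ i))\<^sup>2)"

lemma sqnorm_nonneg [simp]: "0 \<le> sqnorm x"
  by (simp add: sqnorm_def sum_nonneg)

lemma sqnorm_add_axis:
  "sqnorm (x + axis i 1) = sqnorm x + 1 + 2 * real_of_int (x $ i)"
  "sqnorm (x - axis i 1) = sqnorm x + 1 - 2 * real_of_int (x $ i)"
proof -
  have *: "(\<Sum>j\<in>UNIV. g j) = g i + (\<Sum>j\<in>UNIV - {i}. g j)" for g :: "'a \<Rightarrow> real"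
    by (rule sum.remove) auto
  have "sqnorm (x + axis i 1) = (real_of_int (x $ i) + 1)\<^sup>2 + (\<Sum>j\<in>UNIV - {i}. (real_of_int (x $ j))\<^sup>2)"
    unfolding sqnorm_def by (subst *) (auto simp: axis_def intro!: sum.cong)
  then show "sqnorm (x + axis i 1) = sqnorm x + 1 + 2 * real_of_int (x $ i)"
    unfolding sqnorm_def *[of "\<lambda>j. (real_of_int (x $ j))\<^sup>2"] by (simp add: power2_eq_square algebra_simps)
  have "sqnorm (x - axis i 1) = (real_of_int (x $ i) - 1)\<^sup>2 + (\<Sum>j\<in>UNIV - {i}. (real_of_int (x $ j))\<^sup>2)"
    unfolding sqnorm_def by (subst *) (auto simp: axis_def intro!: sum.cong)
  then show "sqnorm (x - axis i 1) = sqnorm x + 1 - 2 * real_of_int (x $ i)"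
    unfolding sqnorm_def *[of "\<lambda>j. (real_of_int (x $ j))\<^sup>2"] by (simp add: power2_eq_square algebra_simps)
qed

lemma sqnorm_component_le: "(real_of_int (x $ i))\<^sup>2 \<le> sqnorm x"
  unfolding sqnorm_def by (intro member_le_sum) auto

lemma ravg_sqnorm: "ravg sqnorm x = sqnorm x + 1"
  by (simp add: ravg_def sqnorm_add_axis field_simps)

lemma avg_power_sqnorm: "(avg ^^ m) (\<lambda>y. ennreal (sqnorm y)) x = ennreal (sqnorm (x :: int ^ 'd::finite) + real m)"
proof (induction m arbitrary: x)
  case (Suc m)
  have "(avg ^^ m) (\<lambda>y. ennreal (sqnorm y)) = (\<lambda>x :: int ^ 'd. ennreal (sqnorm x + real m))"
    using Suc.IH by auto
  moreover have "ravg (\<lambda>y :: int ^ 'd. sqnorm y + real m) x = ravg sqnorm x + real m"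
    by (simp add: ravg_def sum.distrib) (simp add: field_simps)
  ultimately show ?case
    using avg_ennreal[of "\<lambda>y :: int ^ 'd. sqnorm y + real m" x]
    by (simp add: ravg_sqnorm add.assoc add.commute del: ennreal_plus)
qed simp

lemma rw_tail: "measure (rw m (0 :: int ^ 'd::finite)) {x. a \<le> sqnorm x} \<le> real m / a" if "0 < a"
proof -
  have "ennreal a * emeasure (rw m 0) {x :: int ^ 'd. a \<le> sqnorm x} =
      (\<integral>\<^sup>+x. ennreal a * indicator {x :: int ^ 'd. a \<le> sqnorm x} x \<partial>rw m 0)"
    by (simp add: nn_integral_cmult)
  also have "\<dots> \<le> (\<integral>\<^sup>+x. ennreal (sqnorm x) \<partial>rw m (0 :: int ^ 'd))"
    by (intro nn_integral_mono) (auto simp: indicator_def intro: ennreal_leI)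
  also have "\<dots> = ennreal (real m)"
    unfolding avg_power[symmetric] avg_power_sqnorm by (simp add: sqnorm_def)
  finally have "a * measure (rw m (0 :: int ^ 'd)) {x. a \<le> sqnorm x} \<le> real m"
    using that by (simp add: measure_pmf.emeasure_eq_measure ennreal_mult[symmetric])
  then show ?thesis
    using that by (simp add: field_simps)
qed

text \<open>With probability at least 1/2 the walk at time \<open>m\<close> lies in a box of side of
  order \<open>sqrt m\<close>. By Cauchy--Schwarz the squares of its point masses sum to at least
  the inverse volume up to a constant, and that sum is at most the return probability at time
  \<open>2 * m\<close>.\<close>

theorem hk_lower:
  obtains c where "0 < c" "\<And>m. c * real (Suc m) powr (- real CARD('d) / 2) \<le> hk (2 * m) (0 :: int ^ 'd::finite)"
proof -
  let ?d = "real CARD('d)"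
  have "1 / 4 * 4 powr (- ?d) * real (Suc m) powr (- ?d / 2) \<le> hk (2 * m) (0 :: int ^ 'd)" for m
  proof -
    define n where "n = real (Suc m)"
    have n: "1 \<le> n"
      by (simp add: n_def)
    define R where "R = \<lfloor>sqrt (2 * n)\<rfloor>"
    have R: "0 \<le> R" "real_of_int R \<le> sqrt (2 * n)"
      using n by (auto simp: R_def)
    define S where "S = {x :: int ^ 'd. \<forall>i. x $ i \<in> {-R..R}}"
    have fin: "finite S" and card: "card S = nat (2 * R + 1) ^ CARD('d)"
      unfolding S_def by (rule card_vec_box, simp) (subst card_vec_box, simp, simp add: algebra_simps)
    have "{x :: int ^ 'd. sqnorm x < 2 * n} \<subseteq> S"
    proof
      fix x :: "int ^ 'd" assume x: "x \<in> {x. sqnorm x < 2 * n}"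
      show "x \<in> S"
        unfolding S_def
      proof safe
        fix i
        have "(real_of_int (x $ i))\<^sup>2 \<le> 2 * n"
          using x sqnorm_component_le[of x i] by simp
        then have "\<bar>real_of_int (x $ i)\<bar> \<le> sqrt (2 * n)"
          using real_le_rsqrt by auto
        then have "\<bar>x $ i\<bar> \<le> R"
          unfolding R_def by (simp add: le_floor_iff)
        then show "x $ i \<in> {-R..R}"
          by auto
      qed
    qed
    then have "measure (rw m 0) {x :: int ^ 'd. sqnorm x < 2 * n} \<le> measure (rw m 0) S"
      by (intro measure_pmf.finite_measure_mono) auto
    moreover have "measure (rw m 0) {x :: int ^ 'd. sqnorm x < 2 * n} = 1 - measure (rw m 0) {x :: int ^ 'd. 2 * n \<le> sqnorm x}"
    proof -
      have "{x :: int ^ 'd. sqnorm x < 2 * n} = UNIV - {x. 2 * n \<le> sqnorm x}"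
        by auto
      then show ?thesis
        using measure_pmf.prob_compl[of "{x :: int ^ 'd. 2 * n \<le> sqnorm x}" "rw m 0"] by simp
    qed
    moreover have "real m / (2 * n) \<le> 1 / 2"
      using n by (simp add: n_def field_simps)
    ultimately have half: "1 / 2 \<le> (\<Sum>x\<in>S. hk m x)"
    proof -
      assume *: "measure (rw m 0) {x :: int ^ 'd. sqnorm x < 2 * n} \<le> measure (rw m 0) S"
        "measure (rw m 0) {x :: int ^ 'd. sqnorm x < 2 * n} = 1 - measure (rw m 0) {x :: int ^ 'd. 2 * n \<le> sqnorm x}"
        "real m / (2 * n) \<le> 1 / 2"
      have "measure (rw m 0) {x :: int ^ 'd. 2 * n \<le> sqnorm x} \<le> real m / (2 * n)"
        using n by (intro rw_tail) simp
      moreover have "measure (rw m 0) S = (\<Sum>x\<in>S. hk m x)"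
        using measure_measure_pmf_finite[OF fin, of "rw m 0"] by (simp add: pmf_rw hk_uminus)
      ultimately show ?thesis
        using * by linarith
    qed
    have sq: "(\<Sum>x\<in>S. (hk m x)\<^sup>2) \<le> hk (2 * m) (0 :: int ^ 'd)"
    proof -
      have "ennreal (\<Sum>x\<in>S. (hk m x)\<^sup>2) = (\<Sum>x\<in>S. ennreal (hk m x) * ennreal (hk m x))"
        by (simp add: sum_ennreal[symmetric] power2_eq_square ennreal_mult)
      also have "\<dots> = (\<integral>\<^sup>+x. ennreal (hk m x) * ennreal (hk m x) \<partial>count_space S)"
        using fin by (simp add: nn_integral_count_space_finite)
      also have "\<dots> = (\<integral>\<^sup>+x. ennreal (hk m x) * ennreal (hk m x) * indicator S x \<partial>count_space UNIV)"
        by (subst nn_integral_count_space_indicator) auto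
      also have "\<dots> \<le> (\<integral>\<^sup>+x. ennreal (hk m x) * ennreal (hk m (x + 0)) \<partial>count_space (UNIV :: (int ^ 'd) set))"
        by (intro nn_integral_mono) (auto simp: indicator_def)
      also have "\<dots> = ennreal (hk (2 * m) (0 :: int ^ 'd))"
        unfolding chapman_kolmogorov_shift by (simp add: mult_2)
      finally show ?thesis
        by simp
    qed
    have "(1 / 2)\<^sup>2 \<le> (\<Sum>x\<in>S. hk m x)\<^sup>2"
      using half by (intro power_mono) auto
    also have "\<dots> \<le> real (card S) * (\<Sum>x\<in>S. (hk m x)\<^sup>2)"
      using Cauchy_Schwarz_ineq_sum[of "\<lambda>_. 1" "hk m" S] by simp
    also have "\<dots> \<le> (4 * sqrt n) ^ CARD('d) * hk (2 * m) (0 :: int ^ 'd)"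
    proof (intro mult_mono sq)
      \<comment> \<open>As \<open>sqrt 2 \<le> 3 / 2\<close>, the side is at most
        \<open>3 * sqrt n + 1\<close>.\<close>
      have "real (nat (2 * R + 1)) \<le> 4 * sqrt n"
      proof -
        have "sqrt 2 \<le> 3 / 2"
          by (rule real_le_lsqrt) (auto simp: power2_eq_square)
        then have "sqrt (2 * n) \<le> 3 / 2 * sqrt n"
          using n by (simp add: real_sqrt_mult mult_right_mono)
        moreover have "1 \<le> sqrt n"
          using n by simp
        moreover have "real (nat (2 * R + 1)) = 2 * real_of_int R + 1"
          using R(1) by simp
        ultimately show ?thesis
          using R(2) by linarith
      qed
      then show "real (card S) \<le> (4 * sqrt n) ^ CARD('d)"
        unfolding card of_nat_power by (intro power_mono) auto
    qed (use n in \<open>auto intro: sum_nonneg\<close>)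
    also have "(4 * sqrt n) ^ CARD('d) = 1 / (4 powr (- ?d) * n powr (- ?d / 2))"
    proof -
      have "(4 * sqrt n) ^ CARD('d) = (4 * sqrt n) powr ?d"
        using n by (simp add: powr_realpow)
      also have "\<dots> = 4 powr ?d * n powr (?d / 2)"
        using n by (simp add: powr_mult powr_half_sqrt[symmetric] powr_powr)
      finally show ?thesis
        by (simp add: powr_minus field_simps)
    qed
    finally show ?thesis
      unfolding n_def[symmetric] using n by (simp add: field_simps)
  qed
  then show ?thesis
    by (intro that[of "1 / 4 * 4 powr (- ?d)"]) auto
qed

section \<open>Moments of the number of visits\<close>

lemma sum_powr_le:
  assumes "0 \<le> a" "a < 1"
  shows "(\<Sum>m<N. real (Suc m) powr (- a)) \<le> real N powr (1 - a) / (1 - a)"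
proof (induction N)
  case (Suc N)
  define b where "b = 1 - a"
  have b: "0 < b" "b \<le> 1"
    using assms by (auto simp: b_def)
  \<comment> \<open>Weighted AM-GM for \<open>N powr b * (N + 1) powr (1 - b)\<close>, multiplied by
    \<open>(N + 1) powr (b - 1)\<close>: each term of the sum is bounded by an increment of
    \<open>N powr b / b\<close>.\<close>
  have "real N powr b + b * real (Suc N) powr (b - 1) \<le> real (Suc N) powr b"
  proof (cases "N = 0")
    case False
    have "real N powr b * real (Suc N) powr (1 - b) \<le> b * real N + (1 - b) * real (Suc N)"
      using b False by (intro Youngs_inequality_0) auto
    also have "\<dots> = real (Suc N) - b"
      by (simp add: algebra_simps)
    finally have "real N powr b * real (Suc N) powr (1 - b) * real (Suc N) powr (b - 1) \<le>
        (real (Suc N) - b) * real (Suc N) powr (b - 1)"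
      by (intro mult_right_mono) auto
    moreover have "real (Suc N) powr (1 - b) * real (Suc N) powr (b - 1) = 1"
      by (simp add: powr_add[symmetric])
    moreover have "real (Suc N) * real (Suc N) powr (b - 1) = real (Suc N) powr b"
      using powr_add[of "real (Suc N)" 1 "b - 1"] by simp
    ultimately show ?thesis
      by (simp add: algebra_simps del: of_nat_Suc)
  qed (use b in simp)
  moreover have ab: "- a = b - 1"
    by (simp add: b_def)
  moreover have "b * (\<Sum>m<N. real (Suc m) powr (b - 1)) \<le> real N powr b"
    using Suc b unfolding b_def[symmetric] ab by (simp add: field_simps del: of_nat_Suc)
  ultimately have "b * (\<Sum>m<Suc N. real (Suc m) powr (b - 1)) \<le> real (Suc N) powr b"
    by (simp add: distrib_left del: of_nat_Suc)
  then show ?case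
    using b unfolding b_def[symmetric] ab by (simp add: pos_le_divide_eq mult.commute del: of_nat_Suc sum.lessThan_Suc)
qed simp

text \<open>Telescoping of \<open>m powr (-1/2)\<close>. With \<open>s\<close> and \<open>t\<close>
  the square roots of consecutive integers, \<open>1/s - 1/t = 1/(s * t * (t + s))\<close> and
  \<open>t * (t + s) \<le> 4 * s^2\<close>.\<close>

lemma sum_powr_tail_le:
  "(\<Sum>m\<in>{k..<N}. real (Suc m) powr (- 3 / 2)) \<le> 4 * real (Suc k) powr (- 1 / 2)"
proof -
  have decrement: "real (Suc m) powr (- 3 / 2) \<le> 4 * (real (Suc m) powr (- 1 / 2) - real (Suc (Suc m)) powr (- 1 / 2))" for m
  proof -
    define s where "s = sqrt (real (Suc m))"
    define t where "t = sqrt (real (Suc (Suc m)))"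
    have st: "1 \<le> s" "s\<^sup>2 = real (Suc m)" "t\<^sup>2 = s\<^sup>2 + 1" "0 < t"
      by (auto simp: s_def t_def)
    have p1: "real (Suc m) powr (- 1 / 2) = 1 / s" "real (Suc (Suc m)) powr (- 1 / 2) = 1 / t"
      using powr_minus[of "real (Suc m)" "1 / 2"] powr_minus[of "real (Suc (Suc m))" "1 / 2"]
      by (simp_all add: s_def t_def powr_half_sqrt inverse_eq_divide del: of_nat_Suc)
    have p3: "real (Suc m) powr (- 3 / 2) = 1 / s ^ 3"
    proof -
      have "real (Suc m) powr (- 3 / 2) = (real (Suc m) powr (- 1 / 2)) ^ 3"
        using powr_power[of "real (Suc m)" "- 1 / 2" 3] by (simp del: of_nat_Suc)
      then show ?thesis
        unfolding p1 by (simp add: power_divide)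
    qed
    have "t \<le> 3 / 2 * s"
    proof (rule power2_le_imp_le)
      show "t\<^sup>2 \<le> (3 / 2 * s)\<^sup>2"
        using st one_le_power[OF st(1), of 2] by (simp add: power_mult_distrib power2_eq_square)
    qed (use st in auto)
    then have "t * (t + s) \<le> 3 / 2 * s * (3 / 2 * s + s)"
      using st by (intro mult_mono) auto
    also have "\<dots> \<le> 4 * s\<^sup>2"
      by (simp add: power2_eq_square)
    finally have "t * (t + s) \<le> 4 * s\<^sup>2" .
    moreover have "1 / s - 1 / t = 1 / (s * t * (t + s))"
    proof -
      have "(t - s) * (t + s) = 1"
        using st by (simp add: power2_eq_square algebra_simps)
      then have "t - s = 1 / (t + s)"
        using st by (simp add: field_simps)
      moreover have "1 / s - 1 / t = (t - s) / (s * t)"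
        using st by (simp add: field_simps)
      ultimately show ?thesis
        by simp
    qed
    moreover have "4 / (4 * s ^ 3) \<le> 4 / (s * t * (t + s))"
    proof (rule divide_left_mono)
      have "s * (t * (t + s)) \<le> s * (4 * s\<^sup>2)"
        using \<open>t * (t + s) \<le> 4 * s\<^sup>2\<close> st by (intro mult_left_mono) auto
      then show "s * t * (t + s) \<le> 4 * s ^ 3"
        by (simp add: power3_eq_cube power2_eq_square mult.assoc)
    qed (use st in \<open>auto intro!: mult_pos_pos add_pos_pos\<close>)
    ultimately show ?thesis
      unfolding p1 p3 by simp
  qed
  show ?thesis
  proof (cases "k \<le> N")
    case True
    have "(\<Sum>m\<in>{k..<N}. real (Suc m) powr (- 3 / 2)) \<le>
        4 * (real (Suc k) powr (- 1 / 2) - real (Suc N) powr (- 1 / 2))"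
      using True
    proof (induction N rule: dec_induct)
      case (step n)
      then show ?case
        using decrement[of n] by (simp del: of_nat_Suc)
    qed simp
    also have "\<dots> \<le> 4 * real (Suc k) powr (- 1 / 2)"
      by simp
    finally show ?thesis .
  qed simp
qed

text \<open>The Green function truncated at time \<open>N\<close>, the expected number of visits to
  the origin by a single walk.\<close>

definition green :: "nat \<Rightarrow> int ^ 'd::finite \<Rightarrow> real" where
  "green N x = (\<Sum>m<N. hk m x)"

lemma green_nonneg [simp]: "0 \<le> green N x"
  by (simp add: green_def sum_nonneg)

lemma green_mono: "M \<le> N \<Longrightarrow> green M x \<le> green N x"
  unfolding green_def by (intro sum_mono2) auto

lemma avg_sum: "avg (\<lambda>y. \<Sum>i\<in>I. u i y) x = (\<Sum>i\<in>I. avg (u i) x)"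
  unfolding avg_def by (rule nn_integral_sum) simp

lemma avg_power_sum: "(avg ^^ m) (\<lambda>y. \<Sum>i\<in>I. u i y) x = (\<Sum>i\<in>I. (avg ^^ m) (u i) x)"
  unfolding avg_power by (rule nn_integral_sum) simp

lemma avg_power_add: "(avg ^^ m) (\<lambda>y. u y + v y) x = (avg ^^ m) u x + (avg ^^ m) v x"
  unfolding avg_power by (rule nn_integral_add) simp_all

lemma avg_power_cmult: "(avg ^^ m) (\<lambda>y. c * u y) x = c * (avg ^^ m) u x"
  unfolding avg_power by (rule nn_integral_cmult) simp

lemma avg_power_const: "(avg ^^ m) (\<lambda>_. c) x = c"
  unfolding avg_power by simp

lemma avg_power_comp: "(avg ^^ m) ((avg ^^ n) u) x = (avg ^^ (m + n)) u x"
  by (simp add: funpow_add)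

definition zero_one :: "(int ^ 'd \<Rightarrow> nat) list \<Rightarrow> bool" where
  "zero_one \<phi>s \<longleftrightarrow> (\<forall>\<phi>\<in>set \<phi>s. \<forall>x. \<phi> x \<le> 1)"

lemma at_origin_le_1: "at_origin x \<le> 1"
  by (simp add: at_origin_def)

lemma zero_one_replicate [simp]: "zero_one (replicate N at_origin)"
  by (auto simp: zero_one_def at_origin_def)

text \<open>A discrete Duhamel formula: the source met after \<open>j\<close> steps sees only the
  remaining list \<open>drop j \<phi>s\<close> and is carried back by \<open>j\<close> steps of the
  walk.\<close>

lemma iterate_avg_le:
  fixes F :: "(int ^ 'd::finite \<Rightarrow> nat) list \<Rightarrow> int ^ 'd \<Rightarrow> ennreal"
  assumes "\<And>\<phi> \<phi>s x. zero_one (\<phi> # \<phi>s) \<Longrightarrow> F (\<phi> # \<phi>s) x \<le> avg (F \<phi>s) x + S (\<phi> # \<phi>s) x"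
    and "\<And>x. F [] x = 0" and "zero_one \<phi>s"
  shows "F \<phi>s x \<le> (\<Sum>j<length \<phi>s. (avg ^^ j) (S (drop j \<phi>s)) x)"
  using assms(3)
proof (induction \<phi>s arbitrary: x)
  case (Cons \<phi> \<phi>s)
  then have "zero_one \<phi>s"
    by (simp add: zero_one_def)
  have "F (\<phi> # \<phi>s) x \<le> avg (F \<phi>s) x + S (\<phi> # \<phi>s) x"
    by (rule assms(1)) fact
  also have "\<dots> \<le> avg (\<lambda>x. \<Sum>j<length \<phi>s. (avg ^^ j) (S (drop j \<phi>s)) x) x + S (\<phi> # \<phi>s) x"
    by (intro add_mono avg_mono Cons.IH order_refl \<open>zero_one \<phi>s\<close>)
  also have "\<dots> = (\<Sum>j<length (\<phi> # \<phi>s). (avg ^^ j) (S (drop j (\<phi> # \<phi>s))) x)"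
    by (simp add: avg_sum sum.lessThan_Suc_shift add.commute del: sum.lessThan_Suc)
  finally show ?case .
qed (simp add: assms(2))

context critical_offspring
begin

lemma visit_moment_1_Cons:
  assumes "\<phi> x \<le> 1"
  shows "visit_moment \<mu> 1 (\<phi> # \<phi>s) x = avg (visit_moment \<mu> 1 \<phi>s) x + of_nat (\<phi> x)"
  using visit_moment_Cons[of \<phi> x \<mu> 0 \<phi>s, OF assms] next_moment_1[of \<mu> \<phi>s x] by (simp add: bm_offspring_1[simplified])

text \<open>Many-to-one: with mean offspring 1, the expected configuration moves like the law of a
  single random walk.\<close>

lemma visit_moment_1_visits: "visit_moment \<mu> 1 (replicate N at_origin) x = ennreal (green N (x :: int ^ 'd::finite))"
proof (induction N arbitrary: x)
  case 0
  then show ?case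
    by (simp add: visit_moment_Nil green_def)
next
  case (Suc N)
  have IH: "visit_moment \<mu> 1 (replicate N at_origin) = (\<lambda>x :: int ^ 'd. \<Sum>m<N. ennreal (hk m x))"
    using Suc.IH by (auto simp: green_def)
  have "visit_moment \<mu> 1 (replicate (Suc N) at_origin) x = (\<Sum>m<N. ennreal (hk (Suc m) x)) + of_nat (at_origin x)"
    unfolding replicate_Suc visit_moment_1_Cons[of at_origin, OF at_origin_le_1] IH avg_sum avg_hk ..
  also have "of_nat (at_origin x) = ennreal (hk 0 x)"
    by (auto simp: at_origin_def hk_def)
  also have "(\<Sum>m<N. ennreal (hk (Suc m) x)) + ennreal (hk 0 x) = (\<Sum>m<Suc N. ennreal (hk m x))"
    by (simp add: sum.lessThan_Suc_shift add.commute del: sum.lessThan_Suc)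
  finally show ?case
    by (simp add: green_def del: sum.lessThan_Suc)
qed

text \<open>The term \<open>bm 2 \<mu>\<close> counts pairs of visits descending from two different
  children; the added 1 pays for pairs made of the particle's own visit and a later one.\<close>

definition pair_rate :: ennreal where "pair_rate = bm 2 \<mu> + 1"

lemma pair_rate_finite: "pair_rate < \<top>"
  by (simp add: pair_rate_def bm_offspring_finite)

lemma visit_moment_2_Cons_le:
  assumes "\<phi> x \<le> 1"
  shows "visit_moment \<mu> 2 (\<phi> # \<phi>s) x \<le> avg (visit_moment \<mu> 2 \<phi>s) x + pair_rate * (visit_moment \<mu> 1 (\<phi> # \<phi>s) x)\<^sup>2"
proof -
  define A where "A = avg (visit_moment \<mu> 1 \<phi>s) x"
  define p where "p = (of_nat (\<phi> x) :: ennreal)"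
  have "visit_moment \<mu> 2 (\<phi> # \<phi>s) x = avg (visit_moment \<mu> 2 \<phi>s) x + (bm 2 \<mu> * A\<^sup>2 + p * A)"
    using visit_moment_Cons[of \<phi> x \<mu> 1 \<phi>s, OF assms]
    unfolding Suc_1 next_moment_1 next_moment_2 bm_offspring_1 A_def p_def by (simp add: add.assoc)
  also have "\<dots> \<le> avg (visit_moment \<mu> 2 \<phi>s) x + (bm 2 \<mu> * (A + p)\<^sup>2 + 1 * (A + p)\<^sup>2)"
    by (intro add_mono mult_left_mono power_mono order_refl)
      (auto simp: power2_eq_square algebra_simps intro: add_increasing add_increasing2)
  finally show ?thesis
    by (simp add: visit_moment_1_Cons[of \<phi> x \<phi>s, OF assms, simplified] A_def p_def pair_rate_def algebra_simps)
qed

text \<open>Three visits not all descending from one child split as 1 + 2 or 1 + 1 + 1 among the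
  children, or consist of the particle's own visit and two later ones. The first and last kinds
  share the product of the first and second moments.\<close>

lemma visit_moment_3_Cons_le:
  assumes "\<phi> x \<le> 1"
  shows "visit_moment \<mu> 3 (\<phi> # \<phi>s) x \<le> avg (visit_moment \<mu> 3 \<phi>s) x
    + ((2 * bm 2 \<mu> + 1) * (visit_moment \<mu> 1 (\<phi> # \<phi>s) x * visit_moment \<mu> 2 (\<phi> # \<phi>s) x)
       + bm 3 \<mu> * visit_moment \<mu> 1 (\<phi> # \<phi>s) x ^ 3)"
proof -
  define A where "A = avg (visit_moment \<mu> 1 \<phi>s) x"
  define B where "B = avg (visit_moment \<mu> 2 \<phi>s) x"
  define p where "p = (of_nat (\<phi> x) :: ennreal)"
  define n2 where "n2 = B + bm 2 \<mu> * A\<^sup>2"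
  have v1: "visit_moment \<mu> 1 (\<phi> # \<phi>s) x = A + p"
    by (simp add: visit_moment_1_Cons[of \<phi> x \<phi>s, OF assms, simplified] A_def p_def)
  have v2: "visit_moment \<mu> 2 (\<phi> # \<phi>s) x = n2 + p * A"
    using visit_moment_Cons[of \<phi> x \<mu> 1 \<phi>s, OF assms]
    unfolding Suc_1 next_moment_1 next_moment_2 bm_offspring_1 A_def B_def n2_def p_def by simp
  have "visit_moment \<mu> 3 (\<phi> # \<phi>s) x = avg (visit_moment \<mu> 3 \<phi>s) x + (2 * bm 2 \<mu> * (A * B) + p * n2 + bm 3 \<mu> * A ^ 3)"
  proof -
    have "Suc 2 = 3" by simp
    then show ?thesis
      using visit_moment_Cons[of \<phi> x \<mu> 2 \<phi>s, OF assms]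
      unfolding \<open>Suc 2 = 3\<close> next_moment_2 next_moment_3 bm_offspring_1 A_def B_def n2_def p_def by (simp add: ac_simps)
  qed
  also have "\<dots> \<le> avg (visit_moment \<mu> 3 \<phi>s) x
    + (2 * bm 2 \<mu> * ((A + p) * (n2 + p * A)) + (A + p) * (n2 + p * A) + bm 3 \<mu> * (A + p) ^ 3)"
  proof (intro add_mono mult_left_mono mult_mono power_mono order_refl)
    show "B \<le> n2 + p * A"
      by (simp add: n2_def add.assoc add_increasing2)
  qed (auto simp: add_increasing add_increasing2)
  finally show ?thesis
    unfolding v1 v2 by (simp add: distrib_right)
qed

lemma visit_moment_2_le:
  assumes "zero_one \<phi>s"
  shows "visit_moment \<mu> 2 \<phi>s x \<le> (\<Sum>j<length \<phi>s. (avg ^^ j) (\<lambda>y. pair_rate * (visit_moment \<mu> 1 (drop j \<phi>s) y)\<^sup>2) x)"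
  by (rule iterate_avg_le[of "visit_moment \<mu> 2" "\<lambda>\<phi>s y. pair_rate * (visit_moment \<mu> 1 \<phi>s y)\<^sup>2", OF _ _ assms])
    (rule visit_moment_2_Cons_le, simp_all add: zero_one_def visit_moment_Nil)

lemma visit_moment_3_le:
  assumes "zero_one \<phi>s"
  shows "visit_moment \<mu> 3 \<phi>s x \<le> (\<Sum>j<length \<phi>s. (avg ^^ j) (\<lambda>y.
      (2 * bm 2 \<mu> + 1) * (visit_moment \<mu> 1 (drop j \<phi>s) y * visit_moment \<mu> 2 (drop j \<phi>s) y)
      + bm 3 \<mu> * visit_moment \<mu> 1 (drop j \<phi>s) y ^ 3) x)"
  by (rule iterate_avg_le[of "visit_moment \<mu> 3" "\<lambda>\<phi>s y. (2 * bm 2 \<mu> + 1) * (visit_moment \<mu> 1 \<phi>s y * visit_moment \<mu> 2 \<phi>s y)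
      + bm 3 \<mu> * visit_moment \<mu> 1 \<phi>s y ^ 3", OF _ _ assms])
    (rule visit_moment_3_Cons_le, simp_all add: zero_one_def visit_moment_Nil)

text \<open>Serves every horizon up to \<open>N\<close> at once, as the recursion for the third
  moment runs through all shorter horizons.\<close>

definition pair_bound :: "nat \<Rightarrow> int ^ 'd::finite \<Rightarrow> ennreal" where
  "pair_bound N x = pair_rate * (\<Sum>j<N. (avg ^^ j) (\<lambda>y. ennreal ((green N y)\<^sup>2)) x)"

lemma visit_moment_2_visits:
  assumes "M \<le> N"
  shows "visit_moment \<mu> 2 (replicate M at_origin) (x :: int ^ 'd::finite) \<le> pair_bound N x"
proof -
  have "visit_moment \<mu> 2 (replicate M at_origin) x \<le>
      (\<Sum>j<M. (avg ^^ j) (\<lambda>y. pair_rate * (visit_moment \<mu> 1 (drop j (replicate M at_origin)) y)\<^sup>2) x)"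
    using visit_moment_2_le[of "replicate M at_origin" x] by simp
  also have "\<dots> \<le> (\<Sum>j<N. (avg ^^ j) (\<lambda>y. pair_rate * ennreal ((green N y)\<^sup>2)) x)"
  proof (intro order_trans[OF sum_mono sum_mono2])
    fix j
    show "(avg ^^ j) (\<lambda>y. pair_rate * (visit_moment \<mu> 1 (drop j (replicate M at_origin)) y)\<^sup>2) x \<le>
        (avg ^^ j) (\<lambda>y. pair_rate * ennreal ((green N y)\<^sup>2)) x"
    proof (intro avg_power_mono mult_left_mono)
      fix y
      have "visit_moment \<mu> 1 (drop j (replicate M at_origin)) y = ennreal (green (M - j) y)"
        by (simp add: visit_moment_1_visits[simplified])
      also have "\<dots>\<^sup>2 = ennreal ((green (M - j) y)\<^sup>2)"
        by (simp add: ennreal_power)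
      also have "\<dots> \<le> ennreal ((green N y)\<^sup>2)"
        using assms by (intro ennreal_leI power_mono green_mono) auto
      finally show "(visit_moment \<mu> 1 (drop j (replicate M at_origin)) y)\<^sup>2 \<le> ennreal ((green N y)\<^sup>2)" .
    qed simp
  qed (use assms in auto)
  finally show ?thesis
    by (simp add: pair_bound_def avg_power_cmult sum_distrib_left)
qed

lemma visit_moment_3_visits:
  "visit_moment \<mu> 3 (replicate N at_origin) (x :: int ^ 'd::finite) \<le>
    (2 * bm 2 \<mu> + 1) * (\<Sum>j<N. (avg ^^ j) (\<lambda>y. ennreal (green N y) * pair_bound N y) x)
    + bm 3 \<mu> * (\<Sum>j<N. (avg ^^ j) (\<lambda>y. ennreal (green N y ^ 3)) x)"
proof -
  let ?v = "\<lambda>k j. visit_moment \<mu> k (drop j (replicate N (at_origin :: int ^ 'd \<Rightarrow> nat)))"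
  have "visit_moment \<mu> 3 (replicate N at_origin) x \<le>
      (\<Sum>j<N. (avg ^^ j) (\<lambda>y. (2 * bm 2 \<mu> + 1) * (?v 1 j y * ?v 2 j y) + bm 3 \<mu> * ?v 1 j y ^ 3) x)"
    using visit_moment_3_le[of "replicate N at_origin" x] by simp
  also have "\<dots> \<le> (\<Sum>j<N. (avg ^^ j) (\<lambda>y. (2 * bm 2 \<mu> + 1) * (ennreal (green N y) * pair_bound N y)
      + bm 3 \<mu> * ennreal (green N y ^ 3)) x)"
  proof (intro sum_mono avg_power_mono add_mono mult_left_mono mult_mono)
    fix j y
    have v1: "?v 1 j y = ennreal (green (N - j) y)"
      by (simp add: visit_moment_1_visits[simplified])
    show "?v 1 j y \<le> ennreal (green N y)"
      unfolding v1 by (intro ennreal_leI green_mono) auto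
    show "?v 2 j y \<le> pair_bound N y"
      by (simp add: visit_moment_2_visits)
    show "?v 1 j y ^ 3 \<le> ennreal (green N y ^ 3)"
      unfolding v1 by (auto simp: ennreal_power intro!: ennreal_leI power_mono green_mono)
  qed auto
  finally show ?thesis
    by (simp add: avg_power_cmult avg_power_add sum.distrib sum_distrib_left)
qed

text \<open>Markov's inequality with \<open>(j choose k) \<ge> (j / k)^k\<close>, which is why
  \<open>k \<le> n\<close> is assumed.\<close>

lemma measure_tail_le_bm:
  assumes "bm k p \<le> ennreal b" "0 \<le> b" "0 < k" "k \<le> n"
  shows "measure p {n..} \<le> b * (real k / real n) ^ k"
proof -
  have "ennreal ((real n / real k) ^ k) * emeasure p {n..} = (\<integral>\<^sup>+j. ennreal ((real n / real k) ^ k) * indicator {n..} j \<partial>p)"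
    by (simp add: nn_integral_cmult)
  also have "\<dots> \<le> bm k p"
    unfolding bm_def
  proof (rule nn_integral_mono)
    fix j
    show "ennreal ((real n / real k) ^ k) * indicator {n..} j \<le> of_nat (j choose k)"
    proof (cases "n \<le> j")
      case True
      have "(real n / real k) ^ k \<le> (real j / real k) ^ k"
        using True by (intro power_mono divide_right_mono) auto
      also have "\<dots> \<le> real (j choose k)"
        using True assms by (intro binomial_ge_n_over_k_pow_k) auto
      finally show ?thesis
        using True by (simp add: ennreal_of_nat_eq_real_of_nat)
    qed simp
  qed
  also have "\<dots> \<le> ennreal b"
    by fact
  finally have "(real n / real k) ^ k * measure p {n..} \<le> b"
    using assms by (simp add: measure_pmf.emeasure_eq_measure ennreal_mult[symmetric])
  then have "(real k / real n) ^ k * ((real n / real k) ^ k * measure p {n..}) \<le> (real k / real n) ^ k * b"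
    by (intro mult_left_mono) auto
  moreover have "(real k / real n) ^ k * ((real n / real k) ^ k * measure p {n..}) = measure p {n..}"
  proof -
    have "(real k / real n) ^ k * (real n / real k) ^ k = 1"
      using assms by (simp add: power_mult_distrib[symmetric])
    then show ?thesis
      by (simp only: mult.assoc[symmetric] mult_1_left)
  qed
  ultimately show ?thesis
    by (simp only: mult.commute)
qed

text \<open>Markov's inequality for the \<open>k\<close>-th moment of the visits before time \<open>N\<close>, with
  \<open>n\<close> of the order \<open>N powr (1/s)\<close>; extinction by time \<open>N\<close> fails with probability \<open>O(1/N)\<close>.\<close>

lemma visit_tail_le_of_moment:
  assumes "0 < s" "0 < k" "0 \<le> b" "s \<le> real k"
    and moment: "\<And>N. 1 \<le> N \<Longrightarrow> visit_moment \<mu> k (replicate N at_origin) (0 :: int ^ 'd::finite) \<le>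
      ennreal (b * real N powr (real k / s - 1))"
  obtains C where "0 < C" "\<And>n. 1 \<le> n \<Longrightarrow> visit_tail TYPE('d) \<mu> n \<le> C * real n powr (- s)"
proof -
  \<comment> \<open>The summands account in turn for the moment bound at a horizon \<open>N\<close>
    between \<open>x\<close> and \<open>2 * x\<close>, for survival beyond \<open>N\<close>, and for
    the values \<open>n < k\<close>.\<close>
  define C where "C = b * 2 powr (real k / s - 1) * real k ^ k + 1 / survival_rate + real k powr s"
  have parts: "0 \<le> b * 2 powr (real k / s - 1) * real k ^ k" "0 < 1 / survival_rate" "0 < real k powr s"
    using assms survival_rate_pos by auto
  have C: "0 < C"
    using parts unfolding C_def by linarith
  have "visit_tail TYPE('d) \<mu> n \<le> C * real n powr (- s)" if n: "1 \<le> n" for n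
  proof (cases "k \<le> n")
    case False
    have "visit_tail TYPE('d) \<mu> n \<le> 1"
      by (rule visit_tail_leI) auto
    also have "\<dots> \<le> real k powr s * real n powr (- s)"
    proof -
      have "real n powr s \<le> real k powr s"
        using False assms by (intro powr_mono2) auto
      then show ?thesis
        using n by (simp add: powr_minus field_simps)
    qed
    also have "\<dots> \<le> C * real n powr (- s)"
      using parts by (intro mult_right_mono) (auto simp: C_def)
    finally show ?thesis .
  next
    case True
    define x where "x = real n powr s"
    have x: "1 \<le> x"
      using n assms by (simp add: x_def ge_one_powr_ge_zero)
    define N where "N = nat \<lceil>x\<rceil>"
    have N: "1 \<le> N" "x \<le> real N" "real N \<le> 2 * x"
    proof -
      have r: "real N = of_int \<lceil>x\<rceil>"
        using x by (simp add: N_def)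
      show "x \<le> real N" "real N \<le> 2 * x"
        using x unfolding r by linarith+
      then show "1 \<le> N"
        using x by linarith
    qed
    have "visit_moment \<mu> k (replicate N at_origin) (0 :: int ^ 'd) \<le> ennreal (b * (2 * x) powr (real k / s - 1))"
      using N assms by (intro order_trans[OF moment ennreal_leI] mult_left_mono powr_mono2) auto
    then have "measure (occ \<mu> (replicate N at_origin) {#0 :: int ^ 'd#}) {n..} \<le>
        b * (2 * x) powr (real k / s - 1) * (real k / real n) ^ k"
      unfolding visit_moment_def using assms True by (intro measure_tail_le_bm) auto
    also have "\<dots> = b * 2 powr (real k / s - 1) * real k ^ k * real n powr (- s)"
    proof -
      have "x powr (real k / s - 1) = real n powr (real k - s)"
        using assms by (simp add: x_def powr_powr right_diff_distrib)
      also have "\<dots> = real n ^ k * real n powr (- s)"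
        using n powr_add[of "real n" "real k" "- s"] by (simp add: powr_realpow)
      finally have "(2 * x) powr (real k / s - 1) = 2 powr (real k / s - 1) * (real n ^ k * real n powr (- s))"
        using x by (simp add: powr_mult)
      then show ?thesis
        using n by (simp add: power_divide)
    qed
    finally have "visit_tail TYPE('d) \<mu> n \<le>
        b * 2 powr (real k / s - 1) * real k ^ k * real n powr (- s) + 1 / (survival_rate * (real N + 1))"
      using visit_tail_le_truncated[where 'd = 'd, of n N] by linarith
    also have "1 / (survival_rate * (real N + 1)) \<le> 1 / survival_rate * real n powr (- s)"
    proof -
      have "1 / (survival_rate * (real N + 1)) \<le> 1 / (survival_rate * x)"
        using N x survival_rate_pos by (intro divide_left_mono mult_left_mono) auto
      then show ?thesis
        by (simp add: x_def powr_minus field_simps)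
    qed
    finally have "visit_tail TYPE('d) \<mu> n \<le> (b * 2 powr (real k / s - 1) * real k ^ k + 1 / survival_rate) * real n powr (- s)"
      by (simp add: distrib_right)
    also have "\<dots> \<le> C * real n powr (- s)"
      using parts by (intro mult_right_mono) (auto simp: C_def)
    finally show ?thesis .
  qed
  with C show ?thesis
    by (rule that)
qed

end

section \<open>Upper bound in dimension at most three\<close>

locale heat_kernel_bound =
  fixes C :: real and dim :: "'d::finite itself"
  assumes C_pos: "0 < C"
    and hk_le: "\<And>m x. hk m (x :: int ^ 'd) \<le> C * real (Suc m) powr (- real CARD('d) / 2)"
begin

text \<open>Smoothing from \<open>l^1\<close> to the supremum norm: after \<open>k\<close> steps
  only the total mass of \<open>u\<close> matters.\<close>

lemma avg_power_le_sum:
  "(avg ^^ k) u (x :: int ^ 'd) \<le> ennreal (C * real (Suc k) powr (- real CARD('d) / 2)) * (\<integral>\<^sup>+y. u y \<partial>count_space UNIV)"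
proof -
  have "(avg ^^ k) u x \<le> (\<integral>\<^sup>+y. ennreal (C * real (Suc k) powr (- real CARD('d) / 2)) * u y \<partial>count_space UNIV)"
    unfolding avg_power_eq_sum by (intro nn_integral_mono mult_right_mono ennreal_leI hk_le) auto
  then show ?thesis
    by (simp add: nn_integral_cmult)
qed

text \<open>The square sums to the double sum of \<open>hk (i + j) 0\<close>, and
  \<open>(i + j + 1)^2 \<ge> (i + 1) * (j + 1)\<close> separates the indices into two sums with
  exponent \<open>a = d/4\<close>. Here \<open>d < 4\<close> makes \<open>a < 1\<close>; the
  constant 16 is \<open>1/(1 - a)^2\<close> at worst.\<close>

lemma green_square_sum:
  assumes "CARD('d) < 4"
  shows "(\<integral>\<^sup>+y. ennreal ((green N (y :: int ^ 'd))\<^sup>2) \<partial>count_space UNIV) \<le>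
    ennreal (16 * C * real N powr (2 - real CARD('d) / 2))"
proof -
  define a where "a = real CARD('d) / 4"
  have a: "0 < a" "a \<le> 3 / 4"
    using assms by (auto simp: a_def)
  have "(\<integral>\<^sup>+y. ennreal ((green N (y :: int ^ 'd))\<^sup>2) \<partial>count_space UNIV) =
      (\<integral>\<^sup>+y. (\<Sum>i<N. \<Sum>j<N. ennreal (hk i (y :: int ^ 'd)) * ennreal (hk j (y + 0))) \<partial>count_space UNIV)"
    by (intro nn_integral_cong) (simp add: green_def power2_eq_square sum_product ennreal_mult[symmetric] sum_nonneg)
  also have "\<dots> = (\<Sum>i<N. \<Sum>j<N. ennreal (hk (i + j) (0 :: int ^ 'd)))"
    by (simp add: nn_integral_sum chapman_kolmogorov_shift del: add_0_right)
  also have "\<dots> \<le> (\<Sum>i<N. \<Sum>j<N. ennreal (C * (real (Suc i) powr (- a) * real (Suc j) powr (- a))))"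
  proof (intro sum_mono ennreal_leI)
    fix i j
    have "real (Suc i) * real (Suc j) \<le> real (Suc (i + j)) * real (Suc (i + j))"
      by (intro mult_mono) auto
    then have "(real (Suc (i + j)) * real (Suc (i + j))) powr (- a) \<le> (real (Suc i) * real (Suc j)) powr (- a)"
      using a by (intro powr_mono2') auto
    moreover have "(real (Suc (i + j)) * real (Suc (i + j))) powr (- a) = real (Suc (i + j)) powr (- real CARD('d) / 2)"
      by (simp add: powr_mult powr_add[symmetric] a_def)
    moreover have "(real (Suc i) * real (Suc j)) powr (- a) = real (Suc i) powr (- a) * real (Suc j) powr (- a)"
      by (simp add: powr_mult)
    ultimately have "C * real (Suc (i + j)) powr (- real CARD('d) / 2) \<le> C * (real (Suc i) powr (- a) * real (Suc j) powr (- a))"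
      using C_pos by (intro mult_left_mono) auto
    with hk_le[of "i + j" 0] show "hk (i + j) (0 :: int ^ 'd) \<le> C * (real (Suc i) powr (- a) * real (Suc j) powr (- a))"
      by linarith
  qed
  also have "\<dots> = ennreal (C * (\<Sum>i<N. real (Suc i) powr (- a))\<^sup>2)"
  proof -
    have "C * (\<Sum>i<N. real (Suc i) powr (- a))\<^sup>2 = (\<Sum>i<N. \<Sum>j<N. C * (real (Suc i) powr (- a) * real (Suc j) powr (- a)))"
      unfolding power2_eq_square sum_product by (simp only: sum_distrib_left)
    then show ?thesis
      using C_pos by (simp add: sum_nonneg del: of_nat_Suc)
  qed
  also have "\<dots> \<le> ennreal (16 * C * real N powr (2 - real CARD('d) / 2))"
  proof (rule ennreal_leI)
    have "(\<Sum>i<N. real (Suc i) powr (- a)) \<le> real N powr (1 - a) / (1 - a)"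
      using a by (intro sum_powr_le) auto
    also have "\<dots> \<le> real N powr (1 - a) / (1 / 4)"
      using a by (intro divide_left_mono) auto
    finally have "(\<Sum>i<N. real (Suc i) powr (- a))\<^sup>2 \<le> (4 * real N powr (1 - a))\<^sup>2"
      by (intro power_mono sum_nonneg) auto
    also have "\<dots> = 16 * real N powr (2 - real CARD('d) / 2)"
      by (simp add: power_mult_distrib power2_eq_square powr_add[symmetric] a_def)
    finally show "C * (\<Sum>i<N. real (Suc i) powr (- a))\<^sup>2 \<le> 16 * C * real N powr (2 - real CARD('d) / 2)"
      using C_pos by simp
  qed
  finally show ?thesis .
qed

lemma green_split:
  assumes "(\<Sum>m\<in>{k..<N}. real (Suc m) powr (- real CARD('d) / 2)) \<le> B"
  shows "green N (x :: int ^ 'd) \<le> green k x + C * B"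
proof -
  have "green N x \<le> (\<Sum>m\<in>{..<k} \<union> {k..<N}. hk m x)"
    unfolding green_def by (intro sum_mono2) auto
  also have "\<dots> = green k x + (\<Sum>m\<in>{k..<N}. hk m x)"
    unfolding green_def by (rule sum.union_disjoint) auto
  also have "(\<Sum>m\<in>{k..<N}. hk m x) \<le> C * (\<Sum>m\<in>{k..<N}. real (Suc m) powr (- real CARD('d) / 2))"
    unfolding sum_distrib_left by (intro sum_mono hk_le)
  also have "\<dots> \<le> C * B"
    using assms C_pos by (intro mult_left_mono) auto
  finally show ?thesis by simp
qed

text \<open>Cut the Green function at the number \<open>k\<close> of averaging steps. The early part
  has a controlled \<open>l^2\<close> norm, which \<open>k\<close> steps of the walk spread out; the
  late part is at most \<open>C * B\<close> everywhere.\<close>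

lemma avg_power_green_square:
  assumes "CARD('d) < 4" "0 \<le> B"
    and B: "(\<Sum>m\<in>{k..<N}. real (Suc m) powr (- real CARD('d) / 2)) \<le> B"
  shows "(avg ^^ k) (\<lambda>y. ennreal ((green N y)\<^sup>2)) (x :: int ^ 'd) \<le>
    ennreal (32 * C\<^sup>2 * real (Suc k) powr (2 - real CARD('d)) + 2 * C\<^sup>2 * B\<^sup>2)"
proof -
  let ?d = "real CARD('d)"
  have "(avg ^^ k) (\<lambda>y. ennreal ((green N y)\<^sup>2)) x \<le>
      (avg ^^ k) (\<lambda>y. 2 * ennreal ((green k y)\<^sup>2) + ennreal (2 * C\<^sup>2 * B\<^sup>2)) x"
  proof (rule avg_power_mono)
    fix y :: "int ^ 'd"
    have "(green N y)\<^sup>2 \<le> (green k y + C * B)\<^sup>2"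
      using green_split[OF B, of y] by (intro power_mono) auto
    also have "\<dots> \<le> 2 * (green k y)\<^sup>2 + 2 * C\<^sup>2 * B\<^sup>2"
      using sum_squares_bound[of "green k y" "C * B"] by (simp add: power2_eq_square algebra_simps)
    finally have "ennreal ((green N y)\<^sup>2) \<le> ennreal (2 * (green k y)\<^sup>2 + 2 * C\<^sup>2 * B\<^sup>2)"
      by (rule ennreal_leI)
    then show "ennreal ((green N y)\<^sup>2) \<le> 2 * ennreal ((green k y)\<^sup>2) + ennreal (2 * C\<^sup>2 * B\<^sup>2)"
      by (simp add: ennreal_mult)
  qed
  also have "\<dots> = 2 * (avg ^^ k) (\<lambda>y. ennreal ((green k y)\<^sup>2)) x + ennreal (2 * C\<^sup>2 * B\<^sup>2)"
    by (simp add: avg_power_add avg_power_cmult avg_power_const)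
  also have "\<dots> \<le> 2 * (ennreal (C * real (Suc k) powr (- ?d / 2)) * ennreal (16 * C * real k powr (2 - ?d / 2)))
      + ennreal (2 * C\<^sup>2 * B\<^sup>2)"
    by (intro add_mono mult_left_mono order_trans[OF avg_power_le_sum] green_square_sum assms order_refl) auto
  also have "\<dots> = ennreal (2 * (C * real (Suc k) powr (- ?d / 2) * (16 * C * real k powr (2 - ?d / 2))) + 2 * C\<^sup>2 * B\<^sup>2)"
  proof -
    have *: "2 * (ennreal a * ennreal b) + ennreal c = ennreal (2 * (a * b) + c)" if "0 \<le> a" "0 \<le> b" "0 \<le> c" for a b c
      using that by (simp add: ennreal_mult)
    then show ?thesis
      using C_pos by (intro *) auto
  qed
  also have "\<dots> \<le> ennreal (32 * C\<^sup>2 * real (Suc k) powr (2 - ?d) + 2 * C\<^sup>2 * B\<^sup>2)"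
  proof (intro ennreal_leI add_mono order_refl)
    have "real (Suc k) powr (- ?d / 2) * real k powr (2 - ?d / 2) \<le> real (Suc k) powr (- ?d / 2) * real (Suc k) powr (2 - ?d / 2)"
      using assms by (intro mult_left_mono powr_mono2) auto
    also have "\<dots> = real (Suc k) powr (2 - ?d)"
      by (simp add: powr_add[symmetric])
    finally have "32 * C\<^sup>2 * (real (Suc k) powr (- ?d / 2) * real k powr (2 - ?d / 2)) \<le> 32 * C\<^sup>2 * real (Suc k) powr (2 - ?d)"
      by (intro mult_left_mono) auto
    then show "2 * (C * real (Suc k) powr (- ?d / 2) * (16 * C * real k powr (2 - ?d / 2))) \<le> 32 * C\<^sup>2 * real (Suc k) powr (2 - ?d)"
      by (simp add: power2_eq_square mult_ac)
  qed
  finally show ?thesis .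
qed

lemma green_0_le_dim1:
  assumes "CARD('d) = 1"
  shows "green N (0 :: int ^ 'd) \<le> 2 * C * real N powr (1 / 2)"
proof -
  have "green N (0 :: int ^ 'd) \<le> (\<Sum>m<N. C * real (Suc m) powr (- (1 / 2)))"
    unfolding green_def using hk_le assms by (intro sum_mono) simp
  also have "\<dots> = C * (\<Sum>m<N. real (Suc m) powr (- (1 / 2)))"
    by (simp add: sum_distrib_left)
  also have "\<dots> \<le> C * (real N powr (1 - 1 / 2) / (1 - 1 / 2))"
    using C_pos by (intro mult_left_mono sum_powr_le) auto
  finally show ?thesis
    by simp
qed

text \<open>The tail sum of \<open>1/m\<close> is logarithmic. It is replaced by a multiple of
  \<open>(N / (j + 1)) powr (1/4)\<close>, whose square, summed over \<open>j < N\<close>, still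
  gives order \<open>N\<close>, as the second moment requires.\<close>

lemma avg_power_green_square_dim2:
  assumes "CARD('d) = 2" "j < N"
  shows "(avg ^^ j) (\<lambda>y. ennreal ((green N y)\<^sup>2)) (x :: int ^ 'd) \<le>
    ennreal (64 * C\<^sup>2 * (real N powr (1 / 2) * real (Suc j) powr (- (1 / 2))))"
proof -
  define r where "r = real N powr (1 / 2) * real (Suc j) powr (- (1 / 2))"
  have r: "1 \<le> r"
  proof -
    have "real (Suc j) powr (1 / 2) \<le> real N powr (1 / 2)"
      using assms by (intro powr_mono2) auto
    then show ?thesis
      by (simp add: r_def powr_minus field_simps)
  qed
  define B where "B = 4 * (real N powr (1 / 4) * real (Suc j) powr (- (1 / 4)))"
  have "(\<Sum>m\<in>{j..<N}. real (Suc m) powr (- 1)) \<le>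
      (\<Sum>m\<in>{j..<N}. real (Suc j) powr (- (1 / 4)) * real (Suc m) powr (- (3 / 4)))"
  proof (rule sum_mono)
    fix m assume "m \<in> {j..<N}"
    then have "real (Suc m) powr (- (1 / 4)) \<le> real (Suc j) powr (- (1 / 4))"
      by (intro powr_mono2') auto
    then have "real (Suc m) powr (- (1 / 4)) * real (Suc m) powr (- (3 / 4)) \<le>
        real (Suc j) powr (- (1 / 4)) * real (Suc m) powr (- (3 / 4))"
      by (intro mult_right_mono) auto
    then show "real (Suc m) powr (- 1) \<le> real (Suc j) powr (- (1 / 4)) * real (Suc m) powr (- (3 / 4))"
      by (simp add: powr_add[symmetric])
  qed
  also have "\<dots> \<le> real (Suc j) powr (- (1 / 4)) * (\<Sum>m<N. real (Suc m) powr (- (3 / 4)))"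
    unfolding sum_distrib_left by (rule sum_mono2) auto
  also have "\<dots> \<le> real (Suc j) powr (- (1 / 4)) * (real N powr (1 - 3 / 4) / (1 - 3 / 4))"
    by (intro mult_left_mono sum_powr_le) auto
  finally have "(\<Sum>m\<in>{j..<N}. real (Suc m) powr (- real CARD('d) / 2)) \<le> B"
    using assms by (simp add: B_def mult_ac)
  then have "(avg ^^ j) (\<lambda>y. ennreal ((green N y)\<^sup>2)) x \<le>
      ennreal (32 * C\<^sup>2 * real (Suc j) powr (2 - real CARD('d)) + 2 * C\<^sup>2 * B\<^sup>2)"
    using assms by (intro avg_power_green_square) (auto simp: B_def)
  also have "\<dots> \<le> ennreal (64 * C\<^sup>2 * r)"
  proof (rule ennreal_leI)
    have "B\<^sup>2 = 16 * r"
    proof -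
      have "(real N powr (1 / 4))\<^sup>2 = real N powr (1 / 2)"
        using assms by (simp add: powr_power)
      moreover have "(real (Suc j) powr (- (1 / 4)))\<^sup>2 = real (Suc j) powr (- (1 / 2))"
        by (simp add: powr_power del: of_nat_Suc)
      ultimately show ?thesis
        by (simp add: B_def r_def power_mult_distrib del: of_nat_Suc)
    qed
    moreover have "32 * C\<^sup>2 * real (Suc j) powr (2 - real CARD('d)) \<le> 32 * C\<^sup>2 * r"
      using r assms by (intro mult_left_mono) auto
    moreover have "2 * C\<^sup>2 * B\<^sup>2 = 32 * C\<^sup>2 * r"
      by (simp add: \<open>B\<^sup>2 = 16 * r\<close>)
    ultimately show "32 * C\<^sup>2 * real (Suc j) powr (2 - real CARD('d)) + 2 * C\<^sup>2 * B\<^sup>2 \<le> 64 * C\<^sup>2 * r"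
      by linarith
  qed
  finally show ?thesis
    unfolding r_def .
qed

lemma tail_sum_dim3:
  assumes "CARD('d) = 3"
  shows "(\<Sum>m\<in>{k..<N}. real (Suc m) powr (- real CARD('d) / 2)) \<le> 4 * real (Suc k) powr (- (1 / 2))"
  using sum_powr_tail_le[of k N] assms by simp

lemma avg_power_green_square_dim3:
  assumes "CARD('d) = 3"
  shows "(avg ^^ k) (\<lambda>y. ennreal ((green N y)\<^sup>2)) (x :: int ^ 'd) \<le> ennreal (64 * C\<^sup>2 * real (Suc k) powr (- 1))"
proof -
  have "(avg ^^ k) (\<lambda>y. ennreal ((green N y)\<^sup>2)) x \<le>
      ennreal (32 * C\<^sup>2 * real (Suc k) powr (2 - real CARD('d)) + 2 * C\<^sup>2 * (4 * real (Suc k) powr (- (1 / 2)))\<^sup>2)"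
    using assms by (intro avg_power_green_square tail_sum_dim3) auto
  also have "32 * C\<^sup>2 * real (Suc k) powr (2 - real CARD('d)) + 2 * C\<^sup>2 * (4 * real (Suc k) powr (- (1 / 2)))\<^sup>2 =
      64 * C\<^sup>2 * real (Suc k) powr (- 1)"
    using assms by (simp add: power_mult_distrib power2_eq_square powr_add[symmetric])
  finally show ?thesis .
qed

text \<open>The terms \<open>1 / (m + j + 1)\<close> again sum to a logarithm. Splitting the
  exponent 1 as 1/4 + 3/4 trades it for a power that does no harm in the third moment.\<close>

lemma avg_power_pairs_dim3:
  assumes "CARD('d) = 3"
  shows "(\<Sum>j<N. (avg ^^ (m + j)) (\<lambda>y. ennreal ((green N y)\<^sup>2)) (x :: int ^ 'd)) \<le>
    ennreal (256 * C\<^sup>2 * (real N powr (1 / 4) * real (Suc m) powr (- (1 / 4))))"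
proof -
  have "(\<Sum>j<N. (avg ^^ (m + j)) (\<lambda>y. ennreal ((green N y)\<^sup>2)) x) \<le>
      (\<Sum>j<N. ennreal (64 * C\<^sup>2 * real (Suc (m + j)) powr (- 1)))"
    by (intro sum_mono avg_power_green_square_dim3 assms)
  also have "\<dots> \<le> (\<Sum>j<N. ennreal (64 * C\<^sup>2 * (real (Suc m) powr (- (1 / 4)) * real (Suc j) powr (- (3 / 4)))))"
  proof (intro sum_mono ennreal_leI mult_left_mono)
    fix j
    have "real (Suc (m + j)) powr (- 1) = real (Suc (m + j)) powr (- (1 / 4)) * real (Suc (m + j)) powr (- (3 / 4))"
      by (simp add: powr_add[symmetric])
    also have "\<dots> \<le> real (Suc m) powr (- (1 / 4)) * real (Suc j) powr (- (3 / 4))"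
      by (intro mult_mono powr_mono2') auto
    finally show "real (Suc (m + j)) powr (- 1) \<le> real (Suc m) powr (- (1 / 4)) * real (Suc j) powr (- (3 / 4))" .
  qed auto
  also have "\<dots> = ennreal (64 * C\<^sup>2 * real (Suc m) powr (- (1 / 4)) * (\<Sum>j<N. real (Suc j) powr (- (3 / 4))))"
    by (simp add: sum_distrib_left mult.assoc)
  also have "\<dots> \<le> ennreal (64 * C\<^sup>2 * real (Suc m) powr (- (1 / 4)) * (real N powr (1 - 3 / 4) / (1 - 3 / 4)))"
    by (intro ennreal_leI mult_left_mono sum_powr_le) auto
  also have "64 * C\<^sup>2 * real (Suc m) powr (- (1 / 4)) * (real N powr (1 - 3 / 4) / (1 - 3 / 4)) =
      256 * C\<^sup>2 * (real N powr (1 / 4) * real (Suc m) powr (- (1 / 4)))"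
    by simp
  finally show ?thesis .
qed

end

lemma (in critical_offspring) avg_power_pair_bound:
  "(avg ^^ m) (pair_bound N) x = pair_rate * (\<Sum>j<N. (avg ^^ (m + j)) (\<lambda>y. ennreal ((green N y)\<^sup>2)) (x :: int ^ 'd::finite))"
proof -
  have "pair_bound N = (\<lambda>y :: int ^ 'd. pair_rate * (\<Sum>j<N. (avg ^^ j) (\<lambda>y. ennreal ((green N y)\<^sup>2)) y))"
    by (auto simp: pair_bound_def)
  then show ?thesis
    by (simp add: avg_power_cmult avg_power_sum avg_power_comp)
qed

locale critical_brw = critical_offspring \<mu> + heat_kernel_bound C dim
  for \<mu> :: "nat pmf" and C :: real and dim :: "'d::finite itself"
begin

lemma visit_moment_1_dim1:
  assumes "CARD('d) = 1"
  shows "visit_moment \<mu> 1 (replicate N at_origin) (0 :: int ^ 'd) \<le> ennreal (2 * C * real N powr (1 / 2))"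
  unfolding visit_moment_1_visits by (intro ennreal_leI green_0_le_dim1 assms)

lemma visit_moment_2_dim2:
  assumes "CARD('d) = 2"
  shows "visit_moment \<mu> 2 (replicate N at_origin) (0 :: int ^ 'd) \<le> pair_rate * ennreal (128 * C\<^sup>2 * real N)"
proof -
  have "visit_moment \<mu> 2 (replicate N at_origin) (0 :: int ^ 'd) \<le> pair_bound N (0 :: int ^ 'd)"
    by (rule visit_moment_2_visits) simp
  also have "\<dots> \<le> pair_rate * (\<Sum>j<N. ennreal (64 * C\<^sup>2 * (real N powr (1 / 2) * real (Suc j) powr (- (1 / 2)))))"
    unfolding pair_bound_def using assms by (intro mult_left_mono sum_mono avg_power_green_square_dim2) auto
  also have "(\<Sum>j<N. ennreal (64 * C\<^sup>2 * (real N powr (1 / 2) * real (Suc j) powr (- (1 / 2))))) =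
      ennreal (64 * C\<^sup>2 * real N powr (1 / 2) * (\<Sum>j<N. real (Suc j) powr (- (1 / 2))))"
    by (simp add: sum_distrib_left mult.assoc)
  also have "\<dots> \<le> ennreal (64 * C\<^sup>2 * real N powr (1 / 2) * (real N powr (1 - 1 / 2) / (1 - 1 / 2)))"
    by (intro ennreal_leI mult_left_mono sum_powr_le) auto
  also have "64 * C\<^sup>2 * real N powr (1 / 2) * (real N powr (1 - 1 / 2) / (1 - 1 / 2)) = 128 * C\<^sup>2 * real N"
    by (simp add: powr_half_sqrt)
  finally show ?thesis
    by (simp add: mult_left_mono)
qed

lemma avg_power_pair_bound_dim3:
  assumes "CARD('d) = 3"
  shows "(avg ^^ m) (pair_bound N) (x :: int ^ 'd) \<le>
    pair_rate * ennreal (256 * C\<^sup>2 * (real N powr (1 / 4) * real (Suc m) powr (- (1 / 4))))"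
  unfolding avg_power_pair_bound by (intro mult_left_mono avg_power_pairs_dim3 assms) auto

text \<open>Cut the Green function at time \<open>j\<close>. For the early part the supremum bound
  on the kernel leaves a spatial sum, which equals the sum over \<open>i < j\<close> of
  \<open>i\<close>-step averages of \<open>pair_bound\<close> at the origin; the late part is the
  constant \<open>B\<close>. Both pieces have order \<open>(j + 1) powr (-3/4)\<close> times
  \<open>N powr (1/4)\<close>.\<close>

lemma avg_power_green_pair_dim3:
  assumes "CARD('d) = 3"
  shows "(avg ^^ j) (\<lambda>y. ennreal (green N y) * pair_bound N y) (0 :: int ^ 'd) \<le>
    pair_rate * ennreal (2048 * C ^ 3 * (real N powr (1 / 4) * real (Suc j) powr (- (3 / 4))))"
proof -
  define B where "B = C * (4 * real (Suc j) powr (- (1 / 2)))"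
  define b where "b = (\<lambda>m. 256 * C\<^sup>2 * (real N powr (1 / 4) * real (Suc m) powr (- (1 / 4))))"
  define h where "h = C * real (Suc j) powr (- (3 / 2))"
  have nonneg: "0 \<le> B" "0 \<le> b m" "0 \<le> h" for m
    using C_pos by (auto simp: B_def b_def h_def)
  have "(avg ^^ j) (\<lambda>y. ennreal (green N y) * pair_bound N y) (0 :: int ^ 'd) \<le>
      (avg ^^ j) (\<lambda>y. ennreal (green j y) * pair_bound N y + ennreal B * pair_bound N y) (0 :: int ^ 'd)"
  proof (rule avg_power_mono)
    fix y :: "int ^ 'd"
    have "ennreal (green N y) \<le> ennreal (green j y + B)"
      unfolding B_def by (intro ennreal_leI green_split tail_sum_dim3 assms)
    also have "\<dots> = ennreal (green j y) + ennreal B"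
      using nonneg by simp
    finally show "ennreal (green N y) * pair_bound N y \<le> ennreal (green j y) * pair_bound N y + ennreal B * pair_bound N y"
      unfolding distrib_right[symmetric] by (rule mult_right_mono) simp
  qed
  also have "\<dots> = (avg ^^ j) (\<lambda>y. ennreal (green j y) * pair_bound N y) (0 :: int ^ 'd) + ennreal B * (avg ^^ j) (pair_bound N) (0 :: int ^ 'd)"
    by (simp add: avg_power_add avg_power_cmult)
  also have "(avg ^^ j) (\<lambda>y. ennreal (green j y) * pair_bound N y) (0 :: int ^ 'd) \<le>
      ennreal h * (\<integral>\<^sup>+y. ennreal (green j y) * pair_bound N (y :: int ^ 'd) \<partial>count_space UNIV)"
    using avg_power_le_sum[of j "\<lambda>y. ennreal (green j y) * pair_bound N y" 0] assms by (simp add: h_def)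
  also have "(\<integral>\<^sup>+y. ennreal (green j y) * pair_bound N (y :: int ^ 'd) \<partial>count_space UNIV) = (\<Sum>i<j. (avg ^^ i) (pair_bound N) (0 :: int ^ 'd))"
  proof -
    have "(\<integral>\<^sup>+y. ennreal (green j y) * pair_bound N (y :: int ^ 'd) \<partial>count_space UNIV) =
        (\<integral>\<^sup>+y. (\<Sum>i<j. ennreal (hk i (0 - y)) * pair_bound N y) \<partial>count_space (UNIV :: (int ^ 'd) set))"
      by (intro nn_integral_cong) (simp add: green_def sum_ennreal[symmetric] sum_distrib_right hk_uminus del: sum_ennreal)
    then show ?thesis
      unfolding avg_power_eq_sum by (simp add: nn_integral_sum)
  qed
  also have "\<dots> \<le> (\<Sum>i<j. pair_rate * ennreal (b i))"
    unfolding b_def by (intro sum_mono avg_power_pair_bound_dim3 assms)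
  also have "\<dots> = pair_rate * ennreal (\<Sum>i<j. b i)"
    using nonneg by (simp add: sum_distrib_left[symmetric])
  also have "(avg ^^ j) (pair_bound N) (0 :: int ^ 'd) \<le> pair_rate * ennreal (b j)"
    unfolding b_def by (intro avg_power_pair_bound_dim3 assms)
  finally have "(avg ^^ j) (\<lambda>y. ennreal (green N y) * pair_bound N y) (0 :: int ^ 'd) \<le>
      ennreal h * (pair_rate * ennreal (\<Sum>i<j. b i)) + ennreal B * (pair_rate * ennreal (b j))"
    by (simp add: add_mono mult_left_mono)
  also have "\<dots> = pair_rate * (ennreal h * ennreal (\<Sum>i<j. b i) + ennreal B * ennreal (b j))"
    by (simp add: algebra_simps)
  also have "\<dots> = pair_rate * ennreal (h * (\<Sum>i<j. b i) + B * b j)"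
    using nonneg by (simp add: ennreal_mult[symmetric] sum_nonneg)
  also have "\<dots> \<le> pair_rate * ennreal (2048 * C ^ 3 * (real N powr (1 / 4) * real (Suc j) powr (- (3 / 4))))"
  proof (intro mult_left_mono ennreal_leI)
    have "(\<Sum>i<j. b i) = 256 * C\<^sup>2 * real N powr (1 / 4) * (\<Sum>i<j. real (Suc i) powr (- (1 / 4)))"
      by (simp add: b_def sum_distrib_left mult.assoc)
    also have "\<dots> \<le> 256 * C\<^sup>2 * real N powr (1 / 4) * (real j powr (1 - 1 / 4) / (1 - 1 / 4))"
      by (intro mult_left_mono sum_powr_le) auto
    also have "\<dots> \<le> 256 * C\<^sup>2 * real N powr (1 / 4) * (4 * real (Suc j) powr (3 / 4))"
    proof (rule mult_left_mono)
      have "real j powr (3 / 4) \<le> real (Suc j) powr (3 / 4)"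
        by (intro powr_mono2) auto
      moreover have "0 \<le> real (Suc j) powr (3 / 4)"
        by simp
      ultimately have "4 / 3 * real j powr (3 / 4) \<le> 4 * real (Suc j) powr (3 / 4)"
        by linarith
      then show "real j powr (1 - 1 / 4) / (1 - 1 / 4) \<le> 4 * real (Suc j) powr (3 / 4)"
        by simp
    qed auto
    finally have "h * (\<Sum>i<j. b i) \<le> h * (256 * C\<^sup>2 * real N powr (1 / 4) * (4 * real (Suc j) powr (3 / 4)))"
      using nonneg by (intro mult_left_mono)
    also have "\<dots> = 1024 * C ^ 3 * (real N powr (1 / 4) * (real (Suc j) powr (- (3 / 2)) * real (Suc j) powr (3 / 4)))"
      by (simp add: h_def power2_eq_square power3_eq_cube mult_ac)
    also have "real (Suc j) powr (- (3 / 2)) * real (Suc j) powr (3 / 4) = real (Suc j) powr (- (3 / 4))"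
      by (simp add: powr_add[symmetric])
    finally have 1: "h * (\<Sum>i<j. b i) \<le> 1024 * C ^ 3 * (real N powr (1 / 4) * real (Suc j) powr (- (3 / 4)))" .
    have "B * b j = 1024 * C ^ 3 * (real N powr (1 / 4) * (real (Suc j) powr (- (1 / 2)) * real (Suc j) powr (- (1 / 4))))"
      by (simp add: B_def b_def power2_eq_square power3_eq_cube mult_ac)
    also have "real (Suc j) powr (- (1 / 2)) * real (Suc j) powr (- (1 / 4)) = real (Suc j) powr (- (3 / 4))"
      by (simp add: powr_add[symmetric])
    finally show "h * (\<Sum>i<j. b i) + B * b j \<le> 2048 * C ^ 3 * (real N powr (1 / 4) * real (Suc j) powr (- (3 / 4)))"
      using 1 by simp
  qed simp
  finally show ?thesis .
qed

lemma visit_moment_3_dim3: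
  assumes "CARD('d) = 3"
  shows "visit_moment \<mu> 3 (replicate N at_origin) (0 :: int ^ 'd) \<le>
    ((2 * bm 2 \<mu> + 1) * pair_rate + bm 3 \<mu>) * ennreal (8192 * C ^ 3 * real N powr (1 / 2))"
proof -
  have green_le: "green N y \<le> 4 * C" for y :: "int ^ 'd"
    using green_split[OF tail_sum_dim3[OF assms, of 0 N], of y] by (simp add: green_def)
  have "(\<Sum>j<N. (avg ^^ j) (\<lambda>y. ennreal (green N y) * pair_bound N y) (0 :: int ^ 'd)) \<le>
      (\<Sum>j<N. pair_rate * ennreal (2048 * C ^ 3 * (real N powr (1 / 4) * real (Suc j) powr (- (3 / 4)))))"
    by (intro sum_mono avg_power_green_pair_dim3 assms)
  also have "\<dots> = pair_rate * ennreal (2048 * C ^ 3 * real N powr (1 / 4) * (\<Sum>j<N. real (Suc j) powr (- (3 / 4))))"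
    using C_pos by (simp add: sum_distrib_left[symmetric] mult.assoc)
  also have "\<dots> \<le> pair_rate * ennreal (2048 * C ^ 3 * real N powr (1 / 4) * (real N powr (1 - 3 / 4) / (1 - 3 / 4)))"
    using C_pos by (intro mult_left_mono ennreal_leI sum_powr_le) auto
  also have "2048 * C ^ 3 * real N powr (1 / 4) * (real N powr (1 - 3 / 4) / (1 - 3 / 4)) = 8192 * C ^ 3 * real N powr (1 / 2)"
    by (simp add: powr_add[symmetric])
  finally have 1: "(\<Sum>j<N. (avg ^^ j) (\<lambda>y. ennreal (green N y) * pair_bound N y) (0 :: int ^ 'd)) \<le>
      pair_rate * ennreal (8192 * C ^ 3 * real N powr (1 / 2))" .
  have "(\<Sum>j<N. (avg ^^ j) (\<lambda>y. ennreal (green N y ^ 3)) (0 :: int ^ 'd)) \<le>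
      (\<Sum>j<N. ennreal (4 * C * (64 * C\<^sup>2 * real (Suc j) powr (- 1))))"
  proof (rule sum_mono)
    fix j
    have "(avg ^^ j) (\<lambda>y. ennreal (green N y ^ 3)) (0 :: int ^ 'd) \<le> (avg ^^ j) (\<lambda>y. ennreal (4 * C) * ennreal ((green N y)\<^sup>2)) (0 :: int ^ 'd)"
    proof (rule avg_power_mono)
      fix y :: "int ^ 'd"
      have "green N y ^ 3 \<le> 4 * C * (green N y)\<^sup>2"
        using mult_right_mono[OF green_le[of y], of "(green N y)\<^sup>2"] by (simp add: power2_eq_square power3_eq_cube)
      then show "ennreal (green N y ^ 3) \<le> ennreal (4 * C) * ennreal ((green N y)\<^sup>2)"
        using C_pos by (simp add: ennreal_mult[symmetric] ennreal_leI)
    qed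
    also have "\<dots> \<le> ennreal (4 * C) * ennreal (64 * C\<^sup>2 * real (Suc j) powr (- 1))"
      unfolding avg_power_cmult by (intro mult_left_mono avg_power_green_square_dim3 assms) auto
    also have "\<dots> = ennreal (4 * C * (64 * C\<^sup>2 * real (Suc j) powr (- 1)))"
      using C_pos by (intro ennreal_mult[symmetric]) auto
    finally show "(avg ^^ j) (\<lambda>y. ennreal (green N y ^ 3)) (0 :: int ^ 'd) \<le> ennreal (4 * C * (64 * C\<^sup>2 * real (Suc j) powr (- 1)))" .
  qed
  also have "\<dots> \<le> (\<Sum>j<N. ennreal (256 * C ^ 3 * real (Suc j) powr (- (1 / 2))))"
  proof (intro sum_mono ennreal_leI)
    fix j
    have "real (Suc j) powr (- 1) \<le> real (Suc j) powr (- (1 / 2))"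
      by (intro powr_mono) auto
    then have "256 * C ^ 3 * real (Suc j) powr (- 1) \<le> 256 * C ^ 3 * real (Suc j) powr (- (1 / 2))"
      using C_pos by (intro mult_left_mono) auto
    then show "4 * C * (64 * C\<^sup>2 * real (Suc j) powr (- 1)) \<le> 256 * C ^ 3 * real (Suc j) powr (- (1 / 2))"
      by (simp add: power2_eq_square power3_eq_cube mult_ac)
  qed
  also have "\<dots> = ennreal (256 * C ^ 3 * (\<Sum>j<N. real (Suc j) powr (- (1 / 2))))"
    using C_pos by (simp add: sum_distrib_left)
  also have "\<dots> \<le> ennreal (256 * C ^ 3 * (real N powr (1 - 1 / 2) / (1 - 1 / 2)))"
    using C_pos by (intro ennreal_leI mult_left_mono sum_powr_le) auto
  also have "\<dots> \<le> ennreal (8192 * C ^ 3 * real N powr (1 / 2))"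
    using C_pos by (intro ennreal_leI) (simp add: mult_right_mono)
  finally have 2: "(\<Sum>j<N. (avg ^^ j) (\<lambda>y. ennreal (green N y ^ 3)) (0 :: int ^ 'd)) \<le> ennreal (8192 * C ^ 3 * real N powr (1 / 2))" .
  have "visit_moment \<mu> 3 (replicate N at_origin) (0 :: int ^ 'd) \<le>
    (2 * bm 2 \<mu> + 1) * (pair_rate * ennreal (8192 * C ^ 3 * real N powr (1 / 2)))
    + bm 3 \<mu> * ennreal (8192 * C ^ 3 * real N powr (1 / 2))"
    by (intro order_trans[OF visit_moment_3_visits] add_mono mult_left_mono 1 2) auto
  then show ?thesis
    by (simp add: distrib_right mult.assoc)
qed

theorem visit_tail_upper_low_dim:
  assumes "CARD('d) < 4"
  obtains K where "0 < K" "\<And>n. 1 \<le> n \<Longrightarrow> visit_tail TYPE('d) \<mu> n \<le> K * real n powr (- 2 / (4 - real CARD('d)))"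
proof -
  have "0 < CARD('d)"
    by simp
  then consider "CARD('d) = 1" | "CARD('d) = 2" | "CARD('d) = 3"
    using assms by linarith
  then show ?thesis
  proof cases
    case 1
    have mom: "visit_moment \<mu> 1 (replicate N at_origin) (0 :: int ^ 'd) \<le> ennreal (2 * C * real N powr (real 1 / (2 / 3) - 1))" for N
      using visit_moment_1_dim1[OF 1, of N] by simp
    obtain K where "0 < K" "\<And>n. 1 \<le> n \<Longrightarrow> visit_tail TYPE('d) \<mu> n \<le> K * real n powr (- (2 / 3))"
      by (rule visit_tail_le_of_moment[of "2 / 3" 1 "2 * C", where 'd = 'd, OF _ _ _ _ mom]) (use C_pos in auto)
    then show ?thesis
      using 1 by (intro that[of K]) auto
  next
    case 2
    obtain r where r: "pair_rate = ennreal r" "0 \<le> r"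
      using pair_rate_finite by (cases pair_rate) auto
    have mom: "visit_moment \<mu> 2 (replicate N at_origin) (0 :: int ^ 'd) \<le> ennreal (r * (128 * C\<^sup>2) * real N powr (real 2 / 1 - 1))"
      if "1 \<le> N" for N
      using visit_moment_2_dim2[OF 2, of N] that r by (simp add: ennreal_mult[symmetric] mult.assoc)
    obtain K where "0 < K" "\<And>n. 1 \<le> n \<Longrightarrow> visit_tail TYPE('d) \<mu> n \<le> K * real n powr (- 1)"
      by (rule visit_tail_le_of_moment[of 1 2 "r * (128 * C\<^sup>2)", where 'd = 'd, OF _ _ _ _ mom]) (use r in auto)
    then show ?thesis
      using 2 by (intro that[of K]) auto
  next
    case 3
    have "(2 * bm 2 \<mu> + 1) * pair_rate + bm 3 \<mu> < \<top>"
      using pair_rate_finite bm_offspring_finite by (simp add: ennreal_mult_less_top)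
    then obtain r where r: "(2 * bm 2 \<mu> + 1) * pair_rate + bm 3 \<mu> = ennreal r" "0 \<le> r"
      by (metis ennreal_cases less_irrefl)
    have mom: "visit_moment \<mu> 3 (replicate N at_origin) (0 :: int ^ 'd) \<le> ennreal (r * (8192 * C ^ 3) * real N powr (real 3 / 2 - 1))"
      for N
      using visit_moment_3_dim3[OF 3, of N] r C_pos by (simp add: ennreal_mult[symmetric] mult.assoc)
    obtain K where "0 < K" "\<And>n. 1 \<le> n \<Longrightarrow> visit_tail TYPE('d) \<mu> n \<le> K * real n powr (- 2)"
      by (rule visit_tail_le_of_moment[of 2 3 "r * (8192 * C ^ 3)", where 'd = 'd, OF _ _ _ _ mom]) (use r C_pos in auto)
    then show ?thesis
      using 3 by (intro that[of K]) auto
  qed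
qed

end

section \<open>Lower bound in dimension at most three\<close>

lemma occ_mono:
  assumes "list_all2 (\<le>) \<phi>s \<psi>s"
  shows "emeasure (occ \<mu> \<phi>s B) {n..} \<le> emeasure (occ \<mu> \<psi>s B) {n..}"
  using assms
proof (induction \<phi>s \<psi>s arbitrary: B n rule: list_all2_induct)
  case (Cons \<phi> \<phi>s \<psi> \<psi>s)
  have *: "(\<lambda>k. m + k) -` {n..} = {n - m..}" for m n :: nat
    by auto
  have le: "(\<Sum>x\<in>#B. \<phi> x) \<le> (\<Sum>x\<in>#B. \<psi> x)"
    using Cons.hyps by (intro sum_mset_mono) (auto simp: le_fun_def)
  have "emeasure (occ \<mu> \<phi>s B') {n - (\<Sum>x\<in>#B. \<phi> x)..} \<le> emeasure (occ \<mu> \<psi>s B') {n - (\<Sum>x\<in>#B. \<psi> x)..}" for B'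
    using le by (intro order_trans[OF Cons.IH] emeasure_mono) auto
  then show ?case
    by (simp add: * nn_integral_mono)
qed simp

lemma second_moment_bound:
  fixes f :: "'a \<Rightarrow> ennreal"
  shows "(\<integral>\<^sup>+x. f x * indicator S x \<partial>measure_pmf p)\<^sup>2 \<le> (\<integral>\<^sup>+x. (f x)\<^sup>2 \<partial>p) * emeasure p S"
  using Cauchy_Schwarz_nn_integral[of f "measure_pmf p" "indicator S"]
  by (simp add: power2_eq_square indicator_inter_arith[symmetric])

lemma avg_power_jensen: "((avg ^^ m) u x)\<^sup>2 \<le> (avg ^^ m) (\<lambda>y. (u y)\<^sup>2) x"
  using second_moment_bound[where f = u and S = UNIV and p = "rw m x"] by (simp add: avg_power)

text \<open>Paley--Zygmund conditioned on \<open>Y \<ge> 1\<close>.\<close>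

lemma paley_zygmund_nat:
  assumes "ennreal m \<le> bm 1 p" "bm 1 p \<le> ennreal M" "bm 2 p \<le> ennreal v" "measure p {1..} \<le> q"
    and "t * q \<le> m / 2" "0 < m" "0 \<le> v" "0 \<le> t"
  shows "(m / 2)\<^sup>2 \<le> (2 * v + M) * measure p {j. t \<le> real j}"
proof -
  let ?S = "{j. t \<le> real j}"
  have "ennreal m \<le> ennreal M"
    using assms by (meson order_trans)
  then have M: "0 < M"
    using assms by (simp add: ennreal_le_iff2)
  \<comment> \<open>Values below \<open>t\<close> contribute at most \<open>t\<close> times the
    probability of a positive value, that is at most \<open>t * q \<le> m / 2\<close>; half of the
    mean is left for the set where \<open>j \<ge> t\<close>.\<close>
  have "ennreal m \<le> (\<integral>\<^sup>+j. of_nat j * indicator ?S j + ennreal t * indicator {1..} j \<partial>p)"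
  proof (rule order_trans[OF assms(1)])
    show "bm 1 p \<le> (\<integral>\<^sup>+j. of_nat j * indicator ?S j + ennreal t * indicator {1..} j \<partial>p)"
      unfolding bm_def
      by (rule nn_integral_mono)
        (auto simp: indicator_def ennreal_of_nat_eq_real_of_nat Suc_le_eq intro: ennreal_leI)
  qed
  also have "\<dots> = (\<integral>\<^sup>+j. of_nat j * indicator ?S j \<partial>p) + ennreal (t * measure p {1..})"
    using assms by (simp add: nn_integral_add nn_integral_cmult measure_pmf.emeasure_eq_measure ennreal_mult)
  also have "\<dots> \<le> (\<integral>\<^sup>+j. of_nat j * indicator ?S j \<partial>p) + ennreal (m / 2)"
    using assms mult_left_mono[OF assms(4), of t] by (intro add_mono ennreal_leI) auto
  finally have "ennreal (m / 2) + ennreal (m / 2) \<le> ennreal (m / 2) + (\<integral>\<^sup>+j. of_nat j * indicator ?S j \<partial>p)"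
    using assms by (simp add: ennreal_plus[symmetric] add.commute del: ennreal_plus)
  then have "ennreal (m / 2) \<le> (\<integral>\<^sup>+j. of_nat j * indicator ?S j \<partial>p)"
    by (subst (asm) ennreal_add_left_cancel_le) simp
  then have "(ennreal (m / 2))\<^sup>2 \<le> (\<integral>\<^sup>+j. of_nat j * indicator ?S j \<partial>p)\<^sup>2"
    by (rule power_mono) simp
  also have "\<dots> \<le> (\<integral>\<^sup>+j. (of_nat j)\<^sup>2 \<partial>p) * emeasure p ?S"
    by (rule second_moment_bound)
  also have "(\<integral>\<^sup>+j. (of_nat j)\<^sup>2 \<partial>p) = 2 * bm 2 p + bm 1 p"
  proof -
    have "(of_nat j)\<^sup>2 = (2 * of_nat (j choose 2) + of_nat (j choose 1) :: ennreal)" for j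
    proof -
      have "j\<^sup>2 = 2 * (j choose 2) + (j choose 1)"
        by (induction j) (simp_all add: power2_eq_square eval_nat_numeral)
      then show ?thesis
        by (metis of_nat_add of_nat_mult of_nat_numeral of_nat_power)
    qed
    then show ?thesis
      by (simp add: bm_def nn_integral_add nn_integral_cmult)
  qed
  also have "\<dots> \<le> ennreal (2 * v + M)"
    using add_mono[OF mult_left_mono[OF assms(3), of 2] assms(2)] assms M by (simp add: ennreal_mult)
  finally have "ennreal ((m / 2)\<^sup>2) \<le> ennreal ((2 * v + M) * measure p ?S)"
    using assms M by (simp add: ennreal_power measure_pmf.emeasure_eq_measure ennreal_mult mult_right_mono)
  then show ?thesis
    using assms M by (subst (asm) ennreal_le_iff) auto
qed

lemma (in critical_offspring) visit_moment_1_delay: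
  "visit_moment \<mu> 1 (replicate n (\<lambda>_. 0) @ \<phi>s) x = (avg ^^ n) (visit_moment \<mu> 1 \<phi>s) (x :: int ^ 'd::finite)"
proof (induction n arbitrary: x)
  case (Suc n)
  have "visit_moment \<mu> 1 (replicate n (\<lambda>_. 0) @ \<phi>s) = (avg ^^ n) (visit_moment \<mu> 1 \<phi>s)"
    using Suc.IH by auto
  then show ?case
    using visit_moment_1_Cons[of "\<lambda>_. 0" x "replicate n (\<lambda>_. 0) @ \<phi>s"] by simp
qed simp

context critical_brw
begin

text \<open>A positive count implies survival to generation \<open>N\<close>. The length
  \<open>3 * N\<close> makes room for the even generations \<open>2 * k\<close> with
  \<open>N \<le> k < 2 * N\<close>, the ones to which \<open>hk_lower\<close> applies.\<close>

definition window :: "nat \<Rightarrow> (int ^ 'd \<Rightarrow> nat) list" where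
  "window N = replicate N (\<lambda>_. 0) @ replicate (3 * N) at_origin"

lemma visit_moment_1_window:
  "visit_moment \<mu> 1 (window N) 0 = ennreal (\<Sum>m<3 * N. hk (N + m) (0 :: int ^ 'd))"
proof -
  have "visit_moment \<mu> 1 (replicate (3 * N) at_origin) = (\<lambda>x :: int ^ 'd. \<Sum>m<3 * N. ennreal (hk m x))"
    unfolding visit_moment_1_visits by (auto simp: green_def)
  then have "visit_moment \<mu> 1 (window N) 0 = (\<Sum>m<3 * N. ennreal (hk (N + m) (0 :: int ^ 'd)))"
    unfolding window_def visit_moment_1_delay by (simp only: avg_power_sum avg_power_hk)
  then show ?thesis
    by simp
qed

text \<open>At least \<open>N\<close> steps of averaging always act on the squared Green function.
  For a branching at a generation \<open>j \<le> N\<close>, the first moment from there on is itself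
  an average over \<open>N - j\<close> steps, and Jensen's inequality takes the square
  inside.\<close>

lemma visit_moment_2_window:
  assumes "CARD('d) < 4" "1 \<le> N"
  shows "visit_moment \<mu> 2 (window N) 0 \<le> pair_rate * ennreal (576 * C\<^sup>2 * real N powr (3 - real CARD('d)))"
proof -
  let ?d = "real CARD('d)"
  let ?g = "\<lambda>y :: int ^ 'd. ennreal ((green (3 * N) y)\<^sup>2)"
  define b where "b = C * real N powr (- ?d / 2) * (16 * C * real (3 * N) powr (2 - ?d / 2))"
  have g_le: "(avg ^^ j) ?g x \<le> ennreal b" if "N \<le> j" for j x
  proof -
    have "(avg ^^ j) ?g x \<le> ennreal (C * real (Suc j) powr (- ?d / 2)) * ennreal (16 * C * real (3 * N) powr (2 - ?d / 2))"
      using assms by (intro order_trans[OF avg_power_le_sum] mult_left_mono green_square_sum) auto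
    also have "\<dots> \<le> ennreal (C * real N powr (- ?d / 2)) * ennreal (16 * C * real (3 * N) powr (2 - ?d / 2))"
      using that assms C_pos by (intro mult_right_mono ennreal_leI mult_left_mono powr_mono2') auto
    finally show ?thesis
      using C_pos by (simp add: b_def ennreal_mult)
  qed
  have v_le: "(avg ^^ j) (\<lambda>y. (visit_moment \<mu> 1 (drop j (window N)) y)\<^sup>2) (0 :: int ^ 'd) \<le> ennreal b" if "j < 4 * N" for j
  proof (cases "j \<le> N")
    case True
    then have "drop j (window N) = replicate (N - j) (\<lambda>_. 0) @ replicate (3 * N) at_origin"
      by (simp add: window_def)
    then have "(avg ^^ j) (\<lambda>y. (visit_moment \<mu> 1 (drop j (window N)) y)\<^sup>2) (0 :: int ^ 'd) =
        (avg ^^ j) (\<lambda>y. ((avg ^^ (N - j)) (\<lambda>y. ennreal (green (3 * N) y)) y)\<^sup>2) (0 :: int ^ 'd)"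
      by (simp only: visit_moment_1_delay visit_moment_1_visits[abs_def])
    also have "\<dots> \<le> (avg ^^ j) ((avg ^^ (N - j)) ?g) (0 :: int ^ 'd)"
      by (intro avg_power_mono order_trans[OF avg_power_jensen]) (simp add: ennreal_power)
    also have "\<dots> = (avg ^^ N) ?g (0 :: int ^ 'd)"
      using True by (simp add: avg_power_comp)
    also have "\<dots> \<le> ennreal b"
      by (rule g_le) simp
    finally show ?thesis .
  next
    case False
    then have "drop j (window N) = replicate (4 * N - j) at_origin"
      by (simp add: window_def)
    then have "(avg ^^ j) (\<lambda>y. (visit_moment \<mu> 1 (drop j (window N)) y)\<^sup>2) (0 :: int ^ 'd) =
        (avg ^^ j) (\<lambda>y. ennreal ((green (4 * N - j) y)\<^sup>2)) (0 :: int ^ 'd)"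
      by (simp only: visit_moment_1_visits) (simp add: ennreal_power)
    also have "\<dots> \<le> (avg ^^ j) ?g (0 :: int ^ 'd)"
      using False by (intro avg_power_mono ennreal_leI power_mono green_mono) auto
    also have "\<dots> \<le> ennreal b"
      using False by (intro g_le) simp
    finally show ?thesis .
  qed
  have "zero_one (window N)"
    by (auto simp: zero_one_def window_def at_origin_def)
  then have "visit_moment \<mu> 2 (window N) (0 :: int ^ 'd) \<le>
      (\<Sum>j<length (window N). (avg ^^ j) (\<lambda>y. pair_rate * (visit_moment \<mu> 1 (drop j (window N)) y)\<^sup>2) 0)"
    by (rule visit_moment_2_le)
  also have "\<dots> = (\<Sum>j<4 * N. (avg ^^ j) (\<lambda>y. pair_rate * (visit_moment \<mu> 1 (drop j (window N)) y)\<^sup>2) 0)"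
    by (simp add: window_def)
  also have "\<dots> \<le> (\<Sum>j<4 * N. pair_rate * ennreal b)"
    unfolding avg_power_cmult by (intro sum_mono mult_left_mono v_le) auto
  also have "\<dots> = pair_rate * ennreal (real (4 * N) * b)"
    using C_pos by (simp add: b_def ennreal_mult ennreal_of_nat_eq_real_of_nat mult_ac)
  also have "\<dots> \<le> pair_rate * ennreal (576 * C\<^sup>2 * real N powr (3 - ?d))"
  proof (intro mult_left_mono ennreal_leI)
    have "real (3 * N) powr (2 - ?d / 2) = 3 powr (2 - ?d / 2) * real N powr (2 - ?d / 2)"
      by (simp add: powr_mult)
    moreover have "(3 :: real) powr (2 - ?d / 2) \<le> 3 powr 2"
      by (intro powr_mono) auto
    ultimately have "real (3 * N) powr (2 - ?d / 2) \<le> 9 * real N powr (2 - ?d / 2)"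
      by (simp add: mult_right_mono)
    then have "real (4 * N) * b \<le> real (4 * N) * (C * real N powr (- ?d / 2) * (16 * C * (9 * real N powr (2 - ?d / 2))))"
      unfolding b_def using C_pos by (intro mult_left_mono) auto
    also have "\<dots> = 576 * C\<^sup>2 * (real N * (real N powr (- ?d / 2) * real N powr (2 - ?d / 2)))"
      by (simp add: power2_eq_square)
    also have "real N powr (- ?d / 2) * real N powr (2 - ?d / 2) = real N powr (2 - ?d)"
      by (simp add: powr_add[symmetric])
    also have "real N * real N powr (2 - ?d) = real N powr (3 - ?d)"
      using assms powr_add[of "real N" 1 "2 - ?d"] by simp
    finally show "real (4 * N) * b \<le> 576 * C\<^sup>2 * real N powr (3 - ?d)" .
  qed simp
  finally show ?thesis .
qed

lemma visit_tail_ge_window: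
  assumes "real n \<le> t"
  shows "measure (occ \<mu> (window N) {#0 :: int ^ 'd#}) {j. t \<le> real j} \<le> visit_tail TYPE('d) \<mu> n"
proof -
  have "measure (occ \<mu> (window N) {#0 :: int ^ 'd#}) {j. t \<le> real j} \<le> measure (occ \<mu> (window N) {#0 :: int ^ 'd#}) {n..}"
    using assms by (intro measure_pmf.finite_measure_mono) auto
  also have "\<dots> \<le> measure (occ \<mu> (replicate (N + 3 * N) at_origin) {#0 :: int ^ 'd#}) {n..}"
  proof -
    have "list_all2 (\<le>) (window N) (replicate N at_origin @ replicate (3 * N) (at_origin :: int ^ 'd \<Rightarrow> nat))"
      unfolding window_def by (intro list_all2_appendI) (auto simp: list_all2_conv_all_nth le_fun_def)
    then have "emeasure (occ \<mu> (window N) {#0 :: int ^ 'd#}) {n..} \<le>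
        emeasure (occ \<mu> (replicate N at_origin @ replicate (3 * N) at_origin) {#0 :: int ^ 'd#}) {n..}"
      by (rule occ_mono)
    then show ?thesis
      unfolding replicate_add by (simp add: measure_pmf.emeasure_eq_measure)
  qed
  also have "\<dots> \<le> visit_tail TYPE('d) \<mu> n"
    by (rule visit_tail_ge)
  finally show ?thesis .
qed

text \<open>The first \<open>N\<close> functions vanish and produce no visits, so only the survival
  term of \<open>occ_tail_le\<close> remains.\<close>

lemma window_positive_le:
  "measure (occ \<mu> (window N) {#0 :: int ^ 'd#}) {1..} \<le> 1 / (survival_rate * (real N + 1))"
proof -
  have zero: "occ \<mu> (replicate N (\<lambda>_. 0)) B = return_pmf 0" for B :: "'d config"
  proof (induction N arbitrary: B)
    case (Suc N)
    then have "occ \<mu> (replicate N (\<lambda>_. 0)) = (\<lambda>B :: 'd config. return_pmf 0)"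
      by auto
    then show ?case by simp
  qed simp
  show ?thesis
    using occ_tail_le[of "replicate N (\<lambda>_. 0)" "replicate (3 * N) at_origin" "0 :: int ^ 'd" 1]
    by (simp add: window_def zero)
qed

theorem visit_tail_lower_low_dim:
  assumes "CARD('d) < 4"
  obtains K where "0 < K" "\<And>n. 1 \<le> n \<Longrightarrow> K * real n powr (- 2 / (4 - real CARD('d))) \<le> visit_tail TYPE('d) \<mu> n"
proof -
  let ?d = "real CARD('d)"
  define s where "s = 2 / (4 - ?d)"
  have d: "1 \<le> ?d" "?d \<le> 3"
    using assms by (auto simp: Suc_le_eq)
  have s: "0 < s" "(2 - ?d / 2) * s = 1"
    using d by (auto simp: s_def field_simps)
  obtain c where c: "0 < c" "\<And>m. c * real (Suc m) powr (- ?d / 2) \<le> hk (2 * m) (0 :: int ^ 'd)"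
    using hk_lower[where 'd = 'd] by blast
  obtain r where r: "pair_rate = ennreal r" "0 \<le> r"
    using pair_rate_finite by (cases pair_rate) auto
  define e where "e = c * 2 powr (- ?d / 2)"
  \<comment> \<open>\<open>D\<close> bounds the second moment in units of
    \<open>N powr (3 - d)\<close>; the mean enters because \<open>1 - d/2 \<le> 3 - d\<close>. The
    value of \<open>c'\<close> below makes the threshold times the survival bound at most half of
    the mean, so Paley--Zygmund gives probability of order
    \<open>N powr (2 - d) / N powr (3 - d) = 1/N\<close>.\<close>
  define D where "D = 2 * (r * (576 * C\<^sup>2)) + 3 * C"
  define c' where "c' = survival_rate * e / 2"
  have pos: "0 < e" "0 < D" "0 < c'"
    using c r C_pos survival_rate_pos by (auto simp: e_def D_def c'_def add_nonneg_pos)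
  have window: "(e / 2)\<^sup>2 / D / real N \<le> measure (occ \<mu> (window N) {#0 :: int ^ 'd#}) {j. c' * real N powr (2 - ?d / 2) \<le> real j}"
    if N: "1 \<le> N" for N
  proof -
    let ?p = "occ \<mu> (window N) {#0 :: int ^ 'd#}"
    let ?t = "c' * real N powr (2 - ?d / 2)"
    define m where "m = e * real N powr (1 - ?d / 2)"
    define M where "M = 3 * C * real N powr (1 - ?d / 2)"
    define v where "v = r * (576 * C\<^sup>2) * real N powr (3 - ?d)"
    have N_powr: "real N * real N powr a = real N powr (1 + a)" for a
      using N powr_add[of "real N" 1 a] by simp
    have "ennreal m \<le> bm 1 ?p"
      unfolding visit_moment_def[symmetric] visit_moment_1_window
    proof (rule ennreal_leI)
      have "m = (\<Sum>k\<in>{N..<2 * N}. c * real (2 * N) powr (- ?d / 2))"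
        using N_powr[of "- ?d / 2"] by (simp add: m_def e_def powr_mult mult_ac)
      also have "\<dots> \<le> (\<Sum>k\<in>{N..<2 * N}. hk (2 * k) (0 :: int ^ 'd))"
      proof (rule sum_mono)
        fix k assume "k \<in> {N..<2 * N}"
        then have "real (2 * N) powr (- ?d / 2) \<le> real (Suc k) powr (- ?d / 2)"
          by (intro powr_mono2') auto
        then have "c * real (2 * N) powr (- ?d / 2) \<le> c * real (Suc k) powr (- ?d / 2)"
          using c by (intro mult_left_mono) auto
        with c(2)[of k] show "c * real (2 * N) powr (- ?d / 2) \<le> hk (2 * k) (0 :: int ^ 'd)"
          by linarith
      qed
      also have "\<dots> = (\<Sum>m\<in>(\<lambda>k. 2 * k - N) ` {N..<2 * N}. hk (N + m) (0 :: int ^ 'd))"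
        by (subst sum.reindex) (auto simp: inj_on_def intro!: sum.cong)
      also have "\<dots> \<le> (\<Sum>m<3 * N. hk (N + m) (0 :: int ^ 'd))"
        by (rule sum_mono2) auto
      finally show "m \<le> (\<Sum>m<3 * N. hk (N + m) (0 :: int ^ 'd))" .
    qed
    moreover have "bm 1 ?p \<le> ennreal M"
      unfolding visit_moment_def[symmetric] visit_moment_1_window
    proof (rule ennreal_leI)
      have "(\<Sum>m<3 * N. hk (N + m) (0 :: int ^ 'd)) \<le> (\<Sum>m<3 * N. C * real N powr (- ?d / 2))"
      proof (rule sum_mono)
        fix m
        have "real (Suc (N + m)) powr (- ?d / 2) \<le> real N powr (- ?d / 2)"
          using N by (intro powr_mono2') auto
        then have "C * real (Suc (N + m)) powr (- ?d / 2) \<le> C * real N powr (- ?d / 2)"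
          using C_pos by (intro mult_left_mono) auto
        with hk_le[of "N + m" 0] show "hk (N + m) (0 :: int ^ 'd) \<le> C * real N powr (- ?d / 2)"
          by linarith
      qed
      also have "\<dots> = M"
        using N_powr[of "- ?d / 2"] by (simp add: M_def mult_ac)
      finally show "(\<Sum>m<3 * N. hk (N + m) (0 :: int ^ 'd)) \<le> M" .
    qed
    moreover have "bm 2 ?p \<le> ennreal v"
      using visit_moment_2_window[OF assms N] r
      by (simp add: visit_moment_def v_def ennreal_mult[symmetric] mult.assoc)
    moreover have "?t * (1 / (survival_rate * (real N + 1))) \<le> m / 2"
    proof -
      have "?t * (1 / (survival_rate * (real N + 1))) \<le> ?t * (1 / (survival_rate * real N))"
        using survival_rate_pos pos N by (intro mult_left_mono divide_left_mono mult_left_mono) auto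
      also have "\<dots> = m / 2"
        using survival_rate_pos N N_powr[of "1 - ?d / 2", symmetric]
        by (simp add: c'_def m_def)
      finally show ?thesis .
    qed
    ultimately have "(m / 2)\<^sup>2 \<le> (2 * v + M) * measure ?p {j. ?t \<le> real j}"
      using r pos N by (intro paley_zygmund_nat[OF _ _ _ window_positive_le]) (auto simp: v_def m_def)
    also have "\<dots> \<le> D * real N powr (3 - ?d) * measure ?p {j. ?t \<le> real j}"
    proof (rule mult_right_mono)
      have "real N powr (1 - ?d / 2) \<le> real N powr (3 - ?d)"
        using N d by (intro powr_mono) auto
      then have "M \<le> 3 * C * real N powr (3 - ?d)"
        unfolding M_def using C_pos by (intro mult_left_mono) auto
      then show "2 * v + M \<le> D * real N powr (3 - ?d)"
        by (simp add: v_def D_def algebra_simps)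
    qed simp
    finally have "(m / 2)\<^sup>2 \<le> D * real N powr (3 - ?d) * measure ?p {j. ?t \<le> real j}" .
    moreover have "(m / 2)\<^sup>2 = (e / 2)\<^sup>2 * (real N powr (3 - ?d) / real N)"
    proof -
      have "(real N powr (1 - ?d / 2))\<^sup>2 = real N powr (2 - ?d)"
        using N by (simp add: powr_power algebra_simps)
      also have "\<dots> = real N powr (3 - ?d) / real N"
        using N N_powr[of "2 - ?d"] by (simp add: field_simps)
      finally show ?thesis
        by (simp add: m_def power_mult_distrib power_divide)
    qed
    ultimately have "real N powr (3 - ?d) * ((e / 2)\<^sup>2 / real N) \<le> real N powr (3 - ?d) * (D * measure ?p {j. ?t \<le> real j})"
      by (simp add: mult_ac)
    then have "(e / 2)\<^sup>2 / real N \<le> D * measure ?p {j. ?t \<le> real j}"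
      by (rule mult_left_le_imp_le) (use N in simp)
    then have "(e / 2)\<^sup>2 / real N / D \<le> measure ?p {j. ?t \<le> real j}"
      using pos by (subst pos_divide_le_eq) (auto simp: mult.commute)
    then show ?thesis
      by (simp add: divide_divide_eq_left mult_ac)
  qed
  define K where "K = (e / 2)\<^sup>2 / D / ((1 / c') powr s + 1)"
  have "0 < (1 / c') powr s + 1"
    by (rule add_nonneg_pos) auto
  then have K: "0 < K"
    unfolding K_def using pos by (intro divide_pos_pos) auto
  have "K * real n powr (- s) \<le> visit_tail TYPE('d) \<mu> n" if n: "1 \<le> n" for n
  proof -
    \<comment> \<open>The solution of \<open>c' * x powr (2 - d/2) = n\<close>.\<close>
    define x where "x = (real n / c') powr s"
    define N where "N = nat \<lceil>x\<rceil>"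
    have x: "0 < x"
      using n pos by (simp add: x_def)
    have N: "1 \<le> N" "x \<le> real N" "real N \<le> x + 1"
    proof -
      have "real N = of_int \<lceil>x\<rceil>"
        using x by (simp add: N_def)
      then show "x \<le> real N" "real N \<le> x + 1"
        by linarith+
      with x show "1 \<le> N"
        by linarith
    qed
    have "real n = c' * x powr (2 - ?d / 2)"
      using n pos s by (simp add: x_def powr_powr mult.commute)
    also have "\<dots> \<le> c' * real N powr (2 - ?d / 2)"
      using x N pos d by (intro mult_left_mono powr_mono2) auto
    finally have "measure (occ \<mu> (window N) {#0 :: int ^ 'd#}) {j. c' * real N powr (2 - ?d / 2) \<le> real j} \<le> visit_tail TYPE('d) \<mu> n"
      by (rule visit_tail_ge_window)
    with window[OF N(1)] have "(e / 2)\<^sup>2 / D / real N \<le> visit_tail TYPE('d) \<mu> n"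
      by linarith
    moreover have "K * real n powr (- s) \<le> (e / 2)\<^sup>2 / D / real N"
    proof -
      have "1 \<le> real n powr s"
        using n s by (simp add: ge_one_powr_ge_zero)
      moreover have "x = (1 / c') powr s * real n powr s"
        using pos by (simp add: x_def powr_mult[symmetric])
      ultimately have "real N \<le> ((1 / c') powr s + 1) * real n powr s"
        using N by (simp add: distrib_right)
      then have "(e / 2)\<^sup>2 / D / (((1 / c') powr s + 1) * real n powr s) \<le> (e / 2)\<^sup>2 / D / real N"
        using N pos by (intro divide_left_mono) auto
      moreover have "K * real n powr (- s) = (e / 2)\<^sup>2 / D / (((1 / c') powr s + 1) * real n powr s)"
        unfolding K_def by (simp only: powr_minus_divide times_divide_times_eq divide_divide_eq_left mult_1_right mult.assoc)
      ultimately show ?thesis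
        by simp
    qed
    ultimately show ?thesis
      by linarith
  qed
  with K show ?thesis
    by (intro that[of K]) (auto simp: s_def)
qed

end

section \<open>Dimension at least five\<close>

text \<open>The prefactors must be absorbed into the exponent. Where \<open>G n\<close> is large,
  \<open>A\<close> costs at most half of the rate \<open>a\<close>; where
  \<open>G n \<le> M\<close>, the exponent is bounded below because \<open>p n \<le> r < 1\<close>.
  This is the reason for requiring \<open>p2\<close> from 2 on.\<close>

lemma exp_minus_ThetaI:
  fixes p G :: "nat \<Rightarrow> real"
  assumes upper: "\<And>n. 1 \<le> n \<Longrightarrow> p n \<le> A * exp (- a * G n)"
    and lower: "\<And>n. 1 \<le> n \<Longrightarrow> b * exp (- B * G n) \<le> p n"
    and const: "0 < a" "0 < b" "0 \<le> B"
    and G: "\<And>n. 1 \<le> n \<Longrightarrow> 1 \<le> G n"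
    and p2: "\<And>n. 2 \<le> n \<Longrightarrow> p n \<le> r" "r < 1"
  shows "exp_minus_Theta p G"
proof -
  have pos: "0 < p n" if "1 \<le> n" for n
    using lower[OF that] const by (meson exp_gt_zero less_le_trans mult_pos_pos)
  have A: "0 < A"
  proof -
    have "0 < A * exp (- a * G 1)"
      using pos[of 1] upper[of 1] by simp
    then show ?thesis
      by (simp add: zero_less_mult_iff)
  qed
  have r: "0 < r"
    using pos[of 2] p2(1)[of 2] by simp
  define M where "M = max 1 (2 * ln A / a)"
  define c where "c = min (a / 2) (- ln r / M)"
  have c: "0 < c"
  proof -
    have "0 < M" "ln r < 0"
      using r p2 by (auto simp: M_def)
    then have "0 < - ln r / M"
      by (intro divide_pos_pos) auto
    then show ?thesis
      using const by (simp add: c_def)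
  qed
  define C where "C = B + \<bar>ln b\<bar> + 1"
  have "c * G n \<le> - ln (p n) \<and> - ln (p n) \<le> C * G n" if n: "2 \<le> n" for n
  proof
    have G1: "1 \<le> G n" and pn: "0 < p n"
      using G[of n] pos[of n] n by auto
    show "c * G n \<le> - ln (p n)"
    proof (cases "G n \<le> M")
      case True
      have "c * G n \<le> - ln r / M * M"
        using True G1 c p2 r by (intro mult_mono) (auto simp: c_def M_def)
      also have "\<dots> = - ln r"
        by (simp add: M_def)
      also have "\<dots> \<le> - ln (p n)"
        using p2(1)[OF n] pn by simp
      finally show ?thesis .
    next
      case False
      then have "2 * ln A / a \<le> G n"
        by (simp add: M_def)
      then have "ln A \<le> a / 2 * G n"
        using const by (simp add: field_simps)
      moreover have "ln (p n) \<le> ln (A * exp (- a * G n))"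
        using upper[of n] n pn by (intro ln_mono) auto
      moreover have "ln (A * exp (- a * G n)) = ln A - a * G n"
        using A by (simp add: ln_mult)
      ultimately have "a / 2 * G n \<le> - ln (p n)"
        by simp
      moreover have "c * G n \<le> a / 2 * G n"
        unfolding c_def by (intro mult_right_mono min.cobounded1) (use G1 in simp)
      ultimately show ?thesis
        by linarith
    qed
    have "ln (b * exp (- B * G n)) \<le> ln (p n)"
      using lower[of n] n const by (intro ln_mono) auto
    moreover have "ln (b * exp (- B * G n)) = ln b - B * G n"
      using const by (simp add: ln_mult)
    moreover have "- ln b \<le> (\<bar>ln b\<bar> + 1) * G n"
    proof -
      have "- ln b \<le> (\<bar>ln b\<bar> + 1) * 1"
        by (rule order_trans[OF abs_ge_minus_self]) simp
      also have "\<dots> \<le> (\<bar>ln b\<bar> + 1) * G n"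
        by (intro mult_left_mono G1) auto
      finally show ?thesis .
    qed
    ultimately show "- ln (p n) \<le> C * G n"
      by (simp add: C_def algebra_simps)
  qed
  moreover have "0 < C"
    using const by (simp add: C_def add_nonneg_pos)
  ultimately have "Theta_from 2 (\<lambda>n. - ln (p n)) G"
    unfolding Theta_from_def using c by blast
  moreover have "\<forall>n\<ge>1. p n = exp (- (- ln (p n)))"
    using pos by simp
  ultimately show ?thesis
    unfolding exp_minus_Theta_def by (intro exI[of _ "\<lambda>n. - ln (p n)"] conjI)
qed

lemma visit_tail_antimono: "m \<le> n \<Longrightarrow> visit_tail TYPE('d::finite) \<mu> n \<le> visit_tail TYPE('d) \<mu> m"
proof (rule visit_tail_leI)
  fix N assume "m \<le> n"
  then have "measure (occ \<mu> (replicate N at_origin) {#0 :: int ^ 'd#}) {n..} \<le>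
      measure (occ \<mu> (replicate N at_origin) {#0 :: int ^ 'd#}) {m..}"
    by (intro measure_pmf.finite_measure_mono) auto
  also have "\<dots> \<le> visit_tail TYPE('d) \<mu> m"
    by (rule visit_tail_ge)
  finally show "measure (occ \<mu> (replicate N at_origin) {#0 :: int ^ 'd#}) {n..} \<le> visit_tail TYPE('d) \<mu> m" .
qed

section \<open>Supersolutions for the generating function\<close>

lemma sqnorm_0 [simp]: "sqnorm 0 = 0"
  by (simp add: sqnorm_def)

lemma sqnorm_eq_0_iff [simp]: "sqnorm x = 0 \<longleftrightarrow> x = 0"
  unfolding sqnorm_def by (subst sum_nonneg_eq_0_iff) (auto simp: vec_eq_iff)

lemma sqrt_sqnorm_neighbour:
  assumes "y \<in> neighbours x"
  shows "sqrt (sqnorm y) \<le> sqrt (sqnorm x) + 1"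
proof (rule real_le_lsqrt)
  obtain i where "y = x + axis i 1 \<or> y = x - axis i 1"
    using assms by (auto simp: neighbours_def)
  then have "sqnorm y \<le> sqnorm x + 1 + 2 * \<bar>real_of_int (x $ i)\<bar>"
    by (auto simp: sqnorm_add_axis)
  moreover have "\<bar>real_of_int (x $ i)\<bar> \<le> sqrt (sqnorm x)"
    using sqnorm_component_le[of x i] real_le_rsqrt[of "\<bar>real_of_int (x $ i)\<bar>"] by simp
  ultimately show "sqnorm y \<le> (sqrt (sqnorm x) + 1)\<^sup>2"
    by (simp add: power2_eq_square algebra_simps)
qed simp_all

lemma ravg_nonneg: "(\<And>y. 0 \<le> f y) \<Longrightarrow> 0 \<le> ravg f x"
  unfolding ravg_def by (intro divide_nonneg_nonneg sum_nonneg add_nonneg_nonneg) auto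

lemma ravg_cmult: "ravg (\<lambda>y. c * f y) x = c * ravg f x"
  unfolding ravg_def by (simp add: sum_distrib_left distrib_left)

definition inv_sq :: "int ^ 'd::finite \<Rightarrow> real" where
  "inv_sq x = 1 / (sqnorm x + 30)"

lemma inv_sq_pos: "0 < inv_sq x"
  unfolding inv_sq_def by (intro divide_pos_pos add_nonneg_pos) auto

lemma inv_sq_le: "inv_sq x \<le> 1 / 30"
  using frac_le[of 1 1 30 "sqnorm x + 30"] by (simp add: inv_sq_def)

text \<open>Opposite neighbours combine exactly to \<open>2/A + 8 t^2 / (A (A^2 - 4 t^2))\<close>,
  with \<open>t\<close> the coordinate of \<open>x\<close>. Replacing \<open>4 t^2\<close> by
  \<open>4 * sqnorm x\<close> in the denominator lets the numerators add up to
  \<open>sqnorm x\<close>.\<close>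

lemma ravg_inv_sq_le:
  fixes x :: "int ^ 'd::finite"
  defines "A \<equiv> sqnorm x + 31"
  shows "ravg inv_sq x \<le> 1 / A + 4 * sqnorm x / real CARD('d) / (A * (A\<^sup>2 - 4 * sqnorm x))"
proof -
  let ?d = "real CARD('d)"
  define s where "s = sqnorm x"
  have s: "0 \<le> s" "A = s + 31"
    by (auto simp: s_def A_def)
  have A2: "0 < A\<^sup>2 - 4 * s"
  proof -
    have "A\<^sup>2 - 4 * s = s * s + 58 * s + 961"
      unfolding s(2) by (simp add: power2_eq_square algebra_simps)
    also have "0 < \<dots>"
      using s(1) by (intro add_nonneg_pos add_nonneg_nonneg mult_nonneg_nonneg) auto
    finally show ?thesis .
  qed
  have "inv_sq (x + axis i 1) + inv_sq (x - axis i 1) \<le> 2 / A + 8 * (real_of_int (x $ i))\<^sup>2 / (A * (A\<^sup>2 - 4 * s))" for i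
  proof -
    define t where "t = real_of_int (x $ i)"
    have t: "t\<^sup>2 \<le> s"
      unfolding t_def s_def by (rule sqnorm_component_le)
    have "(2 * t)\<^sup>2 < A\<^sup>2"
      using A2 t by (simp add: power_mult_distrib)
    then have "\<bar>2 * t\<bar>\<^sup>2 < A\<^sup>2"
      by (simp only: power2_abs)
    then have abs: "\<bar>2 * t\<bar> < A"
      by (rule power2_less_imp_less) (use s in simp)
    have "inv_sq (x + axis i 1) + inv_sq (x - axis i 1) = 1 / (A + 2 * t) + 1 / (A - 2 * t)"
      by (simp add: inv_sq_def sqnorm_add_axis A_def t_def algebra_simps)
    also have "\<dots> = 2 / A + 8 * t\<^sup>2 / (A * (A\<^sup>2 - 4 * t\<^sup>2))"
    proof -
      have "A\<^sup>2 - 4 * t\<^sup>2 = (A + 2 * t) * (A - 2 * t)"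
        by (simp add: power2_eq_square algebra_simps)
      moreover have "0 < A + 2 * t" "0 < A - 2 * t" "0 < A"
        using abs s by auto
      ultimately show ?thesis
        by (simp add: divide_simps) (simp add: power2_eq_square algebra_simps)
    qed
    also have "\<dots> \<le> 2 / A + 8 * t\<^sup>2 / (A * (A\<^sup>2 - 4 * s))"
      using s A2 t by (intro add_left_mono divide_left_mono mult_left_mono mult_pos_pos) auto
    finally show ?thesis
      by (simp add: t_def)
  qed
  then have "(\<Sum>i\<in>UNIV. inv_sq (x + axis i 1) + inv_sq (x - axis i 1)) \<le>
      (\<Sum>i\<in>UNIV. 2 / A + 8 * (real_of_int (x $ i))\<^sup>2 / (A * (A\<^sup>2 - 4 * s)))"
    by (intro sum_mono) auto
  also have "\<dots> = ?d * (2 / A) + 8 * s / (A * (A\<^sup>2 - 4 * s))"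
    by (simp add: sum.distrib sum_divide_distrib[symmetric] sum_distrib_left[symmetric] s_def sqnorm_def)
  finally have "ravg inv_sq x \<le> (?d * (2 / A) + 8 * s / (A * (A\<^sup>2 - 4 * s))) / (2 * ?d)"
    unfolding ravg_def by (intro divide_right_mono) auto
  also have "\<dots> = 1 / A + 4 * s / ?d / (A * (A\<^sup>2 - 4 * s))"
    by (simp add: add_divide_distrib)
  finally show ?thesis
    by (simp add: s_def)
qed

text \<open>The lattice form of the strict superharmonicity of \<open>|x|^-2\<close> above dimension
  four. The factor \<open>4/d \<le> 4/5\<close> leaves room to bound the second-order term with
  coefficient 9/10 < 1 despite the lattice corrections, and a part of what remains becomes the gain
  \<open>h^2 / 20\<close>.\<close>

lemma ravg_inv_sq_high_dim:
  assumes "5 \<le> CARD('d)"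
  shows "ravg inv_sq (x :: int ^ 'd::finite) \<le> inv_sq x - (inv_sq x)\<^sup>2 / 20"
proof -
  define s where "s = sqnorm x"
  define A where "A = s + 31"
  have s: "0 \<le> s"
    by (simp add: s_def)
  have A: "31 \<le> A" "s = A - 31"
    using s by (auto simp: A_def)
  have A2: "0 < A\<^sup>2 - 4 * s"
    using s by (simp add: A_def power2_eq_square algebra_simps add_nonneg_pos)
  have "8 * s * (A - 1) \<le> 9 * (A\<^sup>2 - 4 * s)"
  proof -
    have "0 \<le> A * A + 220 * A + 868"
      using A by (intro add_nonneg_nonneg mult_nonneg_nonneg) auto
    then show ?thesis
      unfolding A(2) by (simp add: power2_eq_square algebra_simps)
  qed
  then have 1: "4 * s / 5 / (A\<^sup>2 - 4 * s) \<le> 9 / 10 / (A - 1)"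
  proof -
    assume *: "8 * s * (A - 1) \<le> 9 * (A\<^sup>2 - 4 * s)"
    have "4 * s / 5 * (A - 1) \<le> 9 / 10 * (A\<^sup>2 - 4 * s)"
    proof -
      have "4 * s / 5 * (A - 1) = 8 * s * (A - 1) / 10" "9 / 10 * (A\<^sup>2 - 4 * s) = 9 * (A\<^sup>2 - 4 * s) / 10"
        by simp_all
      with * show ?thesis
        by linarith
    qed
    then show ?thesis
      using A A2 by (subst pos_divide_le_eq, simp, subst times_divide_eq_left, subst pos_le_divide_eq) auto
  qed
  have "ravg inv_sq x \<le> 1 / A + 4 * s / real CARD('d) / (A * (A\<^sup>2 - 4 * s))"
    unfolding s_def A_def by (rule ravg_inv_sq_le)
  also have "4 * s / real CARD('d) \<le> 4 * s / 5"
    using assms s by (intro divide_left_mono) auto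
  then have "4 * s / real CARD('d) / (A * (A\<^sup>2 - 4 * s)) \<le> 4 * s / 5 / (A * (A\<^sup>2 - 4 * s))"
    using A A2 by (intro divide_right_mono) auto
  also have "4 * s / 5 / (A * (A\<^sup>2 - 4 * s)) = 4 * s / 5 / (A\<^sup>2 - 4 * s) / A"
    by simp
  also have "\<dots> \<le> 9 / 10 / (A - 1) / A"
    using 1 A by (intro divide_right_mono) auto
  finally have "ravg inv_sq x \<le> 1 / A + 9 / 10 / (A - 1) / A"
    by simp
  also have "\<dots> \<le> 1 / (A - 1) - (1 / (A - 1))\<^sup>2 / 20"
  proof -
    have "1 / (A - 1) - (1 / (A - 1))\<^sup>2 / 20 - (1 / A + 9 / 10 / (A - 1) / A) = (A - 2) / (20 * (A - 1)\<^sup>2 * A)"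
      using A by (simp add: divide_simps power2_eq_square) (simp add: algebra_simps)
    also have "\<dots> \<ge> 0"
      using A by (intro divide_nonneg_nonneg mult_nonneg_nonneg) auto
    finally show ?thesis
      by linarith
  qed
  finally show ?thesis
    by (simp add: inv_sq_def A_def s_def add.commute)
qed

lemma gf_mono: "a \<le> b \<Longrightarrow> gf a p \<le> gf b p"
  unfolding gf_def by (intro nn_integral_mono power_mono) auto

context critical_offspring
begin

text \<open>Each generation moves a particle by distance 1, so a process with \<open>n\<close>
  generations left, started within distance \<open>N - n\<close>, stays in the ball of radius
  \<open>N\<close>; the supersolution inequality is needed only there.\<close>

lemma gf_visits_le:
  fixes g :: "int ^ 'd::finite \<Rightarrow> real"
  assumes g: "\<And>x. 0 \<le> g x"
    and step: "\<And>x. sqrt (sqnorm x) \<le> real N \<Longrightarrow> z ^ at_origin x * gf (ennreal (1 + ravg g x)) \<mu> \<le> ennreal (1 + g x)"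
  shows "n \<le> N \<Longrightarrow> sqrt (sqnorm x) \<le> real (N - n) \<Longrightarrow>
    gf z (occ \<mu> (replicate n at_origin) {#x#}) \<le> ennreal (1 + g x)"
proof (induction n arbitrary: x)
  case 0
  then show ?case
    using g[of x] by (simp add: gf_def)
next
  case (Suc n)
  have "avg (\<lambda>y. gf z (occ \<mu> (replicate n at_origin) {#y#})) x \<le> avg (\<lambda>y. ennreal (1 + g y)) x"
  proof (rule avg_mono)
    fix y assume "y \<in> neighbours x"
    then have "sqrt (sqnorm y) \<le> real (N - n)"
      using sqrt_sqnorm_neighbour[of y x] Suc.prems by simp
    then show "gf z (occ \<mu> (replicate n at_origin) {#y#}) \<le> ennreal (1 + g y)"
      using Suc by simp
  qed
  also have "\<dots> = ennreal (1 + ravg g x)"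
  proof -
    have "ravg (\<lambda>y. 1 + g y) x = 1 + ravg g x"
      unfolding ravg_def by (simp add: sum.distrib field_simps)
    then show ?thesis
      using avg_ennreal[of "\<lambda>y. 1 + g y" x] g by (simp add: add_nonneg_nonneg)
  qed
  finally have "gf z (occ \<mu> (replicate (Suc n) at_origin) {#x#}) \<le> z ^ at_origin x * gf (ennreal (1 + ravg g x)) \<mu>"
    unfolding replicate_Suc gf_occ_Cons by (intro mult_left_mono gf_mono) auto
  also have "\<dots> \<le> ennreal (1 + g x)"
    using Suc.prems by (intro step) auto
  finally show ?case .
qed

lemma measure_tail_le_gf:
  assumes "gf (ennreal z) p \<le> ennreal b" "1 \<le> z" "0 \<le> b"
  shows "measure p {n..} \<le> b / z ^ n"
proof -
  have "ennreal (z ^ n) * emeasure p {n..} = (\<integral>\<^sup>+k. ennreal (z ^ n) * indicator {n..} k \<partial>p)"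
    by (simp add: nn_integral_cmult)
  also have "\<dots> \<le> gf (ennreal z) p"
    unfolding gf_def using assms
    by (intro nn_integral_mono) (auto simp: indicator_def ennreal_power intro!: ennreal_leI power_increasing)
  also have "\<dots> \<le> ennreal b"
    by fact
  finally have "z ^ n * measure p {n..} \<le> b"
    using assms by (simp add: measure_pmf.emeasure_eq_measure ennreal_mult[symmetric])
  then show ?thesis
    using assms by (simp add: pos_le_divide_eq mult.commute)
qed

text \<open>At the origin the excess \<open>e\<close> pays for the factor \<open>1 + \<delta>\<close>; elsewhere it pays for the
  quadratic term of the generating function.\<close>

lemma supersolution_step:
  assumes gf: "\<And>t. 0 \<le> t \<Longrightarrow> t \<le> t0 \<Longrightarrow> gf (ennreal (1 + t)) \<mu> \<le> ennreal (1 + t + A * t\<^sup>2)"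
    and t: "0 \<le> t" "t \<le> t0" "t \<le> 1" "t + A * t\<^sup>2 + e \<le> g" "0 \<le> e" "0 \<le> A"
    and \<delta>: "0 \<le> \<delta>" "x = 0 \<Longrightarrow> \<delta> * (2 + A) \<le> e"
  shows "ennreal (1 + \<delta>) ^ at_origin (x :: int ^ 'd::finite) * gf (ennreal (1 + t)) \<mu> \<le> ennreal (1 + g)"
proof (cases "x = 0")
  case False
  have "gf (ennreal (1 + t)) \<mu> \<le> ennreal (1 + g)"
    using t by (intro order_trans[OF gf[OF t(1,2)] ennreal_leI]) auto
  with False show ?thesis
    by (simp add: at_origin_def)
next
  case True
  have "ennreal (1 + \<delta>) ^ at_origin x * gf (ennreal (1 + t)) \<mu> \<le> ennreal (1 + \<delta>) * ennreal (1 + t + A * t\<^sup>2)"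
    using True gf[OF t(1,2)] by (simp add: at_origin_def mult_left_mono del: ennreal_plus)
  also have "\<dots> = ennreal ((1 + \<delta>) * (1 + t + A * t\<^sup>2))"
    using t \<delta> by (intro ennreal_mult[symmetric]) auto
  also have "\<dots> \<le> ennreal (1 + g)"
  proof (rule ennreal_leI)
    have "t\<^sup>2 \<le> 1"
      using t by (simp add: power_le_one)
    then have "A * t\<^sup>2 \<le> A"
      using t mult_left_mono[of "t\<^sup>2" 1 A] by simp
    then have "\<delta> * (1 + t + A * t\<^sup>2) \<le> \<delta> * (2 + A)"
      using t \<delta> by (intro mult_left_mono) auto
    then show "(1 + \<delta>) * (1 + t + A * t\<^sup>2) \<le> 1 + g"
      using \<delta>(2)[OF True] t by (simp add: algebra_simps)
  qed
  finally show ?thesis .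
qed

theorem visit_tail_upper_high_dim:
  assumes "5 \<le> CARD('d::finite)"
  obtains a where "0 < a" "\<And>n. visit_tail TYPE('d) \<mu> n \<le> 2 * exp (- a * real n)"
proof -
  obtain A t0 where A: "0 < A" "0 < t0"
    and gf: "\<And>t. 0 \<le> t \<Longrightarrow> t \<le> t0 \<Longrightarrow> gf (ennreal (1 + t)) \<mu> \<le> ennreal (1 + t + A * t\<^sup>2)"
    using gf_offspring_le by blast
  \<comment> \<open>\<open>A * \<epsilon> \<le> 1/40\<close> spends one half of the gain
    \<open>\<epsilon> * h^2 / 20\<close> on the quadratic term; the other half is the excess
    \<open>e\<close>.\<close>
  define \<epsilon> where "\<epsilon> = min 1 (min t0 (1 / (40 * A)))"
  have \<epsilon>: "0 < \<epsilon>" "\<epsilon> \<le> 1" "\<epsilon> \<le> t0" "A * \<epsilon> \<le> 1 / 40"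
  proof -
    show "0 < \<epsilon>" "\<epsilon> \<le> 1" "\<epsilon> \<le> t0"
      using A by (auto simp: \<epsilon>_def)
    have "\<epsilon> \<le> 1 / (40 * A)"
      by (simp add: \<epsilon>_def)
    then show "A * \<epsilon> \<le> 1 / 40"
      using A by (simp add: field_simps)
  qed
  \<comment> \<open>At the origin \<open>h = 1/30\<close>, so the excess there is
    \<open>\<epsilon> / (40 * 30^2)\<close>.\<close>
  define \<delta> where "\<delta> = \<epsilon> / 36000 / (2 + A)"
  have \<delta>: "0 < \<delta>"
    using \<epsilon> A by (simp add: \<delta>_def)
  let ?g = "\<lambda>x :: int ^ 'd. \<epsilon> * inv_sq x"
  have g: "0 \<le> ?g x" "?g x \<le> \<epsilon> / 30" for x
    using \<epsilon> inv_sq_pos[of x] inv_sq_le[of x] mult_left_mono[of "inv_sq x" "1 / 30" \<epsilon>] by auto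
  have step: "ennreal (1 + \<delta>) ^ at_origin x * gf (ennreal (1 + ravg ?g x)) \<mu> \<le> ennreal (1 + ?g x)" for x
  proof -
    define h where "h = inv_sq x"
    define t where "t = ravg ?g x"
    have t0: "0 \<le> t"
      unfolding t_def by (rule ravg_nonneg) (rule g)
    have t1: "t \<le> \<epsilon> * (h - h\<^sup>2 / 20)"
      unfolding t_def ravg_cmult h_def using \<epsilon> by (intro mult_left_mono ravg_inv_sq_high_dim assms) auto
    have "\<epsilon> * (h - h\<^sup>2 / 20) \<le> \<epsilon> * h"
      using \<epsilon> by (intro mult_left_mono) auto
    with t1 have t2: "t \<le> \<epsilon> * h"
      by linarith
    have "A * t\<^sup>2 \<le> A * (\<epsilon> * h)\<^sup>2"
      using t0 t2 A by (intro mult_left_mono power_mono) auto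
    also have "\<dots> = (A * \<epsilon>) * (\<epsilon> * h\<^sup>2)"
      by (simp add: power2_eq_square)
    also have "\<dots> \<le> 1 / 40 * (\<epsilon> * h\<^sup>2)"
      using \<epsilon> by (intro mult_right_mono) auto
    finally have main: "t + A * t\<^sup>2 + \<epsilon> * h\<^sup>2 / 40 \<le> \<epsilon> * h"
      using t1 by (simp add: algebra_simps)
    have zero: "\<delta> * (2 + A) \<le> \<epsilon> * h\<^sup>2 / 40" if "x = 0"
    proof -
      have "2 + A \<noteq> 0"
        using A by simp
      then have "\<delta> * (2 + A) = \<epsilon> / 36000"
        using \<delta>_def by (rule iffD1[OF nonzero_eq_divide_eq])
      then show ?thesis
        using that by (simp add: h_def inv_sq_def power2_eq_square)
    qed
    show ?thesis
      unfolding t_def[symmetric] h_def[symmetric]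
    proof (rule supersolution_step[where ?t0.0 = t0 and A = A and e = "\<epsilon> * h\<^sup>2 / 40"])
      show "gf (ennreal (1 + t)) \<mu> \<le> ennreal (1 + t + A * t\<^sup>2)" if "0 \<le> t" "t \<le> t0" for t
        using that by (rule gf)
      have "\<epsilon> * h \<le> \<epsilon> * 1"
        using \<epsilon> inv_sq_le[of x] by (intro mult_left_mono) (auto simp: h_def)
      then have "\<epsilon> * h \<le> \<epsilon>"
        by linarith
      with t2 \<epsilon> show "t \<le> t0" "t \<le> 1"
        by linarith+
    qed (use main zero t0 \<epsilon> A \<delta> in auto)
  qed
  have tail: "measure (occ \<mu> (replicate N at_origin) {#0 :: int ^ 'd#}) {n..} \<le> 2 / (1 + \<delta>) ^ n" for N n
  proof (rule measure_tail_le_gf)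
    have "gf (ennreal (1 + \<delta>)) (occ \<mu> (replicate N at_origin) {#0 :: int ^ 'd#}) \<le> ennreal (1 + ?g 0)"
      by (rule gf_visits_le[where N = N, OF g(1) step]) auto
    also have "\<dots> \<le> ennreal 2"
    proof (rule ennreal_leI)
      show "1 + ?g 0 \<le> 2"
        using g(2)[of 0] \<epsilon>(2) by linarith
    qed
    finally show "gf (ennreal (1 + \<delta>)) (occ \<mu> (replicate N at_origin) {#0 :: int ^ 'd#}) \<le> ennreal 2" .
  qed (use \<delta> in auto)
  have "visit_tail TYPE('d) \<mu> n \<le> 2 * exp (- ln (1 + \<delta>) * real n)" for n
  proof -
    have "visit_tail TYPE('d) \<mu> n \<le> 2 / (1 + \<delta>) ^ n"
      by (rule visit_tail_leI) (rule tail)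
    also have "(1 + \<delta>) ^ n = exp (ln (1 + \<delta>) * real n)"
      using \<delta> by (simp add: exp_of_nat2_mult)
    finally show ?thesis
      by (simp only: divide_inverse exp_minus[symmetric] mult_minus_left)
  qed
  then show ?thesis
    using \<delta> by (intro that[of "ln (1 + \<delta>)"]) auto
qed

text \<open>A second visit requires the first particle to have a child.\<close>

lemma visit_tail_2_le: "visit_tail TYPE('d::finite) \<mu> 2 \<le> 1 - pmf \<mu> 0"
proof (rule visit_tail_leI)
  fix N :: nat assume "1 \<le> N"
  then obtain M where N: "N = Suc M"
    by (cases N) auto
  let ?q = "bind_pmf (pmf_of_set (neighbours 0)) (\<lambda>y :: int ^ 'd. occ \<mu> (replicate M at_origin) {#y#})"
  have "(\<lambda>k. at_origin (0 :: int ^ 'd) + k) -` {2..} = {1..}"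
    by (auto simp: at_origin_def)
  then have "emeasure (occ \<mu> (replicate N at_origin) {#0 :: int ^ 'd#}) {2..} = (\<integral>\<^sup>+k. emeasure (convpow k ?q) {1..} \<partial>\<mu>)"
    unfolding N replicate_Suc occ_single by simp
  also have "\<dots> \<le> (\<integral>\<^sup>+k. indicator (UNIV - {0}) k \<partial>\<mu>)"
  proof (rule nn_integral_mono)
    fix k
    show "emeasure (convpow k ?q) {1..} \<le> indicator (UNIV - {0}) k"
      by (cases k) (auto simp: indicator_def measure_pmf.emeasure_le_1 simp del: convpow.simps(2))
  qed
  also have "\<dots> = ennreal (1 - pmf \<mu> 0)"
    using measure_pmf.prob_compl[of "{0}" \<mu>]
    by (simp add: measure_pmf.emeasure_eq_measure measure_pmf_single)
  finally show "measure (occ \<mu> (replicate N at_origin) {#0 :: int ^ 'd#}) {2..} \<le> 1 - pmf \<mu> 0"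
    by (simp add: measure_pmf.emeasure_eq_measure pmf_le_1)
qed

text \<open>With probability \<open>1 - pmf \<mu> 0\<close> there is a first child; it moves to
  \<open>y\<close> with probability \<open>1/(2 d)\<close>, and all other children are
  ignored.\<close>

lemma occ_step_tail_ge:
  assumes "y \<in> neighbours (x :: int ^ 'd::finite)"
  shows "ennreal ((1 - pmf \<mu> 0) / (2 * real CARD('d))) * emeasure (occ \<mu> \<phi>s {#y#}) {n..} \<le>
    emeasure (occ \<mu> (\<phi> # \<phi>s) {#x#}) {\<phi> x + n..}"
proof -
  let ?q = "bind_pmf (pmf_of_set (neighbours x)) (\<lambda>y. occ \<mu> \<phi>s {#y#})"
  define E where "E = emeasure (occ \<mu> \<phi>s {#y#}) {n..}"
  have q: "ennreal (1 / (2 * real CARD('d))) * E \<le> emeasure ?q {n..}"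
  proof -
    have "ennreal (1 / (2 * real CARD('d))) * E = (\<integral>\<^sup>+z. E * indicator {y} z \<partial>pmf_of_set (neighbours x))"
      using assms
      by (simp add: nn_integral_cmult emeasure_pmf_single card_neighbours mult.commute)
    also have "\<dots> \<le> emeasure ?q {n..}"
      by (auto simp: E_def indicator_def intro!: nn_integral_mono)
    finally show ?thesis .
  qed
  have pow: "emeasure ?q {n..} \<le> emeasure (convpow (Suc k) ?q) {n..}" for k
  proof -
    have "emeasure (convpow (Suc k) ?q) {n..} =
        (\<integral>\<^sup>+a. \<integral>\<^sup>+b. indicator {n..} (a + b) \<partial>convpow k ?q \<partial>?q)"
      unfolding convpow.simps conv_def emeasure_bind_pmf emeasure_return_pmf ..
    also have "\<dots> \<ge> (\<integral>\<^sup>+a. \<integral>\<^sup>+b. indicator {n..} a \<partial>convpow k ?q \<partial>?q)"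
      by (intro nn_integral_mono) (auto simp: indicator_def)
    finally show ?thesis
      by (simp only: nn_integral_const space_measure_pmf emeasure_pmf_UNIV mult_1_right nn_integral_indicator sets_measure_pmf UNIV_I)
  qed
  have "ennreal ((1 - pmf \<mu> 0) / (2 * real CARD('d))) * E = ennreal (1 - pmf \<mu> 0) * (ennreal (1 / (2 * real CARD('d))) * E)"
    by (simp add: ennreal_mult[symmetric] pmf_le_1 mult.assoc[symmetric])
  also have "\<dots> \<le> ennreal (1 - pmf \<mu> 0) * emeasure ?q {n..}"
    by (intro mult_left_mono q) simp
  also have "\<dots> = (\<integral>\<^sup>+k. emeasure ?q {n..} * indicator (UNIV - {0}) k \<partial>\<mu>)"
    using measure_pmf.prob_compl[of "{0}" \<mu>]
    by (simp only: nn_integral_cmult_indicator sets_measure_pmf UNIV_I measure_pmf.emeasure_eq_measure[of \<mu>] space_measure_pmf measure_pmf_single)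
      (simp add: mult.commute)
  also have "\<dots> \<le> (\<integral>\<^sup>+k. emeasure (convpow k ?q) {n..} \<partial>\<mu>)"
  proof (rule nn_integral_mono)
    fix k
    show "emeasure ?q {n..} * indicator (UNIV - {0}) k \<le> emeasure (convpow k ?q) {n..}"
    proof (cases k)
      case (Suc j)
      then show ?thesis
        using pow[of j] by (simp only: Suc) (simp del: convpow.simps emeasure_bind_pmf)
    qed simp
  qed
  also have "\<dots> = emeasure (occ \<mu> (\<phi> # \<phi>s) {#x#}) {\<phi> x + n..}"
  proof -
    have "(\<lambda>k. \<phi> x + k) -` {\<phi> x + n..} = {n..}"
      by auto
    then show ?thesis
      unfolding occ_single by simp
  qed
  finally show ?thesis
    by (simp add: E_def)
qed

text \<open>Follow one line of descent going back and forth between the origin and a neighbour: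
  every further visit costs two generations, each of probability at least \<open>\<rho>\<close>. No
  assumption on the dimension enters.\<close>

theorem visit_tail_lower_exp:
  obtains b where "0 < b" "\<And>n. exp (- b * real n) \<le> visit_tail TYPE('d::finite) \<mu> n"
proof -
  define \<rho> where "\<rho> = (1 - pmf \<mu> 0) / (2 * real CARD('d))"
  have "measure \<mu> {2..} \<le> measure \<mu> (UNIV - {0})"
    by (intro measure_pmf.finite_measure_mono) auto
  also have "\<dots> = 1 - pmf \<mu> 0"
    using measure_pmf.prob_compl[of "{0}" \<mu>] by (simp add: measure_pmf_single)
  finally have less: "0 < 1 - pmf \<mu> 0"
    using offspring_ge_2 by linarith
  have "1 \<le> real CARD('d)"
    by (simp add: Suc_le_eq)
  then have "1 - pmf \<mu> 0 \<le> 2 * real CARD('d)"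
    using pmf_nonneg[of \<mu> 0] by linarith
  then have \<rho>: "0 < \<rho>" "\<rho> \<le> 1"
    using less by (simp_all add: \<rho>_def)
  have "ennreal ((\<rho>\<^sup>2) ^ k) \<le> emeasure (occ \<mu> (replicate (2 * k) at_origin) {#0 :: int ^ 'd#}) {k..}" for k
  proof (induction k)
    case 0
    then show ?case by simp
  next
    case (Suc k)
    let ?\<phi>s = "replicate (2 * k) (at_origin :: int ^ 'd \<Rightarrow> nat)"
    let ?y = "axis undefined 1 :: int ^ 'd"
    have y: "?y \<in> neighbours 0" "0 \<in> neighbours ?y"
      using axis_neighbours(1)[of 0 undefined] axis_neighbours(2)[of ?y undefined] by auto
    have "ennreal ((\<rho>\<^sup>2) ^ Suc k) = ennreal \<rho> * (ennreal \<rho> * ennreal ((\<rho>\<^sup>2) ^ k))"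
      using \<rho> by (simp add: ennreal_mult[symmetric] power2_eq_square mult.assoc)
    also have "\<dots> \<le> ennreal \<rho> * (ennreal \<rho> * emeasure (occ \<mu> ?\<phi>s {#0#}) {k..})"
      by (intro mult_left_mono Suc.IH) auto
    also have "\<dots> \<le> ennreal \<rho> * emeasure (occ \<mu> (at_origin # ?\<phi>s) {#?y#}) {at_origin ?y + k..}"
      unfolding \<rho>_def by (intro mult_left_mono occ_step_tail_ge y) auto
    also have "\<dots> \<le> ennreal \<rho> * emeasure (occ \<mu> (at_origin # ?\<phi>s) {#?y#}) {k..}"
      by (intro mult_left_mono emeasure_mono) auto
    also have "\<dots> \<le> emeasure (occ \<mu> (at_origin # at_origin # ?\<phi>s) {#0#}) {at_origin (0 :: int ^ 'd) + k..}"
      unfolding \<rho>_def by (intro occ_step_tail_ge y)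
    also have "at_origin (0 :: int ^ 'd) + k = Suc k"
      by (simp add: at_origin_def)
    finally show ?case
      by (simp del: occ.simps)
  qed
  then have "(\<rho>\<^sup>2) ^ k \<le> measure (occ \<mu> (replicate (2 * k) at_origin) {#0 :: int ^ 'd#}) {k..}" for k
    by (simp add: measure_pmf.emeasure_eq_measure)
  then have ge: "(\<rho>\<^sup>2) ^ k \<le> visit_tail TYPE('d) \<mu> k" for k
    using visit_tail_ge[where 'd = 'd, of \<mu> "2 * k" k] by (meson order_trans)
  \<comment> \<open>The added 1 makes \<open>b\<close> positive from \<open>\<rho> \<le> 1\<close>
    alone.\<close>
  define b where "b = 1 - ln (\<rho>\<^sup>2)"
  have "exp (- b * real n) \<le> visit_tail TYPE('d) \<mu> n" for n
  proof -
    have "exp (- b * real n) \<le> exp (ln (\<rho>\<^sup>2) * real n)"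
      by (simp add: b_def mult_right_mono)
    also have "\<dots> = (\<rho>\<^sup>2) ^ n"
      using \<rho> by (simp add: exp_of_nat2_mult)
    finally show ?thesis
      using ge[of n] by linarith
  qed
  moreover have "ln (\<rho>\<^sup>2) \<le> 0"
    using \<rho> by (simp add: power_le_one)
  then have "0 < b"
    by (simp add: b_def)
  ultimately show ?thesis
    using that by blast
qed

theorem visit_tail_high_dim:
  assumes "5 \<le> CARD('d::finite)"
  shows "exp_minus_Theta (visit_tail TYPE('d) \<mu>) (\<lambda>n. real n)"
proof -
  obtain a where a: "0 < a" "\<And>n. visit_tail TYPE('d) \<mu> n \<le> 2 * exp (- a * real n)"
    using visit_tail_upper_high_dim[OF assms] by blast
  obtain b where b: "0 < b" "\<And>n. exp (- b * real n) \<le> visit_tail TYPE('d) \<mu> n"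
    using visit_tail_lower_exp[where 'd = 'd] by blast
  show ?thesis
  proof (rule exp_minus_ThetaI)
    show "visit_tail TYPE('d) \<mu> n \<le> 2 * exp (- a * real n)" for n
      by (rule a)
    show "1 * exp (- b * real n) \<le> visit_tail TYPE('d) \<mu> n" for n
      using b by simp
    show "visit_tail TYPE('d) \<mu> n \<le> 1 - pmf \<mu> 0" if "2 \<le> n" for n
      using visit_tail_antimono[OF that, where 'd = 'd, of \<mu>] visit_tail_2_le[where 'd = 'd] by linarith
  qed (use a(1) b(1) offspring_0 in auto)
qed

end

section \<open>Upper bound in dimension four\<close>

text \<open>In dimension four the leading terms cancel, and superharmonicity without a gain of order
  \<open>h^2\<close> is all that is claimed.\<close>

lemma ravg_inv_sq_dim4:
  assumes "CARD('d) = 4"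
  shows "ravg inv_sq (x :: int ^ 'd::finite) \<le> inv_sq x"
proof -
  define s where "s = sqnorm x"
  define A where "A = s + 31"
  have s: "0 \<le> s"
    by (simp add: s_def)
  have A: "31 \<le> A" "s = A - 31"
    using s by (auto simp: A_def)
  have A2: "0 < A\<^sup>2 - 4 * s"
  proof -
    have "A\<^sup>2 - 4 * s = s * s + 58 * s + 961"
      by (simp add: A_def power2_eq_square algebra_simps)
    also have "0 < \<dots>"
      using s by (intro add_nonneg_pos add_nonneg_nonneg mult_nonneg_nonneg) auto
    finally show ?thesis .
  qed
  have "s * (A - 1) \<le> A\<^sup>2 - 4 * s"
    using A unfolding A(2) by (simp add: power2_eq_square algebra_simps)
  then have 1: "s / (A\<^sup>2 - 4 * s) \<le> 1 / (A - 1)"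
    using A A2 by (subst pos_divide_le_eq, simp, subst times_divide_eq_left, subst pos_le_divide_eq) auto
  have "ravg inv_sq x \<le> 1 / A + 4 * s / real CARD('d) / (A * (A\<^sup>2 - 4 * s))"
    unfolding s_def A_def by (rule ravg_inv_sq_le)
  also have "\<dots> = 1 / A + s / (A\<^sup>2 - 4 * s) / A"
    using assms by simp
  also have "\<dots> \<le> 1 / A + 1 / (A - 1) / A"
    using 1 A by (intro add_left_mono divide_right_mono) auto
  also have "\<dots> = 1 / (A - 1)"
    using A by (simp add: field_simps)
  finally show ?thesis
    by (simp add: inv_sq_def A_def s_def add.commute)
qed

text \<open>The sign \<open>\<sigma>\<close> treats both directions of a coordinate at once:
  \<open>1 + 2 * \<sigma> * x_i\<close> is the change of the squared norm. The factor 3 keeps all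
  neighbours in the range where \<open>div_log_tangent\<close> applies.\<close>

lemma inv_sq_neighbour:
  fixes x :: "int ^ 'd::finite"
  assumes "y = x + axis i 1 \<and> \<sigma> = 1 \<or> y = x - axis i 1 \<and> \<sigma> = - 1"
  shows "inv_sq x / 3 \<le> inv_sq y" "inv_sq y \<le> 3 * inv_sq x"
    and "(1 + 2 * \<sigma> * real_of_int (x $ i))\<^sup>2 * inv_sq x ^ 4 / 9 \<le> (inv_sq y - inv_sq x)\<^sup>2"
proof -
  define s where "s = sqnorm x"
  define t where "t = \<sigma> * real_of_int (x $ i)"
  define u where "u = s + 30"
  define v where "v = u + 1 + 2 * t"
  have s: "0 \<le> s" "30 \<le> u"
    by (auto simp: s_def u_def)
  have ts: "t\<^sup>2 \<le> s"
    using assms sqnorm_component_le[of x i] by (auto simp: t_def s_def power_mult_distrib)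
  have y: "inv_sq y = 1 / v" "inv_sq x = 1 / u"
    using assms by (auto simp: inv_sq_def sqnorm_add_axis u_def v_def s_def t_def)
  have "0 \<le> (t - 1)\<^sup>2" "0 \<le> (t + 3 / 2)\<^sup>2"
    by simp_all
  then have "2 * t \<le> s + 1" "- (3 * t) \<le> s + 9 / 4"
    using ts by (simp_all add: power2_eq_square algebra_simps)
  then have v: "v \<le> 3 * u" "u \<le> 3 * v" "0 < v"
    using s by (auto simp: v_def u_def)
  show "inv_sq x / 3 \<le> inv_sq y" "inv_sq y \<le> 3 * inv_sq x"
    unfolding y using v s by (auto simp: field_simps)
  have "inv_sq y - inv_sq x = - (1 + 2 * t) / (u * v)"
    unfolding y using v s by (simp add: v_def field_simps)
  then have "(inv_sq y - inv_sq x)\<^sup>2 = (1 + 2 * t)\<^sup>2 / (u * v)\<^sup>2"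
    by (simp only: power_divide power2_minus)
  also have "\<dots> \<ge> (1 + 2 * t)\<^sup>2 / (u * (3 * u))\<^sup>2"
    using v s by (intro divide_left_mono power_mono mult_left_mono mult_pos_pos zero_less_power) auto
  also have "(1 + 2 * t)\<^sup>2 / (u * (3 * u))\<^sup>2 = (1 + 2 * \<sigma> * real_of_int (x $ i))\<^sup>2 * inv_sq x ^ 4 / 9"
    unfolding y by (simp add: t_def power_mult_distrib power_divide power2_eq_square power4_eq_xxxx mult_ac)
  finally show "(1 + 2 * \<sigma> * real_of_int (x $ i))\<^sup>2 * inv_sq x ^ 4 / 9 \<le> (inv_sq y - inv_sq x)\<^sup>2" .
qed

text \<open>The squared gradient is of order \<open>(1 + sqnorm x) * h^4\<close>, and
  \<open>30 * (1 + sqnorm x) * h \<ge> 1\<close>; the summand 1 keeps the estimate valid at the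
  origin.\<close>

lemma ravg_inv_sq_variance:
  assumes "CARD('d) = 4"
  shows "inv_sq x ^ 3 / 270 \<le> ravg (\<lambda>y. (inv_sq y - inv_sq x)\<^sup>2) (x :: int ^ 'd::finite)"
proof -
  define h where "h = inv_sq x"
  have "(\<Sum>i\<in>UNIV. (1 + 2 * real_of_int (x $ i))\<^sup>2 * h ^ 4 / 9 + (1 - 2 * real_of_int (x $ i))\<^sup>2 * h ^ 4 / 9) \<le>
      (\<Sum>i\<in>UNIV. (inv_sq (x + axis i 1) - inv_sq x)\<^sup>2 + (inv_sq (x - axis i 1) - inv_sq x)\<^sup>2)"
    using inv_sq_neighbour(3)[of "x + axis i 1" x i 1 for i] inv_sq_neighbour(3)[of "x - axis i 1" x i "- 1" for i]
    by (intro sum_mono add_mono) (auto simp: h_def)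
  also have "(\<lambda>i. (1 + 2 * real_of_int (x $ i))\<^sup>2 * h ^ 4 / 9 + (1 - 2 * real_of_int (x $ i))\<^sup>2 * h ^ 4 / 9) =
      (\<lambda>i. (2 + 8 * (real_of_int (x $ i))\<^sup>2) * (h ^ 4 / 9))"
    by (auto simp: fun_eq_iff power2_eq_square field_simps)
  also have "(\<Sum>i\<in>UNIV. (2 + 8 * (real_of_int (x $ i))\<^sup>2) * (h ^ 4 / 9)) = (8 + 8 * sqnorm x) * (h ^ 4 / 9)"
    unfolding sum_distrib_right[symmetric] using assms
    by (simp add: sum.distrib sum_distrib_left[symmetric] sqnorm_def)
  finally have "(8 + 8 * sqnorm x) * (h ^ 4 / 9) / 8 \<le>
      (\<Sum>i\<in>UNIV. (inv_sq (x + axis i 1) - inv_sq x)\<^sup>2 + (inv_sq (x - axis i 1) - inv_sq x)\<^sup>2) / 8"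
    by (rule divide_right_mono) simp
  then have "(8 + 8 * sqnorm x) * (h ^ 4 / 9) / 8 \<le> ravg (\<lambda>y. (inv_sq y - inv_sq x)\<^sup>2) x"
    unfolding ravg_def by (simp add: assms)
  moreover have "h ^ 3 / 270 \<le> (8 + 8 * sqnorm x) * (h ^ 4 / 9) / 8"
  proof -
    have "0 < h"
      unfolding h_def by (rule inv_sq_pos)
    have "1 = (sqnorm x + 30) * h"
      by (simp add: h_def inv_sq_def add_nonneg_eq_0_iff)
    also have "\<dots> \<le> (30 * (1 + sqnorm x)) * h"
      using \<open>0 < h\<close> by (intro mult_right_mono) auto
    finally have "h ^ 3 / 270 * 1 \<le> h ^ 3 / 270 * (30 * (1 + sqnorm x) * h)"
      using \<open>0 < h\<close> by (intro mult_left_mono) auto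
    then show ?thesis
      by (simp add: power3_eq_cube power4_eq_xxxx algebra_simps)
  qed
  ultimately show ?thesis
    by (simp add: h_def)
qed

text \<open>The second derivative of \<open>w / (T + ln w)\<close> is
  \<open>-(1/w) * (1/L^2 - 2/L^3)\<close> with \<open>L = T + ln w\<close>, at most
  \<open>-1/(2 w L^2)\<close> once \<open>L \<ge> 4\<close>. On \<open>[u/3, 3u]\<close> this is at
  most \<open>-m\<close>: there \<open>L\<close> lies between 4 and \<open>2 * l\<close>, because
  \<open>l \<ge> 6\<close> and \<open>ln 3 \<le> 2\<close>. Hence \<open>f\<close>, the negative of
  the function minus a parabola, is convex and lies above its tangent at \<open>u\<close>.\<close>

lemma div_log_tangent:
  fixes u v T :: real
  defines "l \<equiv> T + ln u"
  assumes u: "0 < u" and l: "6 \<le> l" and v: "u / 3 \<le> v" "v \<le> 3 * u"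
  shows "v / (T + ln v) \<le> u / l + (1 / l - 1 / l\<^sup>2) * (v - u) - (v - u)\<^sup>2 / (48 * u * l\<^sup>2)"
proof -
  define m where "m = 1 / (24 * u * l\<^sup>2)"
  define S where "S = {u / 3..3 * u}"
  define f where "f = (\<lambda>w. - (w / (T + ln w)) - m / 2 * (w - u)\<^sup>2)"
  define f' where "f' = (\<lambda>w. - (1 / (T + ln w) - 1 / (T + ln w)\<^sup>2) - m * (w - u))"
  define f'' where "f'' = (\<lambda>w. (1 / w) * (1 / (T + ln w)\<^sup>2 - 2 / (T + ln w) ^ 3) - m)"
  have sq: "((\<lambda>w. m / 2 * (w - u)\<^sup>2) has_real_derivative m * (w - u)) (at w)" for w
    by (auto intro!: derivative_eq_intros)
  have ln3: "ln 3 \<le> (2 :: real)"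
    using ln_le_minus_one[of 3] by simp
  have S: "0 < w \<and> 4 \<le> T + ln w \<and> T + ln w \<le> 2 * l" if "w \<in> S" for w
  proof -
    have w: "u / 3 \<le> w" "w \<le> 3 * u"
      using that by (auto simp: S_def)
    then have "0 < w"
      using u by (meson divide_pos_pos less_le_trans zero_less_numeral)
    have "ln (u / 3) \<le> ln w"
      using w u by (intro ln_mono) auto
    then have "ln u - ln 3 \<le> ln w"
      using u by (simp add: ln_div)
    moreover have "ln w \<le> ln (3 * u)"
      using w u \<open>0 < w\<close> by (intro ln_mono) auto
    then have "ln w \<le> ln 3 + ln u"
      using u by (simp add: ln_mult)
    ultimately show ?thesis
      using \<open>0 < w\<close> ln3 l by (auto simp: l_def)
  qed
  have "convex_on S f"
  proof (rule f''_ge0_imp_convex)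
    show "convex S"
      by (simp add: S_def)
    fix w assume wS: "w \<in> S"
    define L where "L = T + ln w"
    have w: "0 < w" "4 \<le> L" "L \<le> 2 * l" "w \<le> 3 * u"
      using S[OF wS] wS by (auto simp: L_def S_def)
    have "((\<lambda>w. w / (T + ln w)) has_real_derivative (1 * L - w * (1 / w)) / (L * L)) (at w)"
      unfolding L_def using w by (auto intro!: derivative_eq_intros simp: L_def)
    also have "(1 * L - w * (1 / w)) / (L * L) = 1 / L - 1 / L\<^sup>2"
      using w by (simp add: power2_eq_square field_simps)
    finally have D: "((\<lambda>w. w / (T + ln w)) has_real_derivative 1 / L - 1 / L\<^sup>2) (at w)" .
    show "(f has_real_derivative f' w) (at w)"
      unfolding f_def f'_def L_def[symmetric] by (rule DERIV_diff[OF DERIV_minus[OF D] sq])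
    have g: "((\<lambda>w. T + ln w) has_real_derivative 1 / w) (at w)"
      using w by (auto intro!: derivative_eq_intros)
    have "((\<lambda>w. 1 / (T + ln w)) has_real_derivative (0 * (T + ln w) - 1 * (1 / w)) / ((T + ln w) * (T + ln w))) (at w)"
      using w by (intro DERIV_divide g DERIV_const) (simp add: L_def)
    then have g1: "((\<lambda>w. 1 / (T + ln w)) has_real_derivative - (1 / w / L\<^sup>2)) (at w)"
      by (simp add: L_def power2_eq_square)
    have "((\<lambda>w. (1 / (T + ln w))\<^sup>2) has_real_derivative 2 * (- (1 / w / L\<^sup>2) * (1 / (T + ln w)))) (at w)"
      using DERIV_power[OF g1, of 2] by simp
    moreover have "(\<lambda>w. (1 / (T + ln w))\<^sup>2) = (\<lambda>w. 1 / (T + ln w)\<^sup>2)"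
      by (simp add: power_one_over)
    ultimately have g2: "((\<lambda>w. 1 / (T + ln w)\<^sup>2) has_real_derivative 2 * (- (1 / w / L\<^sup>2) * (1 / L))) (at w)"
      by (simp only: L_def)
    have "((\<lambda>w. m * (w - u)) has_real_derivative m) (at w)"
      by (auto intro!: derivative_eq_intros)
    then have "(f' has_real_derivative - (- (1 / w / L\<^sup>2) - 2 * (- (1 / w / L\<^sup>2) * (1 / L))) - m) (at w)"
      unfolding f'_def by (intro DERIV_diff DERIV_minus g1 g2)
    moreover have "- (- (1 / w / L\<^sup>2) - 2 * (- (1 / w / L\<^sup>2) * (1 / L))) - m = f'' w"
      unfolding f''_def L_def[symmetric] by (simp add: right_diff_distrib power2_eq_square power3_eq_cube)
    ultimately show "(f' has_real_derivative f'' w) (at w)"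
      by simp
    have "m \<le> 1 / (2 * w * L\<^sup>2)"
    proof -
      have "2 * w * L\<^sup>2 \<le> 2 * (3 * u) * (2 * l)\<^sup>2"
        using w u by (intro mult_mono power_mono) auto
      then have "1 / (2 * (3 * u) * (2 * l)\<^sup>2) \<le> 1 / (2 * w * L\<^sup>2)"
        using w by (intro divide_left_mono) auto
      then show ?thesis
        by (simp add: m_def power_mult_distrib)
    qed
    also have "\<dots> \<le> (1 / w) * (1 / L\<^sup>2 - 2 / L ^ 3)"
    proof -
      have "(1 / w) * (1 / L\<^sup>2 - 2 / L ^ 3) - 1 / (2 * w * L\<^sup>2) = (L - 4) / (2 * w * L ^ 3)"
        using w by (simp add: field_simps power2_eq_square power3_eq_cube)
      also have "\<dots> \<ge> 0"
        using w by (intro divide_nonneg_nonneg mult_nonneg_nonneg) auto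
      finally show ?thesis by simp
    qed
    finally show "0 \<le> f'' w"
      by (simp add: f''_def L_def)
  qed
  have "f v - f u \<ge> f' u * (v - u)"
  proof (rule convex_on_imp_above_tangent[OF \<open>convex_on S f\<close>])
    show "connected S"
      by (simp add: S_def)
    show "u \<in> interior S"
      using u by (simp add: S_def)
    show "v \<in> S"
      using v by (simp add: S_def)
    have w: "0 < u" "6 \<le> T + ln u"
      using u l by (auto simp: l_def)
    have "((\<lambda>w. w / (T + ln w)) has_real_derivative (1 * (T + ln u) - u * (1 / u)) / ((T + ln u) * (T + ln u))) (at u)"
      using w by (auto intro!: derivative_eq_intros)
    also have "(1 * (T + ln u) - u * (1 / u)) / ((T + ln u) * (T + ln u)) = 1 / (T + ln u) - 1 / (T + ln u)\<^sup>2"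
    proof -
      have "(1 * a - u * (1 / u)) / (a * a) = 1 / a - 1 / a\<^sup>2" if "a \<noteq> 0" for a
        using w(1) that by (simp add: power2_eq_square field_simps)
      then show ?thesis
        using w(2) by simp
    qed
    finally have D: "((\<lambda>w. w / (T + ln w)) has_real_derivative 1 / (T + ln u) - 1 / (T + ln u)\<^sup>2) (at u)" .
    have "(f has_real_derivative f' u) (at u)"
      unfolding f_def f'_def by (rule DERIV_diff[OF DERIV_minus[OF D] sq])
    then show "(f has_real_derivative f' u) (at u within S)"
      by (rule has_field_derivative_at_within)
  qed
  then show ?thesis
    by (simp add: f_def f'_def l_def[symmetric] m_def algebra_simps)
qed

lemma ravg_add: "ravg (\<lambda>y. f y + g y) x = ravg f x + ravg g x"
  unfolding ravg_def by (simp add: sum.distrib add_divide_distrib[symmetric] ac_simps)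

lemma ravg_const: "ravg (\<lambda>_. c) x = c"
  unfolding ravg_def by simp

lemma ravg_mono: "(\<And>y. y \<in> neighbours x \<Longrightarrow> f y \<le> g y) \<Longrightarrow> ravg f x \<le> ravg g x"
  unfolding ravg_def by (intro divide_right_mono sum_mono add_mono) (auto simp: axis_neighbours)

text \<open>The quadratic term of the tangent estimate, averaged with
  \<open>ravg_inv_sq_variance\<close>, gives the gain, with \<open>12960 = 48 * 270\<close>. The
  linear term is kept because it is the only excess available at the origin.\<close>

lemma ravg_div_log_inv_sq:
  fixes x :: "int ^ 'd::finite" and T :: real
  defines "l \<equiv> T + ln (inv_sq x)"
  assumes "CARD('d) = 4" and l: "6 \<le> l"
  shows "ravg (\<lambda>y. inv_sq y / (T + ln (inv_sq y))) x \<le>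
    inv_sq x / l - (1 / (2 * l)) * (inv_sq x - ravg inv_sq x) - (inv_sq x)\<^sup>2 / (12960 * l\<^sup>2)"
proof -
  define h where "h = inv_sq x"
  define a where "a = 1 / l - 1 / l\<^sup>2"
  define b where "b = 1 / (48 * h * l\<^sup>2)"
  have h: "0 < h"
    unfolding h_def by (rule inv_sq_pos)
  have b: "0 \<le> b"
    using h by (simp add: b_def)
  have a: "1 / (2 * l) \<le> a"
  proof -
    have "a - 1 / (2 * l) = (l - 2) / (2 * l\<^sup>2)"
      using l by (simp add: a_def field_simps power2_eq_square)
    also have "\<dots> \<ge> 0"
      using l by (intro divide_nonneg_nonneg) auto
    finally show ?thesis by simp
  qed
  have "ravg (\<lambda>y. inv_sq y / (T + ln (inv_sq y))) x \<le>
      ravg (\<lambda>y. (h / l - a * h) + (a * inv_sq y + (- b) * (inv_sq y - inv_sq x)\<^sup>2)) x"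
  proof (rule ravg_mono)
    fix y assume "y \<in> neighbours x"
    then obtain i \<sigma> where "y = x + axis i 1 \<and> \<sigma> = (1::real) \<or> y = x - axis i 1 \<and> \<sigma> = - 1"
      by (auto simp: neighbours_def)
    note inv_sq_neighbour(1,2)[OF this]
    then have "inv_sq y / (T + ln (inv_sq y)) \<le> h / l + a * (inv_sq y - h) - (inv_sq y - h)\<^sup>2 / (48 * h * l\<^sup>2)"
      using div_log_tangent[of h T "inv_sq y"] h l by (simp add: h_def l_def a_def)
    then show "inv_sq y / (T + ln (inv_sq y)) \<le> (h / l - a * h) + (a * inv_sq y + (- b) * (inv_sq y - inv_sq x)\<^sup>2)"
      by (simp add: b_def h_def algebra_simps)
  qed
  also have "\<dots> = h / l - a * (h - ravg inv_sq x) - b * ravg (\<lambda>y. (inv_sq y - inv_sq x)\<^sup>2) x"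
    unfolding ravg_add ravg_cmult ravg_const by (simp add: algebra_simps)
  also have "\<dots> \<le> h / l - (1 / (2 * l)) * (h - ravg inv_sq x) - b * (inv_sq x ^ 3 / 270)"
    using a b ravg_inv_sq_dim4[OF assms(2), of x] ravg_inv_sq_variance[OF assms(2), of x]
    by (intro diff_mono mult_left_mono mult_right_mono order_refl) (auto simp: h_def)
  also have "b * (inv_sq x ^ 3 / 270) = h\<^sup>2 / (12960 * l\<^sup>2)"
    using h by (simp add: b_def h_def power2_eq_square power3_eq_cube)
  finally show ?thesis
    by (simp add: h_def)
qed

lemma ravg_cong: "(\<And>y. y \<in> neighbours x \<Longrightarrow> f y = g y) \<Longrightarrow> ravg f x = ravg g x"
  by (intro antisym ravg_mono) auto

context critical_offspring
begin

lemma truncated_tail_dim4: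
  assumes "CARD('d::finite) = 4"
  obtains c where "0 < c" "c \<le> 1"
    "\<And>N n. measure (occ \<mu> (replicate N at_origin) {#0 :: int ^ 'd#}) {n..} \<le>
      2 / (1 + c / (6 + ln ((real N + 1)\<^sup>2 + 30))) ^ n"
proof -
  obtain A t0 where A: "0 < A" "0 < t0"
    and gf: "\<And>t. 0 \<le> t \<Longrightarrow> t \<le> t0 \<Longrightarrow> gf (ennreal (1 + t)) \<mu> \<le> ennreal (1 + t + A * t\<^sup>2)"
    using gf_offspring_le by blast
  \<comment> \<open>\<open>A * \<epsilon> \<le> 1/12960\<close> lets the concavity gain pay for the
    whole quadratic term.\<close>
  define \<epsilon> where "\<epsilon> = min 1 (min t0 (1 / (12960 * A)))"
  have \<epsilon>: "0 < \<epsilon>" "\<epsilon> \<le> 1" "\<epsilon> \<le> t0" "A * \<epsilon> \<le> 1 / 12960"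
  proof -
    show "0 < \<epsilon>" "\<epsilon> \<le> 1" "\<epsilon> \<le> t0"
      using A by (auto simp: \<epsilon>_def)
    have "\<epsilon> \<le> 1 / (12960 * A)"
      by (simp add: \<epsilon>_def)
    then show "A * \<epsilon> \<le> 1 / 12960"
      using A by (simp add: field_simps)
  qed
  \<comment> \<open>At the origin the linear term leaves \<open>\<epsilon> / (2 * k) * (1/30 - 1/31)
    = \<epsilon> / (1860 * k)\<close>, where \<open>k \<le> T\<close>.\<close>
  define c where "c = \<epsilon> / (1860 * (2 + A))"
  have c: "0 < c" "c \<le> 1" "c * (2 + A) = \<epsilon> / 1860"
  proof -
    show "0 < c"
      using \<epsilon> A by (simp add: c_def)
    show "c * (2 + A) = \<epsilon> / 1860"
      using A by (simp add: c_def field_simps)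
    then have "c * 1 \<le> 1"
      using \<epsilon> A \<open>0 < c\<close> mult_left_mono[of 1 "2 + A" c] by linarith
    then show "c \<le> 1" by simp
  qed
  have "measure (occ \<mu> (replicate N at_origin) {#0 :: int ^ 'd#}) {n..} \<le>
      2 / (1 + c / (6 + ln ((real N + 1)\<^sup>2 + 30))) ^ n" for N n
  proof -
    \<comment> \<open>Large enough that \<open>T + ln (inv_sq x) \<ge> 6\<close> on the ball of
      radius \<open>N + 1\<close>, which contains all neighbours of points of the ball of radius
      \<open>N\<close>.\<close>
    define T where "T = 6 + ln ((real N + 1)\<^sup>2 + 30)"
    have T: "6 \<le> T"
    proof -
      have "0 \<le> ln ((real N + 1)\<^sup>2 + 30)"
        by (intro ln_ge_zero) (simp add: add_increasing)
      then show ?thesis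
        by (simp add: T_def)
    qed
    define \<delta> where "\<delta> = c / T"
    have \<delta>: "0 \<le> \<delta>" "\<delta> * (2 + A) = \<epsilon> / (1860 * T)"
    proof -
      show "0 \<le> \<delta>"
        using c T by (simp add: \<delta>_def)
      have "\<delta> * (2 + A) = (c * (2 + A)) / T"
        by (simp add: \<delta>_def)
      then show "\<delta> * (2 + A) = \<epsilon> / (1860 * T)"
        unfolding c(3) by simp
    qed
    define l where "l = (\<lambda>x :: int ^ 'd. T + ln (inv_sq x))"
    have l: "6 \<le> l x" "l x \<le> T" if "sqrt (sqnorm x) \<le> real N + 1" for x
    proof -
      have "(sqrt (sqnorm x))\<^sup>2 \<le> (real N + 1)\<^sup>2"
        using that by (intro power_mono) auto
      then have "sqnorm x \<le> (real N + 1)\<^sup>2"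
        by simp
      then have "ln (sqnorm x + 30) \<le> ln ((real N + 1)\<^sup>2 + 30)"
        by (intro ln_mono) (auto intro: add_nonneg_pos)
      moreover have "ln (inv_sq x) = - ln (sqnorm x + 30)"
        by (simp add: inv_sq_def ln_div add_nonneg_pos)
      moreover have "0 \<le> ln (sqnorm x + 30)"
        by (intro ln_ge_zero) simp
      ultimately show "6 \<le> l x" "l x \<le> T"
        by (auto simp: l_def T_def)
    qed
    \<comment> \<open>Outside the ball \<open>l x\<close> need not be positive. Setting
      \<open>g\<close> to 0 there keeps it nonnegative and does not affect averages at points within
      distance \<open>N\<close>.\<close>
    define g where "g = (\<lambda>x. if sqrt (sqnorm x) \<le> real N + 1 then \<epsilon> * (inv_sq x / l x) else 0)"
    have g0: "0 \<le> g x" for x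
      unfolding g_def using \<epsilon> inv_sq_pos[of x] l(1)[of x] by (auto intro!: mult_nonneg_nonneg divide_nonneg_nonneg)
    have step: "ennreal (1 + \<delta>) ^ at_origin x * gf (ennreal (1 + ravg g x)) \<mu> \<le> ennreal (1 + g x)"
      if x: "sqrt (sqnorm x) \<le> real N" for x
    proof -
      define h where "h = inv_sq x"
      define k where "k = l x"
      define t where "t = ravg g x"
      have k: "6 \<le> k" "k \<le> T"
        using l[of x] x by (auto simp: k_def)
      have h: "0 < h" "h \<le> 1 / 30"
        unfolding h_def by (rule inv_sq_pos inv_sq_le)+
      have gx: "g x = \<epsilon> * (h / k)"
        using x by (simp add: g_def h_def k_def)
      have "t = ravg (\<lambda>y. \<epsilon> * (inv_sq y / (T + ln (inv_sq y)))) x"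
        unfolding t_def
      proof (rule ravg_cong)
        fix y assume "y \<in> neighbours x"
        then show "g y = \<epsilon> * (inv_sq y / (T + ln (inv_sq y)))"
          using sqrt_sqnorm_neighbour[of y x] x by (simp add: g_def l_def)
      qed
      then have t1: "t \<le> \<epsilon> * (h / k - 1 / (2 * k) * (h - ravg inv_sq x) - h\<^sup>2 / (12960 * k\<^sup>2))"
      proof -
        assume "t = ravg (\<lambda>y. \<epsilon> * (inv_sq y / (T + ln (inv_sq y)))) x"
        also have "\<dots> = \<epsilon> * ravg (\<lambda>y. inv_sq y / (T + ln (inv_sq y))) x"
          by (rule ravg_cmult)
        also have "\<dots> \<le> \<epsilon> * (h / k - 1 / (2 * k) * (h - ravg inv_sq x) - h\<^sup>2 / (12960 * k\<^sup>2))"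
        proof (rule mult_left_mono)
          show "ravg (\<lambda>y. inv_sq y / (T + ln (inv_sq y))) x \<le>
              h / k - 1 / (2 * k) * (h - ravg inv_sq x) - h\<^sup>2 / (12960 * k\<^sup>2)"
            unfolding h_def k_def l_def
            by (rule ravg_div_log_inv_sq[OF assms]) (use k in \<open>simp add: k_def l_def\<close>)
        qed (use \<epsilon> in simp)
        finally show ?thesis .
      qed
      have t0: "0 \<le> t"
        unfolding t_def by (rule ravg_nonneg) (rule g0)
      have hr: "0 \<le> 1 / (2 * k) * (h - ravg inv_sq x)"
        using k ravg_inv_sq_dim4[OF assms, of x] by (intro mult_nonneg_nonneg) (auto simp: h_def)
      have t2: "t \<le> \<epsilon> * (h / k)"
      proof -
        have "h / k - 1 / (2 * k) * (h - ravg inv_sq x) - h\<^sup>2 / (12960 * k\<^sup>2) \<le> h / k"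
        proof -
          have "0 \<le> h\<^sup>2 / (12960 * k\<^sup>2)"
            by simp
          with hr show ?thesis
            by linarith
        qed
        then have "\<epsilon> * (h / k - 1 / (2 * k) * (h - ravg inv_sq x) - h\<^sup>2 / (12960 * k\<^sup>2)) \<le> \<epsilon> * (h / k)"
          using \<epsilon> by (intro mult_left_mono) auto
        with t1 show ?thesis
          by linarith
      qed
      have "A * t\<^sup>2 \<le> A * (\<epsilon> * (h / k))\<^sup>2"
        using t0 t2 A by (intro mult_left_mono power_mono) auto
      also have "\<dots> = (A * \<epsilon>) * (\<epsilon> * (h\<^sup>2 / k\<^sup>2))"
        by (simp add: power_mult_distrib power_divide) (simp add: power2_eq_square)
      also have "\<dots> \<le> 1 / 12960 * (\<epsilon> * (h\<^sup>2 / k\<^sup>2))"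
        using \<epsilon> by (intro mult_right_mono) auto
      finally have At: "A * t\<^sup>2 \<le> \<epsilon> * (h\<^sup>2 / (12960 * k\<^sup>2))"
        by simp
      define e where "e = \<epsilon> * (1 / (2 * k) * (h - ravg inv_sq x))"
      have main: "t + A * t\<^sup>2 + e \<le> g x"
      proof -
        have "\<epsilon> * (h / k - 1 / (2 * k) * (h - ravg inv_sq x) - h\<^sup>2 / (12960 * k\<^sup>2)) =
            \<epsilon> * (h / k) - e - \<epsilon> * (h\<^sup>2 / (12960 * k\<^sup>2))"
          unfolding e_def by (simp only: right_diff_distrib)
        with t1 At show ?thesis
          unfolding gx by linarith
      qed
      have zero: "\<delta> * (2 + A) \<le> e" if "x = 0"
      proof -
        have "ravg inv_sq (0 :: int ^ 'd) = 1 / 31"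
        proof -
          have "sqnorm (axis i 1 :: int ^ 'd) = 1" "sqnorm (- axis i 1 :: int ^ 'd) = 1" for i
            using sqnorm_add_axis[of "0 :: int ^ 'd" i] by simp_all
          then show ?thesis
            by (simp add: ravg_def inv_sq_def)
        qed
        then have r0: "ravg inv_sq x = 1 / 31" and h0: "h = 1 / 30"
          using that by (simp_all add: h_def inv_sq_def)
        have "e = \<epsilon> * (1 / (2 * k) * (1 / 30 - 1 / 31))"
          unfolding e_def r0 h0 ..
        then have "e = \<epsilon> / (1860 * k)"
          by simp
        moreover have "\<epsilon> / (1860 * T) \<le> \<epsilon> / (1860 * k)"
          using k \<epsilon> by (intro divide_left_mono) auto
        ultimately show ?thesis
          using \<delta>(2) by linarith
      qed
      have "h / k \<le> 1"
        using h k by (simp add: divide_le_eq)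
      then have "\<epsilon> * (h / k) \<le> \<epsilon> * 1"
        using \<epsilon> by (intro mult_left_mono) auto
      then have t3: "t \<le> \<epsilon>"
        using t2 by linarith
      show ?thesis
        unfolding t_def[symmetric]
      proof (rule supersolution_step[where ?t0.0 = t0 and A = A and e = e])
        show "gf (ennreal (1 + t)) \<mu> \<le> ennreal (1 + t + A * t\<^sup>2)" if "0 \<le> t" "t \<le> t0" for t
          using that by (rule gf)
        show "t \<le> t0" "t \<le> 1"
          using t3 \<epsilon> by linarith+
        show "0 \<le> e"
          unfolding e_def by (rule mult_nonneg_nonneg[OF less_imp_le[OF \<epsilon>(1)] hr])
        show "0 \<le> A"
          using A by simp
        show "\<delta> * (2 + A) \<le> e" if "x = 0"
          using that by (rule zero)
      qed (fact t0 main \<delta>(1))+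
    qed
    have "measure (occ \<mu> (replicate N at_origin) {#0 :: int ^ 'd#}) {n..} \<le> 2 / (1 + \<delta>) ^ n"
    proof (rule measure_tail_le_gf)
      have "gf (ennreal (1 + \<delta>)) (occ \<mu> (replicate N at_origin) {#0 :: int ^ 'd#}) \<le> ennreal (1 + g 0)"
        by (rule gf_visits_le[where N = N, OF g0 step]) auto
      also have "\<dots> \<le> ennreal 2"
      proof (rule ennreal_leI)
        have l0: "6 \<le> l 0"
          using l(1)[of 0] by simp
        have i0: "0 < inv_sq (0 :: int ^ 'd)" "inv_sq (0 :: int ^ 'd) \<le> 1 / 30"
          by (rule inv_sq_pos inv_sq_le)+
        have q: "0 \<le> inv_sq (0 :: int ^ 'd) / l 0"
          by (intro divide_nonneg_nonneg) (use l0 i0 in linarith)+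
        have "inv_sq (0 :: int ^ 'd) \<le> l 0"
          using l0 i0 by linarith
        then have q1: "inv_sq (0 :: int ^ 'd) / l 0 \<le> 1"
          using l0 by simp
        have "\<epsilon> * (inv_sq (0 :: int ^ 'd) / l 0) \<le> 1 * 1"
          by (rule mult_mono) (use \<epsilon>(1,2) q q1 in linarith)+
        moreover have "g 0 = \<epsilon> * (inv_sq (0 :: int ^ 'd) / l 0)"
          by (simp add: g_def)
        ultimately show "1 + g 0 \<le> 2"
          by linarith
      qed
      finally show "gf (ennreal (1 + \<delta>)) (occ \<mu> (replicate N at_origin) {#0 :: int ^ 'd#}) \<le> ennreal 2" .
    qed (use \<delta> in auto)
    then show ?thesis
      by (simp add: \<delta>_def T_def)
  qed
  with c(1,2) show ?thesis
    by (rule that)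
qed

theorem visit_tail_upper_dim4:
  assumes "CARD('d::finite) = 4"
  obtains K a where "0 < K" "0 < a" "\<And>n. 1 \<le> n \<Longrightarrow> visit_tail TYPE('d) \<mu> n \<le> K * exp (- a * sqrt (real n))"
proof -
  obtain c where c: "0 < c" "c \<le> 1"
    and tail: "\<And>N n. measure (occ \<mu> (replicate N at_origin) {#0 :: int ^ 'd#}) {n..} \<le>
      2 / (1 + c / (6 + ln ((real N + 1)\<^sup>2 + 30))) ^ n"
    using truncated_tail_dim4[OF assms] by blast
  \<comment> \<open>With \<open>N\<close> about \<open>exp r\<close> and \<open>r = sqrt n\<close>,
    one has \<open>T \<le> 46 * r\<close>, so the tail decays at least like
    \<open>exp (- c / (2 * 46 * r) * n)\<close>. The minimum with 1 accounts for survival beyond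
    \<open>N\<close>, of order \<open>exp (- r)\<close>.\<close>
  define a where "a = min 1 (c / 92)"
  define K where "K = 2 + 1 / survival_rate"
  have a: "0 < a"
    using c by (simp add: a_def)
  have K: "0 < K"
    using survival_rate_pos by (simp add: K_def add_pos_pos)
  have "visit_tail TYPE('d) \<mu> n \<le> K * exp (- a * sqrt (real n))" if n: "1 \<le> n" for n
  proof -
    define r where "r = sqrt (real n)"
    have r: "1 \<le> r" "r * r = real n"
      using n by (auto simp: r_def)
    define N where "N = nat \<lceil>exp r\<rceil>"
    have N: "exp r \<le> real N" "real N \<le> exp r + 1"
    proof -
      have "real N = of_int \<lceil>exp r\<rceil>"
        by (simp add: N_def)
      then show "exp r \<le> real N" "real N \<le> exp r + 1"
        by linarith+
    qed
    define T where "T = 6 + ln ((real N + 1)\<^sup>2 + 30)"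
    have e1: "1 \<le> exp r"
      using r by simp
    have "real N + 1 \<le> 3 * exp r"
      using N e1 by linarith
    then have "(real N + 1)\<^sup>2 + 30 \<le> (3 * exp r)\<^sup>2 + 30 * (exp r)\<^sup>2"
      using one_le_power[OF e1, of 2] by (intro add_mono power_mono) auto
    also have "\<dots> = 39 * exp (2 * r)"
      by (simp add: power2_eq_square exp_add[symmetric])
    finally have "ln ((real N + 1)\<^sup>2 + 30) \<le> ln (39 * exp (2 * r))"
      by (intro ln_mono) (auto intro: add_nonneg_pos)
    also have "\<dots> = ln 39 + 2 * r"
      by (simp add: ln_mult)
    also have "\<dots> \<le> 38 + 2 * r"
      using ln_le_minus_one[of 39] by simp
    finally have T: "T \<le> 46 * r"
      using r by (simp add: T_def)
    have T6: "6 \<le> T"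
    proof -
      have "0 \<le> ln ((real N + 1)\<^sup>2 + 30)"
        by (intro ln_ge_zero) (simp add: add_increasing)
      then show ?thesis
        by (simp add: T_def)
    qed
    define \<delta> where "\<delta> = c / T"
    have \<delta>: "0 < \<delta>" "\<delta> \<le> 1"
      using c T6 by (auto simp: \<delta>_def divide_le_eq)
    have "exp (\<delta> / 2) \<le> 1 + \<delta> / 2 + (\<delta> / 2)\<^sup>2"
      using \<delta> by (intro exp_bound) auto
    also have "(\<delta> / 2)\<^sup>2 \<le> \<delta> / 2"
      using \<delta> mult_left_mono[of \<delta> 1 \<delta>] by (simp add: power2_eq_square)
    finally have "exp (\<delta> / 2) ^ n \<le> (1 + \<delta>) ^ n"
      by (intro power_mono) auto
    then have "2 / (1 + \<delta>) ^ n \<le> 2 / exp (\<delta> / 2) ^ n"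
      using \<delta> by (intro divide_left_mono) auto
    also have "\<dots> = 2 * exp (- (\<delta> / 2 * real n))"
      by (simp only: exp_of_nat2_mult exp_minus divide_inverse)
    also have "\<dots> \<le> 2 * exp (- (a * r))"
    proof -
      have "c / (46 * r) \<le> \<delta>"
        unfolding \<delta>_def using c T T6 by (intro divide_left_mono) auto
      then have "c / (46 * r) / 2 * (r * r) \<le> \<delta> / 2 * (r * r)"
        using r by (intro mult_right_mono divide_right_mono) auto
      moreover have "c / (46 * r) / 2 * (r * r) = c / 92 * r"
        using r by (simp add: field_simps)
      moreover have "a * r \<le> c / 92 * r"
        using r by (intro mult_right_mono) (auto simp: a_def)
      ultimately have "a * r \<le> \<delta> / 2 * (r * r)"
        by linarith
      then show ?thesis
        unfolding r(2)[symmetric] by simp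
    qed
    finally have 1: "measure (occ \<mu> (replicate N at_origin) {#0 :: int ^ 'd#}) {n..} \<le> 2 * exp (- (a * r))"
      using tail[of N n] by (simp add: \<delta>_def T_def)
    have "1 / (survival_rate * (real N + 1)) \<le> 1 / (survival_rate * exp r)"
      using N survival_rate_pos by (intro divide_left_mono mult_left_mono) auto
    also have "\<dots> = 1 / survival_rate * exp (- r)"
      by (simp only: exp_minus divide_inverse inverse_mult_distrib mult_1_left)
    also have "\<dots> \<le> 1 / survival_rate * exp (- (a * r))"
    proof -
      have "a * r \<le> 1 * r"
        using r by (intro mult_right_mono) (auto simp: a_def)
      then show ?thesis
        using survival_rate_pos by (intro mult_left_mono) auto
    qed
    finally have "visit_tail TYPE('d) \<mu> n \<le> 2 * exp (- (a * r)) + 1 / survival_rate * exp (- (a * r))"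
      using visit_tail_le_truncated[where 'd = 'd, of n N] 1 by linarith
    then show ?thesis
      by (simp add: K_def r_def distrib_right)
  qed
  with K a show ?thesis
    by (rule that)
qed

end

section \<open>Lower bound in dimension four\<close>

lemma hk_pos: "\<exists>m. 0 < hk m (x :: int ^ 'd::finite)"
proof (induction "\<Sum>i\<in>UNIV. nat \<bar>x $ i\<bar>" arbitrary: x rule: less_induct)
  case less
  show ?case
  proof (cases "x = 0")
    case True
    then show ?thesis
      by (intro exI[of _ 0]) (simp add: hk_def)
  next
    case False
    then obtain i where i: "x $ i \<noteq> 0"
      by (auto simp: vec_eq_iff)
    define y where "y = (if 0 < x $ i then x - axis i 1 else x + axis i 1)"
    have y: "y \<in> neighbours x"
      by (simp add: y_def axis_neighbours)
    have eq: "y $ j = x $ j" if "j \<noteq> i" for j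
      using that by (simp add: y_def axis_def)
    have less_i: "nat \<bar>y $ i\<bar> < nat \<bar>x $ i\<bar>"
      using i by (simp add: y_def axis_def)
    have le: "nat \<bar>y $ j\<bar> \<le> nat \<bar>x $ j\<bar>" for j
    proof (cases "j = i")
      case True
      show ?thesis
        unfolding True using less_i by (rule less_imp_le)
    next
      case False
      then show ?thesis
        by (simp add: eq[OF False])
    qed
    have "(\<Sum>j\<in>UNIV. nat \<bar>y $ j\<bar>) < (\<Sum>j\<in>UNIV. nat \<bar>x $ j\<bar>)"
    proof (rule sum_strict_mono_ex1)
      show "\<forall>j\<in>UNIV. nat \<bar>y $ j\<bar> \<le> nat \<bar>x $ j\<bar>"
        using le by blast
      show "\<exists>j\<in>UNIV. nat \<bar>y $ j\<bar> < nat \<bar>x $ j\<bar>"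
        using less_i by blast
    qed simp
    then obtain m where "0 < hk m y"
      using less.hyps[of y] by auto
    then have "0 < hk m y / (2 * real CARD('d))"
      by simp
    also have "\<dots> \<le> hk (Suc m) x"
      by (rule hk_Suc_ge) fact
    finally show ?thesis ..
  qed
qed

lemma finite_sqnorm_less: "finite {x :: int ^ 'd::finite. sqnorm x < r}"
proof (rule finite_subset)
  define R where "R = \<lceil>sqrt \<bar>r\<bar>\<rceil>"
  show "{x :: int ^ 'd. sqnorm x < r} \<subseteq> {x. \<forall>i. x $ i \<in> {-R..R}}"
  proof safe
    fix x :: "int ^ 'd" and i assume "sqnorm x < r"
    then have "(real_of_int (x $ i))\<^sup>2 \<le> \<bar>r\<bar>"
      using sqnorm_component_le[of x i] by linarith
    then have "\<bar>real_of_int (x $ i)\<bar> \<le> sqrt \<bar>r\<bar>"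
      using real_le_rsqrt by auto
    also have "\<dots> \<le> real_of_int R"
      by (simp add: R_def)
    finally have "\<bar>x $ i\<bar> \<le> R"
      by linarith
    then show "x $ i \<in> {-R..R}"
      by auto
  qed
  show "finite {x :: int ^ 'd. \<forall>i. x $ i \<in> {-R..R}}"
    by (rule card_vec_box) simp
qed

text \<open>The harmonic function \<open>1 / \<bar>x\<bar>^2\<close> of four-dimensional space, shifted so as to become
  subharmonic on the lattice away from the origin.\<close>

definition sub_inv_sq :: "int ^ 'd::finite \<Rightarrow> real" where
  "sub_inv_sq x = 1 / max 1 (sqnorm x - 4)"

lemma sub_inv_sq_bounds: "0 < sub_inv_sq x" "sub_inv_sq x \<le> 1"
  by (auto simp: sub_inv_sq_def divide_le_eq)

lemma sub_inv_sq_subharmonic: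
  assumes "CARD('d) = 4" "16 \<le> sqnorm x"
  shows "sub_inv_sq x \<le> ravg sub_inv_sq (x :: int ^ 'd::finite)"
proof -
  define s where "s = sqnorm x"
  \<comment> \<open>The denominators at opposite neighbours are \<open>A + 2 t\<close> and
    \<open>A - 2 t\<close>. The bound \<open>sqnorm x \<ge> 16\<close> makes both at least 1, so the
    truncation by \<open>max 1\<close> is inactive.\<close>
  define A where "A = s - 3"
  have A: "13 \<le> A" "s = A + 3"
    using assms by (auto simp: A_def s_def)
  have "2 / A + 8 * (real_of_int (x $ i))\<^sup>2 / A ^ 3 \<le> sub_inv_sq (x + axis i 1) + sub_inv_sq (x - axis i 1)" for i
  proof -
    define t where "t = real_of_int (x $ i)"
    have t: "t\<^sup>2 \<le> s"
      unfolding t_def s_def by (rule sqnorm_component_le)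
    have "(2 * t)\<^sup>2 \<le> (A - 1)\<^sup>2"
    proof -
      have "(2 * t)\<^sup>2 \<le> 4 * s"
        using t by (simp add: power_mult_distrib)
      also have "\<dots> \<le> (A - 1)\<^sup>2"
      proof -
        have "(A - 1)\<^sup>2 - 4 * s = (A - 13) * (A + 7) + 80"
          unfolding A(2) by (simp add: power2_eq_square algebra_simps)
        moreover have "0 \<le> (A - 13) * (A + 7)"
          using A by (intro mult_nonneg_nonneg) auto
        ultimately show ?thesis
          by linarith
      qed
      finally show ?thesis .
    qed
    then have "\<bar>2 * t\<bar>\<^sup>2 \<le> (A - 1)\<^sup>2"
      by (simp only: power2_abs)
    then have abs: "\<bar>2 * t\<bar> \<le> A - 1"
      by (rule power2_le_imp_le) (use A in simp)
    then have pos: "1 \<le> A + 2 * t" "1 \<le> A - 2 * t"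
      by auto
    have "sqnorm (x + axis i 1) - 4 = A + 2 * t" "sqnorm (x - axis i 1) - 4 = A - 2 * t"
      by (simp_all add: sqnorm_add_axis A_def s_def t_def)
    then have eq: "sub_inv_sq (x + axis i 1) + sub_inv_sq (x - axis i 1) = 1 / (A + 2 * t) + 1 / (A - 2 * t)"
      using pos by (simp add: sub_inv_sq_def max_def)
    have "A * (A\<^sup>2 - 4 * t\<^sup>2) = A * ((A + 2 * t) * (A - 2 * t))"
      by (simp add: power2_eq_square algebra_simps)
    then have prod_pos: "0 < A * (A\<^sup>2 - 4 * t\<^sup>2)"
      using pos A by simp
    have "8 * t\<^sup>2 / A ^ 3 \<le> 8 * t\<^sup>2 / (A * (A\<^sup>2 - 4 * t\<^sup>2))"
    proof (rule divide_left_mono)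
      have "A * (A\<^sup>2 - 4 * t\<^sup>2) \<le> A * A\<^sup>2"
        using A by (intro mult_left_mono) auto
      then show "A * (A\<^sup>2 - 4 * t\<^sup>2) \<le> A ^ 3"
        by (simp add: power2_eq_square power3_eq_cube)
      show "0 < A ^ 3 * (A * (A\<^sup>2 - 4 * t\<^sup>2))"
        by (rule mult_pos_pos[OF zero_less_power prod_pos]) (use A in simp)
    qed simp
    moreover have "2 / A + 8 * t\<^sup>2 / (A * (A\<^sup>2 - 4 * t\<^sup>2)) = 1 / (A + 2 * t) + 1 / (A - 2 * t)"
    proof -
      have "A\<^sup>2 - 4 * t\<^sup>2 = (A + 2 * t) * (A - 2 * t)"
        by (simp add: power2_eq_square algebra_simps)
      moreover have "0 < A + 2 * t" "0 < A - 2 * t" "0 < A"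
        using pos A by auto
      ultimately show ?thesis
        by (simp add: divide_simps) (simp add: power2_eq_square algebra_simps)
    qed
    ultimately show ?thesis
      unfolding eq t_def[symmetric] by linarith
  qed
  then have "(\<Sum>i\<in>UNIV. 2 / A + 8 * (real_of_int (x $ i))\<^sup>2 / A ^ 3) \<le>
      (\<Sum>i\<in>UNIV. sub_inv_sq (x + axis i 1) + sub_inv_sq (x - axis i 1))"
    by (intro sum_mono) auto
  also have "(\<Sum>i\<in>UNIV. 2 / A + 8 * (real_of_int (x $ i))\<^sup>2 / A ^ 3) = 8 / A + 8 * s / A ^ 3"
    using assms(1) by (simp add: sum.distrib sum_divide_distrib[symmetric] sum_distrib_left[symmetric] s_def sqnorm_def)
  finally have "(8 / A + 8 * s / A ^ 3) / 8 \<le> (\<Sum>i\<in>UNIV. sub_inv_sq (x + axis i 1) + sub_inv_sq (x - axis i 1)) / 8"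
    by (rule divide_right_mono) simp
  then have "1 / A + s / A ^ 3 \<le> ravg sub_inv_sq x"
    unfolding ravg_def using assms(1) by (simp add: add_divide_distrib)
  moreover have "1 / (A - 1) \<le> 1 / A + s / A ^ 3"
  proof -
    have "1 / A + s / A ^ 3 - 1 / (A - 1) = (2 * A - 3) / (A ^ 3 * (A - 1))"
      unfolding A(2) using A(1) by (simp add: divide_simps power3_eq_cube) (simp add: algebra_simps)
    also have "\<dots> \<ge> 0"
      using A by (intro divide_nonneg_nonneg mult_nonneg_nonneg) auto
    finally show ?thesis by simp
  qed
  moreover have "sub_inv_sq x = 1 / (A - 1)"
    using A by (simp add: sub_inv_sq_def A_def s_def max_def)
  ultimately show ?thesis
    by linarith
qed

lemma green_Suc_ge: "avg (\<lambda>y. ennreal (green N y)) x \<le> ennreal (green (Suc N) (x :: int ^ 'd::finite))"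
proof -
  have "avg (\<lambda>y. ennreal (green N y)) x = (\<Sum>m<N. ennreal (hk (Suc m) x))"
    by (simp add: green_def sum_ennreal[symmetric] avg_sum avg_hk del: sum_ennreal)
  also have "\<dots> \<le> ennreal (green (Suc N) x)"
    unfolding green_def sum.lessThan_Suc_shift by (simp add: ennreal_leI)
  finally show ?thesis .
qed

text \<open>The function is below \<open>\<epsilon> / 2\<close> off a finite set, and the heat
  kernel bound makes the walk unlikely to be in that set at a late time.\<close>

lemma (in heat_kernel_bound) avg_power_sub_inv_sq:
  assumes "0 < \<epsilon>"
  obtains m where "\<And>x :: int ^ 'd. (avg ^^ m) (\<lambda>y. ennreal (sub_inv_sq y)) x \<le> ennreal \<epsilon>"
proof -
  define F where "F = {y :: int ^ 'd. sqnorm y < 4 + 2 / \<epsilon>}"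
  have F: "finite F"
    unfolding F_def by (rule finite_sqnorm_less)
  have le: "ennreal (sub_inv_sq y) \<le> ennreal (\<epsilon> / 2) + indicator F y" for y
  proof (cases "y \<in> F")
    case True
    then show ?thesis
      using sub_inv_sq_bounds(2)[of y] by (simp add: add_increasing)
  next
    case False
    then have "2 / \<epsilon> \<le> max 1 (sqnorm y - 4)"
      by (auto simp: F_def)
    then have "sub_inv_sq y \<le> 1 / (2 / \<epsilon>)"
      unfolding sub_inv_sq_def using assms by (intro divide_left_mono) auto
    then show ?thesis
      using False by (simp add: ennreal_leI)
  qed
  have "(\<lambda>m. C * real (card F) * real (Suc m) powr (- real CARD('d) / 2)) \<longlonglongrightarrow> C * real (card F) * 0"
  proof (intro tendsto_mult_left)
    have "filterlim (\<lambda>m. real (Suc m)) at_top sequentially"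
      by (rule filterlim_compose[OF filterlim_real_sequentially filterlim_Suc])
    then show "(\<lambda>m. real (Suc m) powr (- real CARD('d) / 2)) \<longlonglongrightarrow> 0"
      by (intro tendsto_neg_powr) auto
  qed
  then have "\<forall>\<^sub>F m in sequentially. C * real (card F) * real (Suc m) powr (- real CARD('d) / 2) < \<epsilon> / 2"
    using assms by (intro order_tendstoD) auto
  then obtain m where m: "C * real (card F) * real (Suc m) powr (- real CARD('d) / 2) < \<epsilon> / 2"
    by (auto simp: eventually_sequentially)
  have "(avg ^^ m) (\<lambda>y. ennreal (sub_inv_sq y)) x \<le> ennreal \<epsilon>" for x :: "int ^ 'd"
  proof -
    have "(avg ^^ m) (\<lambda>y. ennreal (sub_inv_sq y)) x \<le> (avg ^^ m) (\<lambda>y. ennreal (\<epsilon> / 2) + indicator F y) x"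
      by (rule avg_power_mono) (rule le)
    also have "\<dots> = ennreal (\<epsilon> / 2) + (avg ^^ m) (indicator F) x"
      by (simp add: avg_power_add avg_power_const)
    also have "(avg ^^ m) (indicator F) x \<le> ennreal (C * real (Suc m) powr (- real CARD('d) / 2)) * (\<integral>\<^sup>+y. indicator F y \<partial>count_space UNIV)"
      by (rule avg_power_le_sum)
    also have "(\<integral>\<^sup>+y. indicator F y \<partial>count_space UNIV) = ennreal (real (card F))"
      using F by (simp add: emeasure_count_space ennreal_of_nat_eq_real_of_nat)
    also have "ennreal (C * real (Suc m) powr (- real CARD('d) / 2)) * ennreal (real (card F)) =
        ennreal (C * real (card F) * real (Suc m) powr (- real CARD('d) / 2))"
      using C_pos by (simp add: ennreal_mult[symmetric] mult_ac)
    also have "\<dots> \<le> ennreal (\<epsilon> / 2)"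
      using m by (intro ennreal_leI) simp
    also have "ennreal (\<epsilon> / 2) + ennreal (\<epsilon> / 2) = ennreal \<epsilon>"
      using assms by (simp add: ennreal_plus[symmetric] del: ennreal_plus)
    finally show ?thesis
      by (simp add: add_left_mono)
  qed
  then show ?thesis
    by (rule that)
qed

text \<open>A maximum principle in finite time. Near the origin the Green function is at least
  \<open>c\<close> by a finite minimum; elsewhere subharmonicity passes the comparison from the
  neighbours to \<open>x\<close> while the horizon grows by one. The error is the average of
  \<open>sub_inv_sq\<close> after \<open>j\<close> steps, uniformly small for large
  \<open>j\<close>.\<close>

lemma (in heat_kernel_bound) green_lower_dim4:
  assumes "CARD('d) = 4"
  obtains c where "0 < c" "\<And>\<epsilon>. 0 < \<epsilon> \<Longrightarrow> \<exists>M. \<forall>x :: int ^ 'd. c * sub_inv_sq x \<le> green M x + \<epsilon>"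
proof -
  define S where "S = {x :: int ^ 'd. sqnorm x < 16}"
  have S: "finite S" "S \<noteq> {}"
    unfolding S_def by (rule finite_sqnorm_less, auto intro!: exI[of _ 0])
  obtain m where m: "\<And>x :: int ^ 'd. 0 < hk (m x) x"
    using hk_pos by metis
  define N0 where "N0 = Suc (Max (m ` S))"
  define c where "c = Min (green N0 ` S)"
  have green_pos: "0 < green N0 x" if "x \<in> S" for x
  proof -
    have "m x \<le> Max (m ` S)"
      using that S by auto
    then have "hk (m x) x \<le> green N0 x"
      unfolding green_def N0_def by (intro member_le_sum) auto
    with m[of x] show ?thesis
      by linarith
  qed
  have c: "0 < c"
    unfolding c_def using S green_pos by (subst Min_gr_iff) auto
  have c_le: "c \<le> green N0 x" if "x \<in> S" for x
    unfolding c_def using S that by auto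
  have claim: "ennreal (c * sub_inv_sq x) \<le> ennreal (green (N0 + j) x) + ennreal c * (avg ^^ j) (\<lambda>y. ennreal (sub_inv_sq y)) x"
    for j and x :: "int ^ 'd"
  proof (induction j arbitrary: x)
    case 0
    then show ?case
      using c by (simp add: ennreal_mult' add_increasing)
  next
    case (Suc j)
    show ?case
    proof (cases "x \<in> S")
      case True
      have "c * sub_inv_sq x \<le> c * 1"
        using c sub_inv_sq_bounds[of x] by (intro mult_left_mono) auto
      also have "\<dots> \<le> green (N0 + Suc j) x"
        using c_le[OF True] green_mono[of N0 "N0 + Suc j" x] by simp
      finally have "ennreal (c * sub_inv_sq x) \<le> ennreal (green (N0 + Suc j) x)"
        by (rule ennreal_leI)
      then show ?thesis
        by (rule order_trans) simp
    next
      case False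
      have "ennreal (c * sub_inv_sq x) \<le> ennreal (c * ravg sub_inv_sq x)"
        using False c assms by (intro ennreal_leI mult_left_mono sub_inv_sq_subharmonic) (auto simp: S_def)
      also have "\<dots> = avg (\<lambda>y. ennreal (c * sub_inv_sq y)) x"
        using c by (subst avg_ennreal) (auto simp: ravg_cmult less_imp_le[OF sub_inv_sq_bounds(1)])
      also have "\<dots> \<le> avg (\<lambda>y. ennreal (green (N0 + j) y) + ennreal c * (avg ^^ j) (\<lambda>y. ennreal (sub_inv_sq y)) y) x"
        by (intro avg_mono Suc.IH)
      also have "\<dots> = avg (\<lambda>y. ennreal (green (N0 + j) y)) x + ennreal c * (avg ^^ Suc j) (\<lambda>y. ennreal (sub_inv_sq y)) x"
        by (simp add: avg_add avg_cmult)
      also have "avg (\<lambda>y. ennreal (green (N0 + j) y)) x \<le> ennreal (green (N0 + Suc j) x)"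
        using green_Suc_ge[of "N0 + j" x] by simp
      finally show ?thesis
        by (simp add: add_right_mono)
    qed
  qed
  have "\<exists>M. \<forall>x :: int ^ 'd. c * sub_inv_sq x \<le> green M x + \<epsilon>" if "0 < \<epsilon>" for \<epsilon>
  proof -
    have "0 < \<epsilon> / c"
      using that c by simp
    then obtain j where j: "\<And>x :: int ^ 'd. (avg ^^ j) (\<lambda>y. ennreal (sub_inv_sq y)) x \<le> ennreal (\<epsilon> / c)"
      using avg_power_sub_inv_sq by blast
    have "c * sub_inv_sq x \<le> green (N0 + j) x + \<epsilon>" for x :: "int ^ 'd"
    proof -
      have "ennreal (c * sub_inv_sq x) \<le> ennreal (green (N0 + j) x) + ennreal c * ennreal (\<epsilon> / c)"
        by (intro order_trans[OF claim[of x j]] add_left_mono mult_left_mono j) simp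
      also have "\<dots> = ennreal (green (N0 + j) x + \<epsilon>)"
        using c that by (simp add: ennreal_mult[symmetric])
      finally show ?thesis
        using that by (subst (asm) ennreal_le_iff) (auto intro: add_nonneg_nonneg)
    qed
    then show ?thesis
      by blast
  qed
  with c show ?thesis
    by (rule that)
qed

text \<open>A sum compared with an integral; it raises the power by one when the contributions of
  the shells are added in \<open>visit_moment_lower_step\<close>.\<close>

lemma power_Suc_le_sum: "real n ^ Suc q \<le> real (Suc q) * (\<Sum>j<n. real (Suc j) ^ q)"
proof (induction n)
  case (Suc n)
  have step: "real (Suc n) ^ Suc q \<le> real n ^ Suc q + real (Suc q) * real (Suc n) ^ q"
  proof (induction q)
    case (Suc q)
    have "real (Suc n) ^ Suc (Suc q) \<le> real (Suc n) * (real n ^ Suc q + real (Suc q) * real (Suc n) ^ q)"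
      unfolding power_Suc[of _ "Suc q"] by (intro mult_left_mono Suc.IH) auto
    also have "\<dots> = real n ^ Suc (Suc q) + (real n ^ Suc q + real (Suc q) * real (Suc n) ^ Suc q)"
      by (simp add: algebra_simps)
    also have "real n ^ Suc q \<le> real (Suc n) ^ Suc q"
      by (intro power_mono) auto
    finally show ?case
      by (simp add: algebra_simps)
  qed simp
  also have "\<dots> \<le> real (Suc q) * (\<Sum>j<n. real (Suc j) ^ q) + real (Suc q) * real (Suc n) ^ q"
    by (intro add_right_mono Suc.IH)
  finally show ?case
    by (simp add: algebra_simps)
qed simp

section \<open>Monotonicity and recursive lower bounds of moments\<close>

lemma bm_convpow_mono:
  assumes "\<And>i. i \<le> k \<Longrightarrow> bm i p \<le> bm i q"
  shows "i \<le> k \<Longrightarrow> bm i (convpow n p) \<le> bm i (convpow n q)"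
proof (induction n arbitrary: i)
  case (Suc n)
  then show ?case
    using assms by (auto simp: bm_conv intro!: sum_mono mult_mono)
qed simp

lemma next_moment_mono:
  assumes "\<And>i y. i \<le> k \<Longrightarrow> visit_moment \<mu> i \<phi>s y \<le> visit_moment \<mu> i \<psi>s y"
  shows "next_moment \<mu> k \<phi>s x \<le> next_moment \<mu> k \<psi>s x"
  unfolding next_moment_def
  by (intro nn_integral_mono bm_convpow_mono[where k = k]) (auto simp: bm_bind_neighbours intro!: avg_mono assms)

lemma visit_moment_incseq:
  "M \<le> N \<Longrightarrow> visit_moment \<mu> k (replicate M at_origin) (x :: int ^ 'd::finite) \<le> visit_moment \<mu> k (replicate N at_origin) x"
proof (induction M arbitrary: N k x)
  case 0
  then show ?case
    by (cases k) (auto simp: visit_moment_Nil)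
next
  case (Suc M)
  then obtain N' where N': "N = Suc N'" "M \<le> N'"
    by (cases N) auto
  show ?case
  proof (cases k)
    case (Suc l)
    have "next_moment \<mu> j (replicate M at_origin) x \<le> next_moment \<mu> j (replicate N' at_origin) x" for j
      by (intro next_moment_mono Suc.IH N')
    then show ?thesis
      unfolding N' replicate_Suc Suc
      by (subst (1 2) visit_moment_Cons) (auto simp: at_origin_def intro: add_mono)
  qed simp
qed

context critical_offspring
begin

lemma visit_moment_Suc_ge:
  fixes x :: "int ^ 'd::finite"
  assumes "0 < k"
  shows "avg (visit_moment \<mu> k (replicate N at_origin)) x +
    bm 2 \<mu> * (\<Sum>i\<in>{0<..<k}. avg (visit_moment \<mu> i (replicate N at_origin)) x *
      avg (visit_moment \<mu> (k - i) (replicate N at_origin)) x)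
    \<le> visit_moment \<mu> k (replicate (Suc N) at_origin) x"
proof -
  obtain l where l: "k = Suc l"
    using assms by (cases k) auto
  have "visit_moment \<mu> k (replicate (Suc N) at_origin) x =
      next_moment \<mu> k (replicate N at_origin) x + of_nat (at_origin x) * next_moment \<mu> l (replicate N at_origin) x"
    unfolding l replicate_Suc by (rule visit_moment_Cons) (simp add: at_origin_def)
  then have "next_moment \<mu> k (replicate N at_origin) x \<le> visit_moment \<mu> k (replicate (Suc N) at_origin) x"
    by simp
  with next_moment_ge[OF assms, of \<mu> "replicate N at_origin" x] show ?thesis
    unfolding bm_offspring_1 mult_1_left by (rule order_trans)
qed

text \<open>A single line is followed for fewer than \<open>M\<close> generations up to a branching
  point, whose branches then still have at least \<open>N\<close> generations. Monotonicity in the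
  horizon allows the same \<open>F\<close> at every step.\<close>

lemma visit_moment_iterate_ge:
  fixes x :: "int ^ 'd::finite"
  assumes "0 < k"
    and F: "\<And>y :: int ^ 'd. F y \<le> bm 2 \<mu> * (\<Sum>i\<in>{0<..<k}. avg (visit_moment \<mu> i (replicate N at_origin)) y *
      avg (visit_moment \<mu> (k - i) (replicate N at_origin)) y)"
  shows "(\<Sum>m<M. (avg ^^ m) F x) \<le> visit_moment \<mu> k (replicate (M + N) at_origin) x"
proof (induction M arbitrary: x)
  case (Suc M)
  have "(\<Sum>m<Suc M. (avg ^^ m) F x) = F x + avg (\<lambda>y. \<Sum>m<M. (avg ^^ m) F y) x"
    unfolding sum.lessThan_Suc_shift by (simp add: avg_sum)
  also have "avg (\<lambda>y. \<Sum>m<M. (avg ^^ m) F y) x \<le> avg (visit_moment \<mu> k (replicate (M + N) at_origin)) x"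
    by (intro avg_mono Suc.IH)
  also have "F x \<le> bm 2 \<mu> * (\<Sum>i\<in>{0<..<k}. avg (visit_moment \<mu> i (replicate (M + N) at_origin)) x *
      avg (visit_moment \<mu> (k - i) (replicate (M + N) at_origin)) x)"
    by (rule order_trans[OF F])
      (intro mult_left_mono sum_mono mult_mono avg_mono visit_moment_incseq, simp_all)
  finally have "(\<Sum>m<Suc M. (avg ^^ m) F x) \<le> bm 2 \<mu> * (\<Sum>i\<in>{0<..<k}. avg (visit_moment \<mu> i (replicate (M + N) at_origin)) x *
      avg (visit_moment \<mu> (k - i) (replicate (M + N) at_origin)) x) + avg (visit_moment \<mu> k (replicate (M + N) at_origin)) x"
    by (simp add: add_mono)
  also have "\<dots> \<le> visit_moment \<mu> k (replicate (Suc M + N) at_origin) x"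
    using visit_moment_Suc_ge[OF assms(1), of "M + N" x] by (simp add: add.commute)
  finally show ?case .
qed simp

end

lemma avg_power_ge_sum:
  fixes x :: "int ^ 'd::finite"
  assumes "finite Q"
  shows "(\<Sum>y\<in>Q. ennreal (green M (x - y)) * F y) \<le> (\<Sum>m<M. (avg ^^ m) F x)"
proof -
  have "(\<Sum>y\<in>Q. ennreal (green M (x - y)) * F y) = (\<Sum>m<M. \<Sum>y\<in>Q. ennreal (hk m (x - y)) * F y)"
    by (simp add: green_def sum_ennreal[symmetric] sum_distrib_right del: sum_ennreal) (rule sum.swap)
  also have "\<dots> \<le> (\<Sum>m<M. (avg ^^ m) F x)"
  proof (rule sum_mono)
    fix m
    have "(\<Sum>y\<in>Q. ennreal (hk m (x - y)) * F y) = (\<integral>\<^sup>+y. ennreal (hk m (x - y)) * F y \<partial>count_space Q)"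
      using assms by (simp add: nn_integral_count_space_finite)
    also have "\<dots> \<le> (\<integral>\<^sup>+y. ennreal (hk m (x - y)) * F y \<partial>count_space UNIV)"
      by (auto simp: nn_integral_count_space_indicator indicator_def intro!: nn_integral_mono)
    finally show "(\<Sum>y\<in>Q. ennreal (hk m (x - y)) * F y) \<le> (avg ^^ m) F x"
      by (simp add: avg_power_eq_sum)
  qed
  finally show ?thesis .
qed

section \<open>Dyadic decomposition of space\<close>

definition box :: "nat \<Rightarrow> (int ^ 'd::finite) set" where
  "box j = {x. \<forall>i. \<bar>x $ i\<bar> \<le> 2 ^ j}"

text \<open>Only the cube in the positive orthant is used: it has exactly \<open>(2^j)^d\<close>
  points, and different shells are disjoint.\<close>

definition shell :: "nat \<Rightarrow> (int ^ 'd::finite) set" where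
  "shell j = {x. \<forall>i. x $ i \<in> {2 ^ j..<2 ^ Suc j}}"

lemma finite_shell [simp]: "finite (shell j)"
  unfolding shell_def by (rule card_vec_box) simp

lemma card_shell: "card (shell j :: (int ^ 'd::finite) set) = (2 ^ j) ^ CARD('d)"
proof -
  show ?thesis
    unfolding shell_def by (subst card_vec_box) (simp_all add: nat_power_eq)
qed

lemma shell_neighbours_box:
  assumes "y \<in> shell j" "z \<in> neighbours (y :: int ^ 'd::finite)"
  shows "z \<in> box (Suc j)"
proof -
  have "\<bar>z $ i\<bar> \<le> 2 ^ Suc j" for i
  proof -
    have "y $ i \<in> {2 ^ j..<2 ^ Suc j}"
      using assms by (auto simp: shell_def)
    moreover have "\<bar>z $ i - y $ i\<bar> \<le> 1"
      using assms(2) by (auto simp: neighbours_def axis_def)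
    moreover have "(1 :: int) \<le> 2 ^ j"
      by simp
    ultimately show ?thesis
      unfolding atLeastLessThan_iff by linarith
  qed
  then show ?thesis
    by (simp add: box_def)
qed

lemma box_diff_shell:
  assumes "x \<in> box l" "y \<in> shell j" "j < l"
  shows "x - y \<in> box (Suc l)"
proof -
  have "\<bar>(x - y) $ i\<bar> \<le> 2 ^ Suc l" for i
  proof -
    have "\<bar>x $ i\<bar> \<le> 2 ^ l" "y $ i \<in> {2 ^ j..<2 ^ Suc j}"
      using assms by (auto simp: box_def shell_def)
    moreover have "(2 :: int) ^ Suc j \<le> 2 ^ l"
      using assms by (intro power_increasing) auto
    moreover have "(0 :: int) < 2 ^ j"
      by simp
    ultimately show ?thesis
      unfolding atLeastLessThan_iff vector_minus_component power_Suc by linarith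
  qed
  then show ?thesis
    by (simp add: box_def)
qed

lemma disjoint_shell:
  assumes "i < j"
  shows "shell i \<inter> shell j = ({} :: (int ^ 'd::finite) set)"
proof -
  have False if "x \<in> shell i" "x \<in> shell j" for x :: "int ^ 'd"
  proof -
    have "x $ k < 2 ^ Suc i" "2 ^ j \<le> x $ k" for k
      using that by (auto simp: shell_def)
    moreover have "(2 :: int) ^ Suc i \<le> 2 ^ j"
      using assms by (intro power_increasing) auto
    ultimately show False
      by (meson not_less order_trans)
  qed
  then show ?thesis
    by blast
qed

lemma sub_inv_sq_box:
  assumes "CARD('d) = 4" "x \<in> box j"
  shows "(1 / 4) ^ j / 4 \<le> sub_inv_sq (x :: int ^ 'd::finite)"
proof -
  have "sqnorm x \<le> (\<Sum>i\<in>(UNIV :: 'd set). 4 ^ j)"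
    unfolding sqnorm_def
  proof (rule sum_mono)
    fix i
    have "\<bar>real_of_int (x $ i)\<bar> \<le> 2 ^ j"
      using assms(2) by (auto simp: box_def simp flip: of_int_abs of_int_power_le_of_int_cancel_iff dest: spec[of _ i])
    then have "\<bar>real_of_int (x $ i)\<bar>\<^sup>2 \<le> (2 ^ j)\<^sup>2"
      by (intro power_mono) auto
    then show "(real_of_int (x $ i))\<^sup>2 \<le> 4 ^ j"
      by (simp add: power2_eq_square power_mult_distrib[symmetric])
  qed
  then have "sqnorm x \<le> 4 * 4 ^ j"
    using assms(1) by simp
  moreover have "(1 :: real) \<le> 4 ^ j"
    by simp
  ultimately have "max 1 (sqnorm x - 4) \<le> 4 * 4 ^ j"
    unfolding max.bounded_iff by linarith
  then have "1 / (4 * 4 ^ j) \<le> sub_inv_sq x"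
    unfolding sub_inv_sq_def by (intro divide_left_mono) auto
  then show ?thesis
    by (simp add: power_one_over mult.commute)
qed

text \<open>The error in \<open>green_lower_dim4\<close> is taken as \<open>c / 8 * 4^(-l)\<close>,
  at most half of \<open>c * sub_inv_sq\<close> on every box up to \<open>l\<close>, so one horizon
  serves all of them.\<close>

lemma (in heat_kernel_bound) green_box:
  assumes "CARD('d) = 4"
  obtains g where "0 < g" "\<And>l. \<exists>M. \<forall>j\<le>l. \<forall>x\<in>box j. g * (1 / 4) ^ j \<le> green M (x :: int ^ 'd)"
proof -
  obtain c where c: "0 < c" "\<And>\<epsilon>. 0 < \<epsilon> \<Longrightarrow> \<exists>M. \<forall>x :: int ^ 'd. c * sub_inv_sq x \<le> green M x + \<epsilon>"
    using green_lower_dim4[OF assms] by blast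
  have "\<exists>M. \<forall>j\<le>l. \<forall>x\<in>box j. c / 8 * (1 / 4) ^ j \<le> green M (x :: int ^ 'd)" for l
  proof -
    have "0 < c / 8 * (1 / 4) ^ l"
      using c by simp
    then obtain M where M: "\<And>x :: int ^ 'd. c * sub_inv_sq x \<le> green M x + c / 8 * (1 / 4) ^ l"
      using c(2) by blast
    have "c / 8 * (1 / 4) ^ j \<le> green M x" if "j \<le> l" "x \<in> box j" for j and x :: "int ^ 'd"
    proof -
      have "c * ((1 / 4) ^ j / 4) \<le> c * sub_inv_sq x"
        using c sub_inv_sq_box[OF assms that(2)] by (intro mult_left_mono) auto
      moreover have "c / 8 * (1 / 4) ^ l \<le> c / 8 * (1 / 4) ^ j"
        using c that by (intro mult_left_mono power_decreasing) auto
      moreover have "c * ((1 / 4) ^ j / 4) = c / 8 * (1 / 4) ^ j + c / 8 * (1 / 4) ^ j"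
        by simp
      ultimately show ?thesis
        using M[of x] by linarith
    qed
    then show ?thesis
      by blast
  qed
  with c(1) show ?thesis
    by (intro that[of "c / 8"]) auto
qed

context critical_brw
begin

text \<open>\<open>visit_moment_iterate_ge\<close> gives the \<open>k\<close>-th moment as a sum over the branching point \<open>y\<close>. A
  branching point in the shell \<open>s < j\<close> contributes \<open>16 ^ -s\<close> times \<open>(s + 1) ^ (k - 2)\<close>, and the shell has
  \<open>16 ^ s\<close> points.\<close>

lemma visit_moment_lower_step:
  fixes x :: "int ^ 'd"
  assumes dim: "CARD('d) = 4" and k: "2 \<le> k" and pos: "0 < g" "0 < a" "0 < \<gamma>" "0 < \<beta>"
    and \<gamma>: "\<gamma> * (g * a) = 64" and a: "ennreal a = bm 2 \<mu>"
    and IH: "\<And>i j y :: int ^ 'd. 1 \<le> i \<Longrightarrow> i < k \<Longrightarrow> j \<le> l \<Longrightarrow> y \<in> box j \<Longrightarrow>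
      ennreal (\<gamma> * \<beta> ^ i * (1 / 4) ^ j * real j ^ (i - 1)) \<le> visit_moment \<mu> i (replicate N at_origin) y"
    and green: "\<And>j y :: int ^ 'd. j \<le> Suc l \<Longrightarrow> y \<in> box j \<Longrightarrow> g * (1 / 4) ^ j \<le> green M y"
    and x: "j \<le> l" "x \<in> box j"
  shows "ennreal (\<gamma> * \<beta> ^ k * (1 / 4) ^ j * real j ^ (k - 1)) \<le> visit_moment \<mu> k (replicate (M + N) at_origin) x"
proof -
  define h where "h i j = \<gamma> * \<beta> ^ i * (1 / 4) ^ j * real j ^ (i - 1)" for i j
  define A where "A i y = avg (visit_moment \<mu> i (replicate N at_origin)) y" for i and y :: "int ^ 'd"
  define F where "F y = bm 2 \<mu> * (\<Sum>i\<in>{0<..<k}. A i y * A (k - i) y)" for y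
  define q where "q = k - 2"
  have q: "k = Suc (Suc q)"
    using k by (simp add: q_def)
  \<comment> \<open>In the sum over \<open>0 < i < k\<close> the product of the two bounds does not
    depend on \<open>i\<close>; this gives \<open>k - 1\<close> equal terms, with
    \<open>4^(-1)\<close> squared per scale and the exponents of \<open>s + 1\<close> adding up to
    \<open>k - 2\<close>.\<close>
  define f where "f s = a * (\<gamma>\<^sup>2 * \<beta> ^ k * (1 / 16) ^ Suc s * (real (Suc q) * real (Suc s) ^ q))" for s
  have f_nonneg: "0 \<le> f s" for s
    using pos by (auto simp: f_def)
  have A_ge: "ennreal (h i (Suc s)) \<le> A i y" if "i \<in> {0<..<k}" "s < l" "y \<in> shell s" for i s y
  proof -
    have "ennreal (h i (Suc s)) = avg (\<lambda>_. ennreal (h i (Suc s))) y"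
      by simp
    also have "\<dots> \<le> A i y"
      unfolding A_def h_def using that
      by (intro avg_mono IH shell_neighbours_box) auto
    finally show ?thesis .
  qed
  have F_ge: "ennreal (f s) \<le> F y" if "s < l" "y \<in> shell s" for s y
  proof -
    have eq: "h i (Suc s) * h (k - i) (Suc s) = \<gamma>\<^sup>2 * \<beta> ^ k * (1 / 16) ^ Suc s * real (Suc s) ^ q"
      if "i \<in> {0<..<k}" for i
    proof -
      have "\<beta> ^ i * \<beta> ^ (k - i) = \<beta> ^ k" "real (Suc s) ^ (i - 1) * real (Suc s) ^ (k - i - 1) = real (Suc s) ^ q"
        using that by (auto simp: power_add[symmetric] q_def)
      moreover have "(1 / 4 :: real) ^ Suc s * (1 / 4) ^ Suc s = (1 / 16) ^ Suc s"
        by (simp only: power_mult_distrib[symmetric]) simp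
      moreover have "h i (Suc s) * h (k - i) (Suc s) = \<gamma>\<^sup>2 * (\<beta> ^ i * \<beta> ^ (k - i)) *
          ((1 / 4) ^ Suc s * (1 / 4) ^ Suc s) * (real (Suc s) ^ (i - 1) * real (Suc s) ^ (k - i - 1))"
        unfolding h_def power2_eq_square by (simp only: mult_ac)
      ultimately show ?thesis
        by (simp only:)
    qed
    have "f s = a * (\<Sum>i\<in>{0<..<k}. h i (Suc s) * h (k - i) (Suc s))"
    proof -
      have "(\<Sum>i\<in>{0<..<k}. h i (Suc s) * h (k - i) (Suc s)) =
          (\<Sum>i\<in>{0<..<k}. \<gamma>\<^sup>2 * \<beta> ^ k * (1 / 16) ^ Suc s * real (Suc s) ^ q)"
        by (rule sum.cong[OF refl eq])
      also have "\<dots> = real (Suc q) * (\<gamma>\<^sup>2 * \<beta> ^ k * (1 / 16) ^ Suc s * real (Suc s) ^ q)"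
        by (simp add: q)
      finally show ?thesis
        by (simp only: f_def mult_ac)
    qed
    also have "ennreal \<dots> = bm 2 \<mu> * (\<Sum>i\<in>{0<..<k}. ennreal (h i (Suc s)) * ennreal (h (k - i) (Suc s)))"
      using pos by (simp add: ennreal_mult' a h_def sum_ennreal[symmetric] ennreal_mult[symmetric] sum_nonneg del: sum_ennreal)
    also have "\<dots> \<le> F y"
      unfolding F_def using that by (intro mult_left_mono sum_mono mult_mono A_ge) auto
    finally show ?thesis .
  qed
  \<comment> \<open>The difference of \<open>x\<close> and a shell point lies in the box one scale
    larger, which costs a factor 4, and the neighbours of a shell point cost 16 in \<open>f\<close>.
    The normalisation \<open>\<gamma> * (g * a) = 64\<close> cancels exactly these factors and
    closes the induction.\<close>
  define G where "G = g * (1 / 4) ^ Suc j"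
  have G: "0 \<le> G"
    using pos by (simp add: G_def)
  have "\<gamma> * \<beta> ^ k * (1 / 4) ^ j * real j ^ (k - 1) \<le>
      \<gamma> * \<beta> ^ k * (1 / 4) ^ j * (real (Suc q) * (\<Sum>s<j. real (Suc s) ^ q))"
    unfolding q diff_Suc_1 using pos by (intro mult_left_mono power_Suc_le_sum) auto
  also have "\<dots> = (\<Sum>s<j. \<gamma> * \<beta> ^ k * (1 / 4) ^ j * (real (Suc q) * real (Suc s) ^ q))"
    by (simp add: sum_distrib_left)
  also have "\<dots> = (\<Sum>s<j. 16 ^ s * (G * f s))"
  proof (rule sum.cong)
    fix s
    have "(16 :: real) ^ s * (1 / 16) ^ s = 1"
      by (simp add: power_mult_distrib[symmetric])
    have "16 ^ s * (G * f s) = (16 ^ s * (1 / 16) ^ s) * (\<gamma> * (g * a)) / 64 *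
        (\<gamma> * \<beta> ^ k * (1 / 4) ^ j * (real (Suc q) * real (Suc s) ^ q))"
      by (simp only: G_def f_def power_Suc power2_eq_square) (simp add: field_simps)
    then show "\<gamma> * \<beta> ^ k * (1 / 4) ^ j * (real (Suc q) * real (Suc s) ^ q) = 16 ^ s * (G * f s)"
      by (simp add: \<gamma> power_mult_distrib[symmetric])
  qed simp
  finally have "ennreal (\<gamma> * \<beta> ^ k * (1 / 4) ^ j * real j ^ (k - 1)) \<le> ennreal (\<Sum>s<j. 16 ^ s * (G * f s))"
    by (rule ennreal_leI)
  also have "\<dots> = (\<Sum>s<j. \<Sum>y\<in>(shell s :: (int ^ 'd) set). ennreal G * ennreal (f s))"
    using G f_nonneg dim
    by (simp add: sum_ennreal[symmetric] card_shell ennreal_mult ennreal_of_nat_eq_real_of_nat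
          ennreal_power[symmetric] power_mult[symmetric] mult.commute[of _ 4] power_mult[of 2 4] del: sum_ennreal)
  also have "\<dots> \<le> (\<Sum>s<j. \<Sum>y\<in>(shell s :: (int ^ 'd) set). ennreal (green M (x - y)) * F y)"
  proof (intro sum_mono mult_mono)
    fix s and y :: "int ^ 'd" assume s: "s \<in> {..<j}" and y: "y \<in> shell s"
    show "ennreal G \<le> ennreal (green M (x - y))"
      unfolding G_def using s y x by (intro ennreal_leI green box_diff_shell) auto
    show "ennreal (f s) \<le> F y"
      using s y x by (intro F_ge) auto
  qed auto
  also have "\<dots> = (\<Sum>y\<in>(\<Union>s<j. shell s :: (int ^ 'd) set). ennreal (green M (x - y)) * F y)"
    using disjoint_shell by (subst sum.UNION_disjoint) (auto simp: neq_iff)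
  also have "\<dots> \<le> (\<Sum>m<M. (avg ^^ m) F x)"
    by (intro avg_power_ge_sum) auto
  also have "\<dots> \<le> visit_moment \<mu> k (replicate (M + N) at_origin) x"
    using k by (intro visit_moment_iterate_ge) (auto simp: F_def A_def)
  finally show ?thesis .
qed

lemma visit_moment_lower_dim4:
  assumes dim: "CARD('d) = 4"
  obtains \<gamma> \<beta> where "0 < \<gamma>" "0 < \<beta>"
    "\<And>k. 1 \<le> k \<Longrightarrow> \<exists>N. ennreal (\<gamma> * \<beta> ^ k * real k ^ (k - 1)) \<le> bm k (occ \<mu> (replicate N at_origin) {#0 :: int ^ 'd#})"
proof -
  obtain g where g: "0 < g" "\<And>l. \<exists>M. \<forall>j\<le>l. \<forall>x\<in>box j. g * (1 / 4) ^ j \<le> green M (x :: int ^ 'd)"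
    using green_box[OF dim] by blast
  obtain a where a: "bm 2 \<mu> = ennreal a" "0 \<le> a"
    using bm_offspring_finite[of 2] by (cases "bm 2 \<mu>") auto
  with bm_offspring_2_pos have a_pos: "0 < a"
    by simp
  define \<gamma> where "\<gamma> = 64 / (g * a)"
  \<comment> \<open>Makes \<open>\<gamma> * \<beta> = g\<close>, so that the case of the first
    moment is the Green function bound itself.\<close>
  define \<beta> where "\<beta> = g / \<gamma>"
  have pos: "0 < \<gamma>" "0 < \<beta>" and \<gamma>: "\<gamma> * (g * a) = 64" "\<gamma> * \<beta> = g"
    using g(1) a_pos by (auto simp: \<gamma>_def \<beta>_def)
  have main: "\<exists>N. \<forall>i j. \<forall>x :: int ^ 'd. 1 \<le> i \<longrightarrow> i \<le> k \<longrightarrow> j \<le> l \<longrightarrow> x \<in> box j \<longrightarrow>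
      ennreal (\<gamma> * \<beta> ^ i * (1 / 4) ^ j * real j ^ (i - 1)) \<le> visit_moment \<mu> i (replicate N at_origin) x" for k l
  proof (induction k)
    case (Suc k)
    then obtain N where N: "\<And>i j x :: int ^ 'd. 1 \<le> i \<Longrightarrow> i \<le> k \<Longrightarrow> j \<le> l \<Longrightarrow> x \<in> box j \<Longrightarrow>
      ennreal (\<gamma> * \<beta> ^ i * (1 / 4) ^ j * real j ^ (i - 1)) \<le> visit_moment \<mu> i (replicate N at_origin) x"
      by blast
    obtain M where M: "\<And>j x :: int ^ 'd. j \<le> Suc l \<Longrightarrow> x \<in> box j \<Longrightarrow> g * (1 / 4) ^ j \<le> green M x"
      using g(2)[of "Suc l"] by blast
    have "ennreal (\<gamma> * \<beta> ^ i * (1 / 4) ^ j * real j ^ (i - 1)) \<le> visit_moment \<mu> i (replicate (M + N) at_origin) x"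
      if "1 \<le> i" "i \<le> Suc k" "j \<le> l" "x \<in> box j" for i j and x :: "int ^ 'd"
    proof -
      consider "i \<le> k" | "i = Suc k" "2 \<le> i" | "i = 1"
        using \<open>1 \<le> i\<close> \<open>i \<le> Suc k\<close> by linarith
      then show ?thesis
      proof cases
        case 1
        show ?thesis
          by (rule order_trans[OF N visit_moment_incseq]) (use that 1 in auto)
      next
        case 2
        show ?thesis
          by (rule visit_moment_lower_step[OF dim 2(2) g(1) a_pos pos \<gamma>(1) a(1)[symmetric] N M that(3,4)])
            (use 2 in auto)
      next
        case 3
        have "ennreal (g * (1 / 4) ^ j) \<le> ennreal (green M x)"
          using that by (intro ennreal_leI M) auto
        also have "\<dots> = visit_moment \<mu> 1 (replicate M at_origin) x"
          by (rule visit_moment_1_visits[symmetric])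
        also have "\<dots> \<le> visit_moment \<mu> 1 (replicate (M + N) at_origin) x"
          by (rule visit_moment_incseq) simp
        finally show ?thesis
          unfolding 3 by (simp add: \<gamma>(2))
      qed
    qed
    then show ?case
      by blast
  qed auto
  \<comment> \<open>The origin lies in every box, so the scale is free; \<open>j = k\<close> costs
    \<open>4^(-k)\<close> and gains \<open>k^(k - 1)\<close>.\<close>
  have "\<exists>N. ennreal (\<gamma> * (\<beta> / 4) ^ k * real k ^ (k - 1)) \<le> bm k (occ \<mu> (replicate N at_origin) {#0 :: int ^ 'd#})"
    if "1 \<le> k" for k
  proof -
    have "(0 :: int ^ 'd) \<in> box k"
      by (simp add: box_def)
    with main[of k k] that obtain N where
      "ennreal (\<gamma> * \<beta> ^ k * (1 / 4) ^ k * real k ^ (k - 1)) \<le> visit_moment \<mu> k (replicate N at_origin) (0 :: int ^ 'd)"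
      by blast
    moreover have "\<gamma> * \<beta> ^ k * (1 / 4) ^ k * real k ^ (k - 1) = \<gamma> * (\<beta> / 4) ^ k * real k ^ (k - 1)"
      by (simp add: power_divide)
    ultimately show ?thesis
      unfolding visit_moment_def by (intro exI[of _ N]) (simp only:)
  qed
  with pos show ?thesis
    by (intro that[of \<gamma> "\<beta> / 4"]) auto
qed

end

section \<open>From moments to stretched exponential tails\<close>

lemma exp_minus_sqrt_le:
  assumes "0 < b" "1 \<le> n"
  shows "exp (- b * sqrt (real n)) \<le> 24 / b ^ 4 * (1 / (real n)\<^sup>2)"
proof -
  have "sqrt (real n) ^ 4 = ((sqrt (real n))\<^sup>2)\<^sup>2"
    by (simp only: power_mult[symmetric]) simp
  then have "(b * sqrt (real n)) ^ 4 = b ^ 4 * (real n)\<^sup>2"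
    by (simp add: power_mult_distrib)
  moreover have "(b * sqrt (real n)) ^ 4 \<le> fact 4 * exp (b * sqrt (real n))"
    using assms by (intro power_le_fact_exp) auto
  moreover have "fact 4 = (24 :: real)"
    by (simp add: eval_nat_numeral)
  ultimately have "b ^ 4 * (real n)\<^sup>2 \<le> 24 * exp (b * sqrt (real n))"
    by simp
  then show ?thesis
    using assms by (simp add: exp_minus divide_simps mult.commute)
qed

lemma summable_exp_minus_sqrt:
  assumes "0 < b"
  shows "summable (\<lambda>n. exp (- b * sqrt (real n)))"
proof (rule summable_comparison_test')
  show "summable (\<lambda>n. 24 / b ^ 4 * (1 / (real n)\<^sup>2))"
    using inverse_power_summable[of 2, where 'a = real]
    by (intro summable_mult) (simp add: inverse_eq_divide power_one_over)
  show "norm (exp (- b * sqrt (real n))) \<le> 24 / b ^ 4 * (1 / (real n)\<^sup>2)" if "1 \<le> n" for n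
    using exp_minus_sqrt_le[OF assms that] by simp
qed

text \<open>Half of the exponential decay bounds the power, by
  \<open>x^(4 * k) \<le> fact (4 * k) * exp x\<close> at \<open>x = a * sqrt n / 2\<close>; the
  other half makes the series converge. The assumption \<open>1 \<le> K\<close> extends the
  pointwise bound to \<open>n = 0\<close>.\<close>

lemma moment_le_of_stretched_tail:
  assumes tail: "\<And>n. 1 \<le> n \<Longrightarrow> measure (measure_pmf p) {n..} \<le> K * exp (- a * sqrt (real n))" and a: "0 < a" and K: "1 \<le> K"
  shows "(\<integral>\<^sup>+n. ennreal (real n ^ (2 * k)) \<partial>measure_pmf p)
    \<le> ennreal (K * (\<Sum>n. exp (- (a / 2) * sqrt (real n))) * (8 * real k / a) ^ (4 * k))"
proof -
  let ?f = "\<lambda>n::nat. K * (8 * real k / a) ^ (4 * k) * exp (- (a / 2) * sqrt (real n))"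
  have "(\<integral>\<^sup>+n. ennreal (real n ^ (2 * k)) \<partial>measure_pmf p) = (\<Sum>n. ennreal (pmf p n) * ennreal (real n ^ (2 * k)))"
    by (simp add: nn_integral_measure_pmf nn_integral_count_space_nat)
  also have "\<dots> \<le> (\<Sum>n. ennreal (?f n))"
  proof (rule suminf_le)
    fix n
    define r where "r = sqrt (real n)"
    have r: "0 \<le> r" "real n = r\<^sup>2"
      by (auto simp: r_def)
    have "pmf p n \<le> K * exp (- a * r)"
    proof (cases "n = 0")
      case True
      then show ?thesis
        using K pmf_le_1[of p 0] by (simp add: r_def)
    next
      case False
      have "pmf p n = measure (measure_pmf p) {n}"
        by (simp add: measure_pmf_single)
      also have "\<dots> \<le> measure (measure_pmf p) {n..}"
        by (intro measure_pmf.finite_measure_mono) auto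
      finally show ?thesis
        using tail[of n] False by (simp add: r_def)
    qed
    moreover have "real n ^ (2 * k) \<le> (8 * real k / a) ^ (4 * k) * exp (a / 2 * r)"
    proof -
      have "(a / 2 * r) ^ (4 * k) \<le> fact (4 * k) * exp (a / 2 * r)"
        using a r by (intro power_le_fact_exp) auto
      also have "fact (4 * k) \<le> real (4 * k) ^ (4 * k)"
        using fact_le_power[of "4 * k", where 'a = real] by (simp only: of_nat_power)
      finally have "(2 / a) ^ (4 * k) * (a / 2 * r) ^ (4 * k) \<le> (2 / a) ^ (4 * k) * (real (4 * k) ^ (4 * k) * exp (a / 2 * r))"
        using a by (intro mult_left_mono) (auto simp: mult_right_mono)
      moreover have "(2 / a) ^ (4 * k) * (a / 2 * r) ^ (4 * k) = real n ^ (2 * k)"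
      proof -
        have "(2 / a) ^ (4 * k) * (a / 2 * r) ^ (4 * k) = r ^ (4 * k)"
          using a by (simp add: power_mult_distrib[symmetric])
        also have "\<dots> = (r\<^sup>2) ^ (2 * k)"
          by (simp add: power_mult[symmetric])
        finally show ?thesis
          by (simp only: r(2))
      qed
      moreover have "(2 / a) ^ (4 * k) * (real (4 * k) ^ (4 * k) * exp (a / 2 * r)) = (8 * real k / a) ^ (4 * k) * exp (a / 2 * r)"
        by (simp only: mult.assoc[symmetric] power_mult_distrib[symmetric]) simp
      ultimately show ?thesis
        by linarith
    qed
    ultimately have "pmf p n * real n ^ (2 * k) \<le> (K * exp (- a * r)) * ((8 * real k / a) ^ (4 * k) * exp (a / 2 * r))"
      using K by (intro mult_mono) auto
    also have "\<dots> = K * (8 * real k / a) ^ (4 * k) * (exp (- a * r) * exp (a / 2 * r))"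
      by simp
    also have "exp (- a * r) * exp (a / 2 * r) = exp (- (a / 2) * r)"
      unfolding exp_add[symmetric] by (simp add: field_simps)
    finally show "ennreal (pmf p n) * ennreal (real n ^ (2 * k)) \<le> ennreal (?f n)"
      by (simp add: r_def ennreal_mult[symmetric] ennreal_leI)
  qed auto
  also have "\<dots> = ennreal (\<Sum>n. ?f n)"
    using a K by (intro suminf_ennreal2 summable_mult summable_exp_minus_sqrt) auto
  also have "(\<Sum>n. ?f n) = K * (\<Sum>n. exp (- (a / 2) * sqrt (real n))) * (8 * real k / a) ^ (4 * k)"
    using a by (subst suminf_mult) (auto intro!: summable_exp_minus_sqrt[of "a / 2", simplified])
  finally show ?thesis .
qed

text \<open>The factorial, at least \<open>(k/e)^k\<close>, contributes a second factor
  \<open>k^k\<close>, so the ordinary moment grows like \<open>k^(2 * k)\<close> up to exponential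
  factors; \<open>k^(k - 1) \<ge> (k/2)^k\<close> because \<open>k \<le> 2^k\<close>.\<close>

lemma moment_ge_of_binomial_moment:
  assumes "ennreal (\<gamma> * \<beta> ^ k * real k ^ (k - 1)) \<le> bm k p" "0 < \<gamma>" "0 < \<beta>" "1 \<le> k"
  shows "ennreal (\<gamma> * (\<beta> / (2 * exp 1) * (real k)\<^sup>2) ^ k) \<le> (\<integral>\<^sup>+n. ennreal (real n ^ k) \<partial>measure_pmf p)"
proof -
  have "(real k / 2) ^ k \<le> real k ^ (k - 1)"
  proof -
    have "real k * real k ^ (k - 1) \<le> 2 ^ k * real k ^ (k - 1)"
      using of_nat_less_two_power[of k, where 'a = real] by (intro mult_right_mono) auto
    moreover have "real k * real k ^ (k - 1) = real k ^ k"
      using assms(4) by (cases k) auto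
    ultimately show ?thesis
      by (simp add: power_divide divide_le_eq mult.commute)
  qed
  moreover have "(real k / exp 1) ^ k \<le> fact k"
  proof -
    have "real k ^ k \<le> fact k * exp (real k)"
      by (rule power_le_fact_exp) simp
    moreover have "exp (real k) = exp 1 ^ k"
      by (simp add: exp_of_nat_mult[symmetric])
    ultimately show ?thesis
      by (simp add: power_divide divide_le_eq)
  qed
  ultimately have "(real k / exp 1) ^ k * (\<gamma> * \<beta> ^ k * (real k / 2) ^ k) \<le> fact k * (\<gamma> * \<beta> ^ k * real k ^ (k - 1))"
    using assms by (intro mult_mono mult_left_mono) auto
  moreover have "(real k / exp 1) ^ k * (\<gamma> * \<beta> ^ k * (real k / 2) ^ k) = \<gamma> * (\<beta> / (2 * exp 1) * (real k)\<^sup>2) ^ k"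
  proof -
    have "(real k / exp 1) ^ k * (\<gamma> * \<beta> ^ k * (real k / 2) ^ k) = \<gamma> * (real k / exp 1 * \<beta> * (real k / 2)) ^ k"
      by (simp only: power_mult_distrib mult_ac)
    also have "real k / exp 1 * \<beta> * (real k / 2) = \<beta> / (2 * exp 1) * (real k)\<^sup>2"
      by (simp add: power2_eq_square mult_ac)
    finally show ?thesis .
  qed
  ultimately have "ennreal (\<gamma> * (\<beta> / (2 * exp 1) * (real k)\<^sup>2) ^ k) \<le> ennreal (fact k) * ennreal (\<gamma> * \<beta> ^ k * real k ^ (k - 1))"
    using assms by (simp add: ennreal_mult[symmetric] ennreal_leI)
  also have "\<dots> \<le> ennreal (fact k) * bm k p"
    by (intro mult_left_mono assms) auto
  also have "\<dots> = (\<integral>\<^sup>+n. ennreal (fact k) * of_nat (n choose k) \<partial>measure_pmf p)"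
    by (simp add: bm_def nn_integral_cmult)
  also have "\<dots> \<le> (\<integral>\<^sup>+n. ennreal (real n ^ k) \<partial>measure_pmf p)"
  proof (rule nn_integral_mono)
    fix n
    have "real ((n choose k) * fact k) \<le> real (n ^ k)"
      using binomial_fact_pow[of n k] by (simp only: of_nat_le_iff)
    then show "ennreal (fact k) * of_nat (n choose k) \<le> ennreal (real n ^ k)"
      by (simp add: ennreal_of_nat_eq_real_of_nat ennreal_mult[symmetric] ennreal_leI mult.commute)
  qed
  finally show ?thesis .
qed

text \<open>Paley--Zygmund for the \<open>k\<close>-th power. The constants must not depend on
  \<open>p\<close> or \<open>k\<close>, because the horizon at which the moment bound holds, and
  with it the law \<open>p\<close>, varies with \<open>k\<close>.\<close>

lemma stretched_tail_ge_of_moments: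
  assumes a: "0 < a" and K: "1 \<le> K" and pos: "0 < \<gamma>" "0 < \<beta>"
  obtains s c \<rho> where "0 < s" "0 < c" "0 < \<rho>" "\<rho> \<le> 1"
    "\<And>p k. \<forall>n\<ge>1. measure (measure_pmf p) {n..} \<le> K * exp (- a * sqrt (real n)) \<Longrightarrow> 1 \<le> k \<Longrightarrow>
      ennreal (\<gamma> * \<beta> ^ k * real k ^ (k - 1)) \<le> bm k p \<Longrightarrow>
      c * \<rho> ^ k \<le> measure (measure_pmf p) {n. s * (real k)\<^sup>2 \<le> real n}"
proof -
  define D where "D = K * (\<Sum>n. exp (- (a / 2) * sqrt (real n)))"
  define \<sigma> where "\<sigma> = \<beta> / (2 * exp 1)"
  \<comment> \<open>Since \<open>\<eta>^k \<le> \<eta> \<le> \<gamma> / 2\<close>, values below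
    \<open>\<eta> * \<sigma> * k^2\<close> account for at most half of the lower bound on the
    \<open>k\<close>-th moment.\<close>
  define \<eta> where "\<eta> = min 1 (\<gamma> / 2)"
  define s where "s = \<eta> * \<sigma>"
  define c where "c = (\<gamma> / 2)\<^sup>2 / D"
  \<comment> \<open>The base of the quotient of \<open>(\<sigma> * k^2)^(2 * k)\<close> by
    \<open>(8 * k / a)^(4 * k)\<close>, in which the powers of \<open>k\<close> cancel; the minimum
    with 1 ensures \<open>\<rho> \<le> 1\<close>.\<close>
  define \<rho> where "\<rho> = min 1 (\<sigma>\<^sup>2 * (a / 8) ^ 4)"
  have "0 < (\<Sum>n. exp (- (a / 2) * sqrt (real n)))"
    using a by (intro suminf_pos summable_exp_minus_sqrt) auto
  then have D: "0 < D"
    using K by (simp add: D_def)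
  have \<sigma>: "0 < \<sigma>" and \<eta>: "0 < \<eta>" "\<eta> \<le> 1" "\<eta> \<le> \<gamma> / 2"
    using pos by (auto simp: \<sigma>_def \<eta>_def)
  have spos: "0 < s" "0 < c" "0 < \<rho>" "\<rho> \<le> 1"
    using \<sigma> \<eta> D pos a by (auto simp: s_def c_def \<rho>_def)
  have "c * \<rho> ^ k \<le> measure (measure_pmf p) {n. s * (real k)\<^sup>2 \<le> real n}"
    if tail: "\<forall>n\<ge>1. measure (measure_pmf p) {n..} \<le> K * exp (- a * sqrt (real n))" and k: "1 \<le> k"
      and bm: "ennreal (\<gamma> * \<beta> ^ k * real k ^ (k - 1)) \<le> bm k p" for p k
  proof -
    let ?S = "{n. s * (real k)\<^sup>2 \<le> real n}"
    let ?I = "\<integral>\<^sup>+n. ennreal (real n ^ k) * indicator ?S n \<partial>measure_pmf p"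
    define m where "m = (\<sigma> * (real k)\<^sup>2) ^ k"
    have m: "0 < m"
      using \<sigma> k by (simp add: m_def)
    have "ennreal (\<gamma> * m) \<le> (\<integral>\<^sup>+n. ennreal (real n ^ k) \<partial>measure_pmf p)"
      using moment_ge_of_binomial_moment[OF bm pos k] by (simp add: m_def \<sigma>_def)
    also have "\<dots> \<le> (\<integral>\<^sup>+n. ennreal (real n ^ k) * indicator ?S n + ennreal (\<gamma> / 2 * m) \<partial>measure_pmf p)"
    proof (rule nn_integral_mono)
      fix n
      show "ennreal (real n ^ k) \<le> ennreal (real n ^ k) * indicator ?S n + ennreal (\<gamma> / 2 * m)"
      proof (cases "n \<in> ?S")
        case False
        then have "real n ^ k \<le> (s * (real k)\<^sup>2) ^ k"
          by (intro power_mono) auto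
        also have "\<dots> = \<eta> ^ k * m"
          by (simp add: s_def m_def power_mult_distrib mult.assoc)
        also have "\<dots> \<le> \<gamma> / 2 * m"
          using m k \<eta> power_decreasing[of 1 k \<eta>] by (intro mult_right_mono) auto
        finally show ?thesis
          using False by (simp add: ennreal_leI)
      qed simp
    qed
    also have "\<dots> = ?I + ennreal (\<gamma> / 2 * m)"
      by (simp add: nn_integral_add)
    finally have "ennreal (\<gamma> / 2 * m) + ennreal (\<gamma> / 2 * m) \<le> ennreal (\<gamma> / 2 * m) + ?I"
      using m pos by (simp add: ennreal_plus[symmetric] add.commute del: ennreal_plus)
    then have "ennreal (\<gamma> / 2 * m) \<le> ?I"
      by (subst (asm) ennreal_add_left_cancel_le) simp
    then have "(ennreal (\<gamma> / 2 * m))\<^sup>2 \<le> ?I\<^sup>2"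
      by (intro power_mono) auto
    also have "\<dots> \<le> (\<integral>\<^sup>+n. (ennreal (real n ^ k))\<^sup>2 \<partial>measure_pmf p) * emeasure (measure_pmf p) ?S"
      by (rule second_moment_bound)
    also have "(\<lambda>n. (ennreal (real n ^ k))\<^sup>2) = (\<lambda>n. ennreal (real n ^ (2 * k)))"
      by (simp add: ennreal_power power_mult[symmetric] mult.commute)
    also have "(\<integral>\<^sup>+n. ennreal (real n ^ (2 * k)) \<partial>measure_pmf p) * emeasure (measure_pmf p) ?S \<le>
        ennreal (D * (8 * real k / a) ^ (4 * k)) * emeasure (measure_pmf p) ?S"
      unfolding D_def by (intro mult_right_mono moment_le_of_stretched_tail tail[rule_format] a K) auto
    finally have "(\<gamma> / 2 * m)\<^sup>2 \<le> D * (8 * real k / a) ^ (4 * k) * measure (measure_pmf p) ?S"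
      using m pos D a
      by (simp add: ennreal_power measure_pmf.emeasure_eq_measure ennreal_mult[symmetric])
    moreover have "(\<gamma> / 2 * m)\<^sup>2 = D * (8 * real k / a) ^ (4 * k) * (c * (\<sigma>\<^sup>2 * (a / 8) ^ 4) ^ k)"
    proof -
      have "(8 * real k / a) ^ (4 * k) * (\<sigma>\<^sup>2 * (a / 8) ^ 4) ^ k = ((8 * real k / a) ^ 4 * (\<sigma>\<^sup>2 * (a / 8) ^ 4)) ^ k"
        by (simp only: power_mult power_mult_distrib)
      also have "(8 * real k / a) ^ 4 * (\<sigma>\<^sup>2 * (a / 8) ^ 4) = (\<sigma> * (real k)\<^sup>2)\<^sup>2"
        using a by (simp add: power_mult_distrib power_divide power_mult[symmetric])
      also have "\<dots> ^ k = m\<^sup>2"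
        by (simp only: m_def power_mult[symmetric] mult.commute)
      finally have "(8 * real k / a) ^ (4 * k) * (\<sigma>\<^sup>2 * (a / 8) ^ 4) ^ k = m\<^sup>2" .
      moreover have "D * c = (\<gamma> / 2)\<^sup>2"
        using D by (simp add: c_def)
      ultimately have "(\<gamma> / 2)\<^sup>2 * m\<^sup>2 = (D * c) * ((8 * real k / a) ^ (4 * k) * (\<sigma>\<^sup>2 * (a / 8) ^ 4) ^ k)"
        by (simp only:)
      then show ?thesis
        unfolding power_mult_distrib[of "\<gamma> / 2" m] by (simp only: mult_ac)
    qed
    ultimately have "c * (\<sigma>\<^sup>2 * (a / 8) ^ 4) ^ k \<le> measure (measure_pmf p) ?S"
      using D a k by (simp add: mult_le_cancel_left_pos)
    moreover have "c * \<rho> ^ k \<le> c * (\<sigma>\<^sup>2 * (a / 8) ^ 4) ^ k"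
      using spos by (intro mult_left_mono power_mono) (auto simp: \<rho>_def)
    ultimately show ?thesis
      by linarith
  qed
  with spos show ?thesis
    by (rule that)
qed

context critical_brw
begin

theorem visit_tail_lower_dim4:
  assumes dim: "CARD('d) = 4"
  obtains b B where "0 < b" "0 \<le> B" "\<And>n. b * exp (- B * sqrt (real n)) \<le> visit_tail TYPE('d) \<mu> n"
proof -
  obtain K0 a where K0: "0 < a" "\<And>n. 1 \<le> n \<Longrightarrow> visit_tail TYPE('d) \<mu> n \<le> K0 * exp (- a * sqrt (real n))"
    using visit_tail_upper_dim4[OF dim] by blast
  define K where "K = max 1 K0"
  have tail: "measure (occ \<mu> (replicate N at_origin) {#0 :: int ^ 'd#}) {n..} \<le> K * exp (- a * sqrt (real n))" if "1 \<le> n" for N n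
  proof -
    have "measure (occ \<mu> (replicate N at_origin) {#0 :: int ^ 'd#}) {n..} \<le> visit_tail TYPE('d) \<mu> n"
      by (rule visit_tail_ge)
    also have "\<dots> \<le> K0 * exp (- a * sqrt (real n))"
      by (rule K0(2)[OF that])
    also have "\<dots> \<le> K * exp (- a * sqrt (real n))"
      by (intro mult_right_mono) (auto simp: K_def)
    finally show ?thesis .
  qed
  obtain \<gamma> \<beta> where pos: "0 < \<gamma>" "0 < \<beta>"
    and moment: "\<And>k. 1 \<le> k \<Longrightarrow> \<exists>N. ennreal (\<gamma> * \<beta> ^ k * real k ^ (k - 1)) \<le> bm k (occ \<mu> (replicate N at_origin) {#0 :: int ^ 'd#})"
    using visit_moment_lower_dim4[OF dim] by blast
  have "1 \<le> K"
    by (simp add: K_def)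
  obtain s c \<rho> where s: "0 < s" "0 < c" "0 < \<rho>" "\<rho> \<le> 1"
    and lower: "\<And>p k. \<forall>n\<ge>1. measure (measure_pmf p) {n..} \<le> K * exp (- a * sqrt (real n)) \<Longrightarrow> 1 \<le> k \<Longrightarrow>
      ennreal (\<gamma> * \<beta> ^ k * real k ^ (k - 1)) \<le> bm k p \<Longrightarrow>
      c * \<rho> ^ k \<le> measure (measure_pmf p) {n. s * (real k)\<^sup>2 \<le> real n}"
    using stretched_tail_ge_of_moments[OF K0(1) \<open>1 \<le> K\<close> pos] by blast
  define B where "B = - ln \<rho> / sqrt s"
  have B: "0 \<le> B"
    using s by (simp add: B_def divide_nonpos_pos)
  have "c * \<rho>\<^sup>2 * exp (- B * sqrt (real n)) \<le> visit_tail TYPE('d) \<mu> n" for n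
  proof -
    define t where "t = sqrt (real n) / sqrt s"
    have t: "0 \<le> t" "s * t\<^sup>2 = real n"
      using s by (auto simp: t_def power_divide)
    \<comment> \<open>Rounding up gives \<open>s * k^2 \<ge> n\<close>, and the successor gives
      \<open>k \<ge> 1\<close> also for \<open>n = 0\<close>. Since \<open>k \<le> t + 2\<close>,
      the price is the factor \<open>\<rho>^2\<close>.\<close>
    define k where "k = Suc (nat \<lceil>t\<rceil>)"
    have k: "1 \<le> k" "t \<le> real k" "real k \<le> t + 2"
      using t unfolding k_def by linarith+
    obtain N where N: "ennreal (\<gamma> * \<beta> ^ k * real k ^ (k - 1)) \<le> bm k (occ \<mu> (replicate N at_origin) {#0 :: int ^ 'd#})"
      using moment[OF k(1)] by blast
    have "s * t\<^sup>2 \<le> s * (real k)\<^sup>2"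
      using s t k by (intro mult_left_mono power_mono) auto
    then have sub: "{j. s * (real k)\<^sup>2 \<le> real j} \<subseteq> {n..}"
      using t by auto
    have "exp (- B * sqrt (real n)) = exp (t * ln \<rho>)"
      by (simp add: B_def t_def)
    then have "c * \<rho>\<^sup>2 * exp (- B * sqrt (real n)) = c * exp ((t + 2) * ln \<rho>)"
      using s by (simp add: distrib_right exp_add exp_double)
    also have "\<dots> \<le> c * exp (real k * ln \<rho>)"
    proof -
      have "(t + 2) * ln \<rho> \<le> real k * ln \<rho>"
        using k s by (intro mult_right_mono_neg) auto
      then show ?thesis
        using s by simp
    qed
    also have "\<dots> = c * \<rho> ^ k"
      using s by (simp add: exp_of_nat_mult)
    also have "\<dots> \<le> measure (occ \<mu> (replicate N at_origin) {#0 :: int ^ 'd#}) {j. s * (real k)\<^sup>2 \<le> real j}"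
      using tail by (intro lower k(1) N) blast
    also have "\<dots> \<le> measure (occ \<mu> (replicate N at_origin) {#0 :: int ^ 'd#}) {n..}"
      by (intro measure_pmf.finite_measure_mono sub) auto
    also have "\<dots> \<le> visit_tail TYPE('d) \<mu> n"
      by (rule visit_tail_ge)
    finally show ?thesis .
  qed
  with s B show ?thesis
    by (intro that[of "c * \<rho>\<^sup>2" B]) auto
qed

theorem visit_tail_dim4:
  assumes dim: "CARD('d) = 4"
  shows "exp_minus_Theta (visit_tail TYPE('d) \<mu>) (\<lambda>n. sqrt (real n))"
proof -
  obtain K a where K: "0 < a" "\<And>n. 1 \<le> n \<Longrightarrow> visit_tail TYPE('d) \<mu> n \<le> K * exp (- a * sqrt (real n))"
    using visit_tail_upper_dim4[OF dim] by blast
  obtain b B where b: "0 < b" "0 \<le> B" "\<And>n. b * exp (- B * sqrt (real n)) \<le> visit_tail TYPE('d) \<mu> n"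
    using visit_tail_lower_dim4[OF dim] by blast
  show ?thesis
  proof (rule exp_minus_ThetaI[where a = a and A = K and b = b and B = B])
    show "visit_tail TYPE('d) \<mu> n \<le> 1 - pmf \<mu> 0" if "2 \<le> n" for n
      using visit_tail_antimono[OF that, where 'd = 'd and \<mu> = \<mu>] visit_tail_2_le[where 'd = 'd] by linarith
    show "1 - pmf \<mu> 0 < 1"
      using offspring_0 by simp
  qed (use K b in auto)
qed

theorem visit_tail_low_dim:
  assumes "CARD('d) < 4"
  shows "Theta_from 1 (visit_tail TYPE('d) \<mu>) (\<lambda>n. real n powr (- 2 / (4 - real CARD('d))))"
proof -
  let ?g = "\<lambda>n. real n powr (- 2 / (4 - real CARD('d)))"
  obtain c where c: "0 < c" "\<And>n. 1 \<le> n \<Longrightarrow> c * ?g n \<le> visit_tail TYPE('d) \<mu> n"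
    using visit_tail_lower_low_dim[OF assms] by blast
  obtain C where C: "\<And>n. 1 \<le> n \<Longrightarrow> visit_tail TYPE('d) \<mu> n \<le> C * ?g n"
    using visit_tail_upper_low_dim[OF assms] by blast
  have "c * ?g 1 \<le> C * ?g 1"
    using c(2)[of 1] C[of 1] by linarith
  then have "0 < C"
    using c(1) by simp
  with c C show ?thesis
    unfolding Theta_from_def by blast
qed

end

theorem theorem1p1:
  fixes \<mu> :: "nat pmf"
  assumes "critical \<mu>" and "nontrivial \<mu>" and "subexponential \<mu>"
  shows
    "let p = (\<lambda>n::nat. \<P>(B in brw_law \<mu> (0 :: int ^ 'd::finite). of_nat n \<le> total_visits B 0));
         d = CARD('d)
     in (d < 4 \<longrightarrow> Theta_from 1 p (\<lambda>n. real n powr (- 2 / (4 - real d)))) \<and>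
        (d = 4 \<longrightarrow> exp_minus_Theta p (\<lambda>n. sqrt (real n))) \<and>
        (d > 4 \<longrightarrow> exp_minus_Theta p (\<lambda>n. real n))"
proof -
  interpret critical_offspring \<mu>
    by unfold_locales fact+
  obtain C where "0 < C" "\<And>m (x :: int ^ 'd). hk m x \<le> C * real (Suc m) powr (- real CARD('d) / 2)"
    using hk_upper[where 'd = 'd] by blast
  then interpret critical_brw \<mu> C "TYPE('d)"
    by unfold_locales
  have "(\<lambda>n::nat. \<P>(B in brw_law \<mu> (0 :: int ^ 'd). of_nat n \<le> total_visits B 0)) = visit_tail TYPE('d) \<mu>"
    by (simp add: fun_eq_iff visit_tail_def)
  then show ?thesis
    using visit_tail_low_dim visit_tail_dim4 visit_tail_high_dim[where 'd = 'd]
    by (simp add: Let_def Suc_le_eq)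
qed

end
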